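(* Let $M_n$ denote the length of the largest interval after $n$ steps of Kakutani's interval-splitting process, and let $\sigma^2 := 16\log 2 - 10$. There exists a constant $C\in[0,\infty)$ such that for every $n\in\mathbb N=\{1,2,\dots\}$, \[ \sup_{x\in\mathbb R}\left|\Pr\left(\sqrt{\frac{n^3}{\sigma^2}}\left(M_n-\frac{2}{n}\right)\le x\right)-\Phi(x)\right|\le \frac{C}{\sqrt n}. \]
   Context: Kakutani's interval-splitting process: let $U_1,U_2,\dots$ be i.i.d. uniform random variables on $[0,1]$. At time $0$ the partition of $[0,1]$ consists of the single interval $[0,1]$. Given the partition at time $n\in\mathbb Z_+$ (which consists of $n+1$ intervals, whose lengths are a.s. distinct), let $[a,b]$ be the interval of maximal length; the partition at time $n+1$ is obtained by replacing $[a,b]$ by the two intervals $[a,a+U_{n+1}(b-a)]$ and $[a+U_{n+1}(b-a),b]$. Write $L_{n,1},\dots,L_{n,n+1}$ for the lengths of the $n+1$ intervals at time $n$ (in left-to-right order), $M_n:=\max_i L_{n,i}$ and $m_n:=\min_i L_{n,i}$. $\Phi$ is the standard normal distribution function. *)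

theory Defs
  imports "HOL-Probability.Probability"
begin

text \<open>Kakutani's interval-splitting process, driven by a sequence u of splitting
  values (u (n+1) is used at step n+1).  The state at time n is the list of the
  n+1 interval lengths in left-to-right order.  The interval to split is the
  (first) one of maximal length; ties occur only with probability 0.\<close>

fun kakutani_lengths :: "(nat \<Rightarrow> real) \<Rightarrow> nat \<Rightarrow> real list" where
  "kakutani_lengths u 0 = [1]"
| "kakutani_lengths u (Suc n) =
     (let ls = kakutani_lengths u n;
          i = (LEAST i. i < length ls \<and> ls ! i = Max (set ls))
      in take i ls @ [u (Suc n) * (ls ! i), (1 - u (Suc n)) * (ls ! i)] @ drop (Suc i) ls)"

definition kakutani_max :: "(nat \<Rightarrow> real) \<Rightarrow> nat \<Rightarrow> real" where
  "kakutani_max u n = Max (set (kakutani_lengths u n))"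

definition Phi :: "real \<Rightarrow> real" where
  "Phi x = measure (density lborel std_normal_density) {..x}"

end

theory Submission
  imports Defs "HOL-Real_Asymp.Real_Asymp"
begin

text \<open>
  The largest interval is at most \<open>t\<close> after \<open>n\<close> steps iff at most \<open>n\<close> splits are needed to bring
  all intervals below \<open>t\<close>. The order of the splits does not matter for their number, so the number of
  final pieces of an interval of length \<open>x = 1 / t\<close> (with threshold 1) satisfies a distributional
  recursion: its centred characteristic function \<open>f\<close> solves \<open>x f(x) = (f * f)(x)\<close> for \<open>x > 1\<close>,
  with an explicit \<open>f\<close> on \<open>[0, 1]\<close>. Every exponential solves the same equation exactly, and the Gaussian
  guess \<open>g\<close> built from the mean \<open>2 x\<close> and the variance \<open>(8 ln 2 - 5) x\<close> (for \<open>x \<ge> 2\<close>) solves it up to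
  an error of third order in the frequency, because mean and variance satisfy the moment recursions.
  A Gronwall argument for the averaged equation, combined with exponential decay of \<open>|f|\<close> from an
  explicit supersolution, bounds \<open>f - g\<close>; Esseen's smoothing inequality then gives a Berry--Esseen
  bound for the number of splits, which is inverted to obtain the one for the largest interval.
\<close>

section \<open>Averaged Gronwall inequality\<close>

text \<open>With only \<open>|f| \<le> 1\<close> the Gronwall bound on \<open>f - g\<close> grows
  like \<theta>^3 x, which is useless in Esseen's integral, where \<theta> reaches a fixed angle
  while x tends to infinity. A factor exp (- c \<theta>^2 x) has to be carried through the argument.
  It originates in the variance already present on [3/2, 2] and spreads to all larger x by
  comparison with a perturbed exponential. Angles below a fixed constant suffice: after
  normalisation by a multiple of sqrt x they give a cut-off of order sqrt x, whose reciprocal is the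
  error aimed at. The centring is rigid: the pieces are one more than the splits and their mean is
  exactly 2 x for x > 1. As the variance is exactly linear from 2 on, the Gaussian guess fails only
  where one of the two pieces has length at most 2, so its residual does not grow with x. The value
  2 (8 ln 2 - 5) of \<open>\<sigma>\<^sup>2\<close> arises on inversion. A threshold near 2 / n
  means x near n / 2, where the count has variance about (8 ln 2 - 5) n / 2, and a relative change
  \<tau> of the threshold shifts the mean count by about n \<tau>.\<close>

lemma set_integrable_lborel_bounded:
  fixes f :: "real \<Rightarrow> 'b::{banach, second_countable_topology}"
  assumes [measurable]: "f \<in> borel_measurable borel"
    and "\<And>y. y \<in> {a..b} \<Longrightarrow> norm (f y) \<le> B"
  shows "set_integrable lborel {a..b} f"
proof -
  have *: "set_integrable lborel {a..b} (\<lambda>_. B)"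
    by (intro borel_integrable_atLeastAtMost') auto
  show ?thesis
    by (rule set_integrable_bound[OF *]) (use assms(2) in \<open>force simp: set_borel_measurable_def\<close>)+
qed

lemma set_integral_reflect:
  fixes h :: "real \<Rightarrow> 'b::{banach, second_countable_topology}"
  shows "(LBINT y:{0..x}. h (x - y)) = (LBINT y:{0..x}. h y)"
  unfolding set_lebesgue_integral_def
  by (subst lborel_integral_real_affine[where c = "-1" and t = x])
     (auto intro!: Bochner_Integration.integral_cong simp: indicator_def)

lemma set_integral_powr:
  fixes A :: real
  assumes "0 < x0" "x0 \<le> x" "A \<noteq> 0"
  shows "(LBINT y:{x0..x}. y powr (A - 1)) = (x powr A - x0 powr A) / A"
proof -
  have "(LBINT y. y powr (A - 1) * indicator {x0..x} y) = x powr A / A - x0 powr A / A"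
    using assms
    by (intro integral_FTC_Icc_real)
       (auto intro!: derivative_eq_intros continuous_intros simp: field_simps powr_diff)
  then show ?thesis
    by (simp add: set_lebesgue_integral_def mult.commute diff_divide_distrib)
qed

text \<open>The power u^(A-1) reproduces itself: A times its integral from x0 to x is x * x^(A-1) -
  x0^A. So if s is the best constant in b \<le> s y^(A-1), inserting this bound gives back s minus a
  gain proportional to s x0^A - E, and a positive gain contradicts the choice of s. The bound
  \<open>B\<close> makes s finite; the bounded range up to \<open>X\<close> makes the gain
  uniform.\<close>

lemma gronwall_averaged:
  fixes b :: "real \<Rightarrow> real"
  assumes "0 < x0" "0 < A" "0 \<le> E"
    and [measurable]: "b \<in> borel_measurable borel"
    and nonneg: "\<And>y. 0 \<le> b y"
    and zero: "\<And>y. y \<le> x0 \<Longrightarrow> b y = 0"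
    and bdd: "\<And>y. y \<le> X \<Longrightarrow> b y \<le> B"
    and rec: "\<And>x. x0 < x \<Longrightarrow> x \<le> X \<Longrightarrow> x * b x \<le> A * (LBINT y:{0..x}. b y) + E"
    and "x0 < x" "x \<le> X"
  shows "b x \<le> E / x0 powr A * x powr (A - 1)"
proof -
  define R where "R = (\<lambda>y. b y / y powr (A - 1)) ` {x0<..X}"
  define s where "s = Sup R"
  have ne: "R \<noteq> {}"
    using assms by (auto simp: R_def)
  have bdd_R: "bdd_above R"
  proof -
    \<comment> \<open>The exponent A - 1 may have either sign, so the weight is bounded below by its
      value at the end of the interval where it is smaller.\<close>
    define m where "m = min (x0 powr (A - 1)) (X powr (A - 1))"
    have "m > 0"
      using assms by (auto simp: m_def)
    have "b y / y powr (A - 1) \<le> B / m" if "x0 < y" "y \<le> X" for y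
    proof -
      have "m \<le> y powr (A - 1)"
      proof (cases "A \<ge> 1")
        case True
        then have "x0 powr (A - 1) \<le> y powr (A - 1)"
          using that assms by (intro powr_mono2) auto
        then show ?thesis by (auto simp: m_def)
      next
        case False
        then have "X powr (A - 1) \<le> y powr (A - 1)"
          using that assms by (intro powr_mono2') auto
        then show ?thesis by (auto simp: m_def)
      qed
      then show ?thesis
        using that \<open>m > 0\<close> bdd[of y] nonneg[of y] by (intro frac_le) auto
    qed
    then show ?thesis
      unfolding R_def by (intro bdd_aboveI[where M = "B / m"]) auto
  qed
  have le_s: "b y \<le> s * y powr (A - 1)" if "x0 < y" "y \<le> X" for y
  proof -
    have "b y / y powr (A - 1) \<le> s"
      unfolding s_def using that by (intro cSup_upper bdd_R) (auto simp: R_def)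
    then show ?thesis
      using that assms by (simp add: field_simps)
  qed
  have "s \<le> E / x0 powr A"
  proof (rule ccontr)
    assume "\<not> s \<le> E / x0 powr A"
    then have gap: "s * x0 powr A - E > 0"
      using assms by (simp add: field_simps)
    \<comment> \<open>The improved bound: the term subtracted from s is positive and does not depend
      on y.\<close>
    have "b y / y powr (A - 1) \<le> s - (s * x0 powr A - E) / X powr A" if y: "x0 < y" "y \<le> X" for y
    proof -
      have "(LBINT u:{0..y}. b u) = (LBINT u:{x0..y}. b u)"
        unfolding set_lebesgue_integral_def
        using zero \<open>0 < x0\<close> by (intro Bochner_Integration.integral_cong) (auto simp: indicator_def not_le)
      also have "\<dots> \<le> (LBINT u:{x0..y}. s * u powr (A - 1))"
      proof (rule set_integral_mono)
        show "set_integrable lborel {x0..y} b"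
          using bdd nonneg y by (intro set_integrable_lborel_bounded[where B = B]) auto
        show "set_integrable lborel {x0..y} (\<lambda>u. s * u powr (A - 1))"
          using assms by (intro borel_integrable_atLeastAtMost') (auto intro!: continuous_intros)
        have "s \<ge> 0"
        proof -
          have "0 \<le> E" by fact
          then have "s * x0 powr A > 0" using gap by linarith
          then show ?thesis using \<open>0 < x0\<close> by (simp add: zero_less_mult_iff)
        qed
        then show "\<And>u. u \<in> {x0..y} \<Longrightarrow> b u \<le> s * u powr (A - 1)"
          using le_s zero y by (metis atLeastAtMost_iff less_eq_real_def mult_nonneg_nonneg order.trans powr_ge_zero)
      qed
      also have "\<dots> = s * ((y powr A - x0 powr A) / A)"
        using assms y by (simp add: set_integral_powr)
      finally have "A * (LBINT u:{0..y}. b u) \<le> s * (y powr A - x0 powr A)"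
        using \<open>0 < A\<close> by (simp add: field_simps)
      then have *: "y * b y \<le> s * y powr A - (s * x0 powr A - E)"
        using rec[OF y] by (simp add: algebra_simps)
      have ypos: "y powr A > 0" "y > 0"
        using y assms by auto
      have "b y / y powr (A - 1) = y * b y / y powr A"
        using ypos by (simp add: powr_diff field_simps)
      also have "\<dots> \<le> (s * y powr A - (s * x0 powr A - E)) / y powr A"
        using * ypos by (intro divide_right_mono) auto
      also have "\<dots> = s - (s * x0 powr A - E) / y powr A"
        using ypos by (simp add: field_simps)
      also have "\<dots> \<le> s - (s * x0 powr A - E) / X powr A"
        using gap y assms ypos
        by (intro diff_left_mono divide_left_mono powr_mono2) auto
      finally show ?thesis .
    qed
    then have "s \<le> s - (s * x0 powr A - E) / X powr A"
      unfolding s_def by (intro cSup_least ne) (auto simp: R_def)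
    moreover have "(s * x0 powr A - E) / X powr A > 0"
      using gap assms by auto
    ultimately show False by linarith
  qed
  then have "s * x powr (A - 1) \<le> E / x0 powr A * x powr (A - 1)"
    by (intro mult_right_mono) auto
  then show ?thesis
    using le_s[OF \<open>x0 < x\<close> \<open>x \<le> X\<close>] by linarith
qed

section \<open>Number of splits of a single interval\<close>

text \<open>The law of the number of splits with threshold 1, conditioned on the first split: its
  position is uniform on [0, x], and the two pieces then need k further splits together. The law is
  introduced as an analytic recursion, free of any probability space;
  \<open>prob_kakutani_max_le\<close> later connects it with the process.\<close>

fun split_prob :: "nat \<Rightarrow> real \<Rightarrow> real" where
  "split_prob 0 x = (if x \<le> 1 then 1 else 0)"
| "split_prob (Suc k) x = (if x \<le> 1 then 0 else
     (LBINT y:{0..x}. (\<Sum>i\<le>k. split_prob i y * split_prob (k - i) (x - y))) / x)"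

declare split_prob.simps(2)[simp del]

lemma split_prob_le_1: "x \<le> 1 \<Longrightarrow> split_prob k x = (if k = 0 then 1 else 0)"
  by (cases k) (auto simp: split_prob.simps)

lemma measurable_split_prob[measurable]: "split_prob k \<in> borel_measurable borel"
proof (induction k rule: less_induct)
  case (less k)
  show ?case
  proof (cases k)
    case 0
    then show ?thesis by simp
  next
    case (Suc j)
    have IH[measurable]: "split_prob i \<in> borel_measurable borel" if "i \<le> j" for i
      using less[of i] that Suc by simp
    have *: "(\<lambda>z. if 0 \<le> snd z \<and> snd z \<le> fst z then
                   (\<Sum>i\<in>{..j}. split_prob i (snd z) * split_prob (j - i) (fst z - snd z)) else 0)
          \<in> borel_measurable (borel \<Otimes>\<^sub>M lborel)"
    proof (intro measurable_If borel_measurable_sum borel_measurable_times)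
      fix i assume "i \<in> {..j}"
      then have "i \<le> j" "j - i \<le> j" by auto
      note [measurable] = IH[OF this(1)] IH[OF this(2)]
      show "(\<lambda>z. split_prob i (snd z)) \<in> borel_measurable (borel \<Otimes>\<^sub>M lborel)"
        "(\<lambda>z. split_prob (j - i) (fst z - snd z)) \<in> borel_measurable (borel \<Otimes>\<^sub>M lborel)"
        by measurable
    qed measurable
    have **: "(\<lambda>x. \<integral>y. (if 0 \<le> y \<and> y \<le> x then
                   (\<Sum>i\<in>{..j}. split_prob i y * split_prob (j - i) (x - y)) else 0) \<partial>lborel)
          \<in> borel_measurable borel"
      by (rule lborel.borel_measurable_lebesgue_integral) (use * in \<open>simp add: case_prod_beta\<close>)
    have "split_prob k = (\<lambda>x. if x \<le> 1 then 0 else (\<integral>y. (if 0 \<le> y \<and> y \<le> x then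
                   (\<Sum>i\<in>{..j}. split_prob i y * split_prob (j - i) (x - y)) else 0) \<partial>lborel) / x)"
      by (auto simp: fun_eq_iff Suc split_prob.simps set_lebesgue_integral_def
          intro!: Bochner_Integration.integral_cong)
    then show ?thesis
      using ** by simp
  qed
qed

lemma split_prob_nonneg: "0 \<le> split_prob k x"
proof (induction k arbitrary: x rule: less_induct)
  case (less k)
  show ?case
  proof (cases k)
    case (Suc j)
    have "0 \<le> (LBINT y:{0..x}. (\<Sum>i\<le>j. split_prob i y * split_prob (j - i) (x - y)))"
      unfolding set_lebesgue_integral_def using less Suc
      by (intro integral_nonneg_AE AE_I2) (auto intro!: sum_nonneg mult_nonneg_nonneg)
    then show ?thesis
      by (simp add: Suc split_prob.simps)
  qed auto
qed

lemma sum_cauchy_le_mult_sum: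
  fixes a b :: "nat \<Rightarrow> real"
  assumes "\<And>i. 0 \<le> a i" "\<And>i. 0 \<le> b i"
  shows "(\<Sum>k\<le>n. \<Sum>i\<le>k. a i * b (k - i)) \<le> (\<Sum>i\<le>n. a i) * (\<Sum>i\<le>n. b i)"
proof -
  have "(\<Sum>k\<le>n. \<Sum>i\<le>k. a i * b (k - i)) = (\<Sum>(i, j)\<in>{(i, j). i + j \<le> n}. a i * b j)"
    by (simp add: sum.triangle_reindex_eq)
  also have "\<dots> \<le> (\<Sum>(i, j)\<in>{..n} \<times> {..n}. a i * b j)"
    using assms by (intro sum_mono2) auto
  also have "\<dots> = (\<Sum>i\<le>n. a i) * (\<Sum>i\<le>n. b i)"
    by (simp add: sum_product sum.cartesian_product)
  finally show ?thesis .
qed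

lemma set_integral_sum_finite:
  fixes f :: "'i \<Rightarrow> 'a \<Rightarrow> 'b::{banach, second_countable_topology}"
  assumes "\<And>i. i \<in> I \<Longrightarrow> set_integrable M A (f i)"
  shows "(LINT x:A|M. (\<Sum>i\<in>I. f i x)) = (\<Sum>i\<in>I. LINT x:A|M. f i x)"
  using assms unfolding set_lebesgue_integral_def set_integrable_def
  by (simp add: scaleR_sum_right)

lemma split_prob_bounded_aux:
  assumes "\<And>x. (\<Sum>k\<le>n. split_prob k x) \<le> 1"
  shows "(\<Sum>k\<le>n. \<Sum>i\<le>k. split_prob i y * split_prob (k - i) z) \<le> 1"
proof -
  have "(\<Sum>k\<le>n. \<Sum>i\<le>k. split_prob i y * split_prob (k - i) z)
      \<le> (\<Sum>i\<le>n. split_prob i y) * (\<Sum>i\<le>n. split_prob i z)"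
    by (intro sum_cauchy_le_mult_sum split_prob_nonneg)
  also have "\<dots> \<le> 1"
    using assms[of y] assms[of z] by (intro mult_le_one sum_nonneg split_prob_nonneg)
  finally show ?thesis .
qed

lemma split_prob_conv_le_1:
  assumes "\<And>x. (\<Sum>k\<le>n. split_prob k x) \<le> 1" "k \<le> n"
  shows "norm (\<Sum>i\<le>k. split_prob i y * split_prob (k - i) z) \<le> 1"
proof -
  have "(\<Sum>i\<le>k. split_prob i y * split_prob (k - i) z)
      \<le> (\<Sum>k\<le>n. \<Sum>i\<le>k. split_prob i y * split_prob (k - i) z)"
    using assms(2) by (intro member_le_sum) (auto intro!: sum_nonneg split_prob_nonneg mult_nonneg_nonneg)
  also have "\<dots> \<le> 1"
    using assms(1) by (rule split_prob_bounded_aux)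
  finally show ?thesis
    by (simp add: sum_nonneg split_prob_nonneg)
qed

lemma split_prob_conv_integrable:
  assumes "\<And>x. (\<Sum>k\<le>n. split_prob k x) \<le> 1" "k \<le> n"
  shows "set_integrable lborel {a..b} (\<lambda>y. \<Sum>i\<le>k. split_prob i y * split_prob (k - i) (x - y))"
  by (rule set_integrable_lborel_bounded[OF _ split_prob_conv_le_1[OF assms]]) measurable

text \<open>Summed over k, the recursion averages truncated Cauchy products. These are at most the
  product of the partial sums, since a triangle of index pairs lies in a square, so the bound 1
  passes from n to n + 1 for all x simultaneously.\<close>

lemma sum_split_prob_le_1: "(\<Sum>k\<le>n. split_prob k x) \<le> 1"
proof (induction n arbitrary: x)
  case (Suc n)
  show ?case
  proof (cases "x \<le> 1")
    case True
    then show ?thesis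
      by (simp add: split_prob_le_1 sum.delta)
  next
    case False
    have "(\<Sum>k\<le>Suc n. split_prob k x) = (\<Sum>k\<le>n. split_prob (Suc k) x)"
      using False by (subst sum.atMost_Suc_shift) simp
    also have "\<dots> = (\<Sum>k\<le>n. (LBINT y:{0..x}. (\<Sum>i\<le>k. split_prob i y * split_prob (k - i) (x - y)))) / x"
      using False by (simp add: split_prob.simps(2) sum_divide_distrib)
    also have "(\<Sum>k\<le>n. (LBINT y:{0..x}. (\<Sum>i\<le>k. split_prob i y * split_prob (k - i) (x - y)))) =
        (LBINT y:{0..x}. (\<Sum>k\<le>n. \<Sum>i\<le>k. split_prob i y * split_prob (k - i) (x - y)))"
      using Suc by (subst set_integral_sum_finite) (auto intro!: split_prob_conv_integrable)
    also have "\<dots> \<le> (LBINT y:{0..x}. 1)"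
    proof (rule set_integral_mono)
      show "set_integrable lborel {0..x} (\<lambda>y. \<Sum>k\<le>n. \<Sum>i\<le>k. split_prob i y * split_prob (k - i) (x - y))"
        using Suc by (intro set_integrable_lborel_bounded[where B = 1])
          (auto simp: sum_nonneg split_prob_nonneg split_prob_bounded_aux)
      show "set_integrable lborel {0..x} (\<lambda>y. 1::real)"
        by (intro set_integrable_lborel_bounded[where B = 1]) auto
    qed (use Suc split_prob_bounded_aux in auto)
    also have "\<dots> = x"
      using False by (simp add: set_integral_const)
    finally show ?thesis
      using False by (simp add: divide_le_eq_1 divide_right_mono)
  qed
qed auto

lemma sum_lessThan_split_prob_le_1: "(\<Sum>k<n. split_prob k x) \<le> 1"
proof -
  have "(\<Sum>k<n. split_prob k x) \<le> (\<Sum>k\<le>n. split_prob k x)"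
    by (intro sum_mono2 split_prob_nonneg) auto
  also have "\<dots> \<le> 1"
    by (rule sum_split_prob_le_1)
  finally show ?thesis .
qed

lemma summable_split_prob: "summable (\<lambda>k. split_prob k x)"
  by (rule summableI_nonneg_bounded[OF split_prob_nonneg sum_lessThan_split_prob_le_1])

section \<open>Generating function of the number of splits\<close>

definition split_gf :: "'a::{real_normed_field, banach, second_countable_topology} \<Rightarrow> real \<Rightarrow> 'a" where
  "split_gf z x = (\<Sum>k. split_prob k x *\<^sub>R z ^ k)"

context
  fixes z :: "'a::{real_normed_field, banach, second_countable_topology}"
  assumes z: "norm z \<le> 1"
begin

lemma norm_split_prob_scaleR_le: "norm (split_prob k x *\<^sub>R z ^ k) \<le> split_prob k x"
  using z power_le_one[of "norm z" k] split_prob_nonneg[of k x]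
  by (simp add: norm_power mult_left_le)

lemma summable_norm_split_gf: "summable (\<lambda>k. norm (split_prob k x *\<^sub>R z ^ k))"
  by (rule summable_comparison_test[OF _ summable_split_prob[of x]])
     (use norm_split_prob_scaleR_le in auto)

lemma split_gf_sums: "(\<lambda>k. split_prob k x *\<^sub>R z ^ k) sums split_gf z x"
  unfolding split_gf_def
  by (rule summable_sums[OF summable_norm_cancel[OF summable_norm_split_gf]])

lemma norm_split_gf_le_1: "norm (split_gf z x) \<le> 1"
proof -
  have "norm (split_gf z x) \<le> (\<Sum>k. norm (split_prob k x *\<^sub>R z ^ k))"
    unfolding split_gf_def by (rule summable_norm[OF summable_norm_split_gf])
  also have "\<dots> \<le> (\<Sum>k. split_prob k x)"
    by (intro suminf_le norm_split_prob_scaleR_le summable_norm_split_gf summable_split_prob)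
  also have "\<dots> \<le> 1"
    by (intro suminf_le_const summable_split_prob)
       (rule sum_lessThan_split_prob_le_1)
  finally show ?thesis .
qed

lemma measurable_split_gf[measurable]: "split_gf z \<in> borel_measurable borel"
  unfolding split_gf_def[abs_def] by measurable

lemma split_gf_le_1: "x \<le> 1 \<Longrightarrow> split_gf z x = 1"
proof -
  assume "x \<le> 1"
  then have "(\<lambda>k. split_prob k x *\<^sub>R z ^ k) = (\<lambda>k. if k = 0 then 1 else 0)"
    by (auto simp: split_prob_le_1)
  then show ?thesis
    using split_gf_sums[of x] sums_single[of 0 "\<lambda>_. 1::'a"] by (metis sums_unique2)
qed

text \<open>Generating functions turn the inner Cauchy product into a pointwise product; the factor
  z in front accounts for the first split.\<close>

lemma split_gf_convolution:
  assumes "x > 1"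
  shows "of_real x * split_gf z x = z * (LBINT y:{0..x}. split_gf z y * split_gf z (x - y))"
proof -
  define c where "c k y = (\<Sum>i\<le>k. (split_prob i y *\<^sub>R z ^ i) * (split_prob (k - i) (x - y) *\<^sub>R z ^ (k - i)))" for k y
  have c_eq: "c k y = (\<Sum>i\<le>k. split_prob i y * split_prob (k - i) (x - y)) *\<^sub>R z ^ k" for k y
    unfolding c_def scaleR_sum_left
    by (intro sum.cong) (auto simp: power_add[symmetric])
  have c_sums: "(\<lambda>k. c k y) sums (split_gf z y * split_gf z (x - y))" for y
    unfolding c_def split_gf_def by (intro Cauchy_product_sums summable_norm_split_gf)
  have c_int: "(LBINT y:{0..x}. c k y) = (x * split_prob (Suc k) x) *\<^sub>R z ^ k" for k
  proof -
    have "(LBINT y:{0..x}. c k y) =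
        (LBINT y. (indicator {0..x} y * (\<Sum>i\<le>k. split_prob i y * split_prob (k - i) (x - y))) *\<^sub>R z ^ k)"
      unfolding c_eq set_lebesgue_integral_def by simp
    also have "\<dots> = (LBINT y:{0..x}. (\<Sum>i\<le>k. split_prob i y * split_prob (k - i) (x - y))) *\<^sub>R z ^ k"
      using split_prob_conv_integrable[OF sum_split_prob_le_1 order_refl, of 0 x k x]
      by (subst integral_scaleR_left) (auto simp: set_lebesgue_integral_def set_integrable_def)
    also have "\<dots> = (x * split_prob (Suc k) x) *\<^sub>R z ^ k"
      using assms by (simp add: split_prob.simps(2))
    finally show ?thesis .
  qed
  have c_integrable: "set_integrable lborel {0..x} (c k)" for k
  proof -
    have "integrable lborel
        (\<lambda>y. (indicator {0..x} y * (\<Sum>i\<le>k. split_prob i y * split_prob (k - i) (x - y))) *\<^sub>R z ^ k)"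
      using split_prob_conv_integrable[OF sum_split_prob_le_1 order_refl, of 0 x k x]
      by (intro integrable_scaleR_left) (simp add: set_integrable_def)
    then show ?thesis
      unfolding c_eq set_integrable_def by simp
  qed
  have [measurable]: "c k \<in> borel_measurable borel" for k
    unfolding c_def by measurable
  \<comment> \<open>Dominated convergence needs a bound on whole partial sums, uniform in n; the
    truncated Cauchy product estimate supplies 1.\<close>
  have norm_partial: "norm (\<Sum>k<n. c k y) \<le> 1" for n y
  proof -
    have "norm (\<Sum>k<n. c k y) \<le> (\<Sum>k<n. (\<Sum>i\<le>k. split_prob i y * split_prob (k - i) (x - y)))"
    proof (rule order_trans[OF norm_sum sum_mono])
      fix k
      show "norm (c k y) \<le> (\<Sum>i\<le>k. split_prob i y * split_prob (k - i) (x - y))"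
        unfolding c_eq using z power_le_one[of "norm z" k]
        by (simp add: norm_power mult_left_le sum_nonneg split_prob_nonneg)
    qed
    also have "\<dots> \<le> (\<Sum>k\<le>n. (\<Sum>i\<le>k. split_prob i y * split_prob (k - i) (x - y)))"
      by (intro sum_mono2 sum_nonneg mult_nonneg_nonneg split_prob_nonneg) auto
    also have "\<dots> \<le> 1"
      by (intro split_prob_bounded_aux sum_split_prob_le_1)
    finally show ?thesis .
  qed
  have "(\<lambda>n. \<integral>y. indicator {0..x} y *\<^sub>R (\<Sum>k<n. c k y) \<partial>lborel)
      \<longlonglongrightarrow> (\<integral>y. indicator {0..x} y *\<^sub>R (split_gf z y * split_gf z (x - y)) \<partial>lborel)"
  proof (rule integral_dominated_convergence[where w = "\<lambda>y. indicator {0..x} y *\<^sub>R 1"])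
    show "integrable lborel (\<lambda>y. indicator {0..x} y *\<^sub>R (1::real))"
      using set_integrable_lborel_bounded[of "\<lambda>_. 1::real" 0 x 1] by (simp add: set_integrable_def)
    show "AE y in lborel. (\<lambda>n. indicator {0..x} y *\<^sub>R (\<Sum>k<n. c k y))
        \<longlonglongrightarrow> indicator {0..x} y *\<^sub>R (split_gf z y * split_gf z (x - y))"
      using c_sums by (intro AE_I2 tendsto_scaleR tendsto_const) (auto simp: sums_def)
    show "AE y in lborel. norm (indicator {0..x} y *\<^sub>R (\<Sum>k<n. c k y)) \<le> indicator {0..x} y *\<^sub>R 1" for n
      using norm_partial by (intro AE_I2) (auto simp: indicator_def)
  qed measurable
  moreover have "(\<integral>y. indicator {0..x} y *\<^sub>R (\<Sum>k<n. c k y) \<partial>lborel)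
      = (\<Sum>k<n. (x * split_prob (Suc k) x) *\<^sub>R z ^ k)" for n
    using set_integral_sum_finite[of "{..<n}" lborel "{0..x}" c] c_integrable
    by (simp add: c_int[unfolded set_lebesgue_integral_def] set_lebesgue_integral_def)
  ultimately have "(\<lambda>k. (x * split_prob (Suc k) x) *\<^sub>R z ^ k) sums (LBINT y:{0..x}. split_gf z y * split_gf z (x - y))"
    by (simp add: sums_def set_lebesgue_integral_def)
  then have "(\<lambda>k. z * ((x * split_prob (Suc k) x) *\<^sub>R z ^ k))
      sums (z * (LBINT y:{0..x}. split_gf z y * split_gf z (x - y)))"
    by (rule sums_mult)
  moreover have "(\<lambda>k. of_real x * (split_prob (Suc k) x *\<^sub>R z ^ Suc k)) sums (of_real x * split_gf z x)"
    using split_gf_sums[of x] assms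
    by (intro sums_mult iffD2[OF sums_Suc_iff[of "\<lambda>k. split_prob k x *\<^sub>R z ^ k"]]) simp
  ultimately show ?thesis
    by (simp add: scaleR_conv_of_real mult_ac sums_unique2)
qed

end

text \<open>Splitting stops almost surely. The missing mass b satisfies 1 - (1 - p) (1 - q) \<le> p
  + q under the convolution, hence x b(x) is at most twice the integral of b, and Gronwall with E =
  0 gives b = 0. This is the use of \<open>split_gf\<close> at the real argument 1; the complex
  arguments \<open>cis \<theta>\<close> serve for the characteristic function.\<close>

lemma suminf_split_prob: "(\<Sum>k. split_prob k x) = 1"
proof -
  define b where "b x = 1 - split_gf (1::real) x" for x
  have S: "split_gf 1 x = (\<Sum>k. split_prob k x)" for x
    by (simp add: split_gf_def)
  have S0: "0 \<le> split_gf (1::real) x" for x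
    unfolding S by (intro suminf_nonneg summable_split_prob split_prob_nonneg)
  have S1: "split_gf (1::real) x \<le> 1" for x
    using norm_split_gf_le_1[of "1::real" x] by simp
  have [measurable]: "split_gf (1::real) \<in> borel_measurable borel"
    by (rule measurable_split_gf) simp
  have int: "set_integrable lborel {0..y} (\<lambda>u. split_gf (1::real) u * split_gf 1 (y - u))"
    "set_integrable lborel {0..y} (split_gf (1::real))" 
    "set_integrable lborel {0..y} (\<lambda>u. split_gf (1::real) (y - u))" 
    "set_integrable lborel {0..y} b" "set_integrable lborel {0..y} (\<lambda>u. b (y - u))" for y
    using S0 S1 unfolding b_def by (auto intro!: set_integrable_lborel_bounded[where B = 1] mult_le_one)
  show ?thesis
  proof (cases "x \<le> 1")
    case True
    then show ?thesis using split_gf_le_1[of "1::real" x] S by simp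
  next
    case False
    have "b x \<le> 0 / 1 powr 2 * x powr (2 - 1)"
    proof (rule gronwall_averaged[where X = x and B = 1])
      show "b \<in> borel_measurable borel" unfolding b_def by measurable
      show "0 \<le> b y" "b y \<le> 1" for y using S0 S1 by (auto simp: b_def)
      show "b y = 0" if "y \<le> 1" for y using that by (simp add: b_def split_gf_le_1)
      show "y * b y \<le> 2 * (LBINT u:{0..y}. b u) + 0" if "1 < y" for y
      proof -
        have "y * b y = (LBINT u:{0..y}. 1) - (LBINT u:{0..y}. split_gf (1::real) u * split_gf 1 (y - u))"
          using split_gf_convolution[of "1::real" y] that
          by (simp add: b_def algebra_simps set_integral_const)
        also have "\<dots> = (LBINT u:{0..y}. 1 - split_gf (1::real) u * split_gf 1 (y - u))"
          by (subst set_integral_diff) (auto intro!: int set_integrable_lborel_bounded[where B = 1])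
        also have "\<dots> \<le> (LBINT u:{0..y}. b u + b (y - u))"
        proof (rule set_integral_mono)
          show "set_integrable lborel {0..y} (\<lambda>u. 1 - split_gf (1::real) u * split_gf 1 (y - u))"
            by (intro set_integral_diff int set_integrable_lborel_bounded[where B = 1]) auto
          show "set_integrable lborel {0..y} (\<lambda>u. b u + b (y - u))"
            by (intro set_integral_add int)
          fix u
          have "0 \<le> b u * b (y - u)" using S1 by (intro mult_nonneg_nonneg) (auto simp: b_def)
          then show "1 - split_gf 1 u * split_gf 1 (y - u) \<le> b u + b (y - u)"
            by (simp add: b_def algebra_simps)
        qed
        also have "\<dots> = (LBINT u:{0..y}. b u) + (LBINT u:{0..y}. b (y - u))"
          by (intro set_integral_add int)
        also have "(LBINT u:{0..y}. b (y - u)) = (LBINT u:{0..y}. b u)"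
          by (rule set_integral_reflect[where h = b and x = y])
        finally show ?thesis by simp
      qed
    qed (use False in auto)
    then show ?thesis
      using S1[of x] S[of x] by (simp add: b_def)
  qed
qed

section \<open>The Kakutani process and its splitting counts\<close>

text \<open>The splitting value is a separate argument, so that one step can be integrated over it
  while the list is held fixed.\<close>

definition kakutani_step :: "real \<Rightarrow> real list \<Rightarrow> real list" where
  "kakutani_step w ls = (let i = (LEAST i. i < length ls \<and> ls ! i = Max (set ls))
     in take i ls @ [w * (ls ! i), (1 - w) * (ls ! i)] @ drop (Suc i) ls)"

lemma kakutani_lengths_Suc: "kakutani_lengths u (Suc n) = kakutani_step (u (Suc n)) (kakutani_lengths u n)"
  by (simp add: kakutani_step_def Let_def)

lemma Least_Max_index:
  fixes ls :: "real list"
  assumes "ls \<noteq> []"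
  shows "(LEAST i. i < length ls \<and> ls ! i = Max (set ls)) < length ls"
    and "ls ! (LEAST i. i < length ls \<and> ls ! i = Max (set ls)) = Max (set ls)"
proof -
  have "\<exists>i. i < length ls \<and> ls ! i = Max (set ls)"
    using Max_in[of "set ls"] assms by (auto simp: in_set_conv_nth)
  from LeastI_ex[OF this] show "(LEAST i. i < length ls \<and> ls ! i = Max (set ls)) < length ls"
    and "ls ! (LEAST i. i < length ls \<and> ls ! i = Max (set ls)) = Max (set ls)"
    by auto
qed

text \<open>The surrounding lists \<open>as\<close> and \<open>bs\<close> are chosen before w, so
  integration over w affects only the two new pieces.\<close>

lemma kakutani_step_split:
  assumes "ls \<noteq> []"
  obtains as bs where "ls = as @ Max (set ls) # bs"
    "\<And>w. kakutani_step w ls = as @ [w * Max (set ls), (1 - w) * Max (set ls)] @ bs"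
proof -
  let ?i = "LEAST i. i < length ls \<and> ls ! i = Max (set ls)"
  show ?thesis
    using Least_Max_index[OF assms] id_take_nth_drop[of ?i ls]
    by (intro that[of "take ?i ls" "drop (Suc ?i) ls"]) (simp_all add: kakutani_step_def Let_def)
qed

lemma length_kakutani_lengths [simp]: "length (kakutani_lengths u n) = Suc n"
proof (induction n)
  case (Suc n)
  then have "kakutani_lengths u n \<noteq> []" by auto
  then obtain as bs where
    as: "kakutani_lengths u n = as @ Max (set (kakutani_lengths u n)) # bs"
    "\<And>w. kakutani_step w (kakutani_lengths u n) =
      as @ [w * Max (set (kakutani_lengths u n)), (1 - w) * Max (set (kakutani_lengths u n))] @ bs"
    using kakutani_step_split by blast
  have "length (as @ Max (set (kakutani_lengths u n)) # bs) = Suc n"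
    using as(1) Suc by simp
  then show ?case
    unfolding kakutani_lengths_Suc as(2) by simp
qed simp

declare kakutani_lengths.simps(2) [simp del]

lemma kakutani_lengths_nonempty [simp]: "kakutani_lengths u n \<noteq> []"
  by (metis length_kakutani_lengths list.size(3) nat.distinct(1))

lemma kakutani_lengths_cong:
  assumes "\<And>i. 1 \<le> i \<Longrightarrow> i \<le> n \<Longrightarrow> u i = v i"
  shows "kakutani_lengths u n = kakutani_lengths v n"
  using assms by (induction n) (simp_all add: kakutani_lengths_Suc)

text \<open>The number of splits an interval of length \<open>l\<close> needs until all its pieces have length at
  most \<open>t\<close> is \<open>k\<close> with probability \<open>split_prob k (l / t)\<close>; different intervals are independent, which
  is why generating functions multiply, irrespective of the order in which intervals are split.\<close>

definition split_fps :: "real \<Rightarrow> real fps" where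
  "split_fps x = Abs_fps (\<lambda>k. split_prob k x)"

definition state_fps :: "real \<Rightarrow> real list \<Rightarrow> real fps" where
  "state_fps t ls = prod_list (map (\<lambda>l. split_fps (l / t)) ls)"

text \<open>The candidate for the conditional probability, given the lengths \<open>ls\<close>, that
  n further steps bring every length to at most t. That the process really follows it is the
  one-step equation \<open>done_prob_Suc\<close>.\<close>

definition done_prob :: "real \<Rightarrow> nat \<Rightarrow> real list \<Rightarrow> real" where
  "done_prob t n ls = (\<Sum>k\<le>n. fps_nth (state_fps t ls) k)"

lemma split_fps_le_1: "x \<le> 1 \<Longrightarrow> split_fps x = 1"
  by (simp add: split_fps_def fps_eq_iff split_prob_le_1)

text \<open>The substitution y = w x converts a uniform position on [0, x] into the uniform
  proportion w used by the process.\<close>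

lemma split_fps_Suc:
  assumes "x > 1"
  shows "fps_nth (split_fps x) (Suc k) =
    (LBINT w:{0..1}. fps_nth (split_fps (w * x) * split_fps ((1 - w) * x)) k)"
proof -
  have "(LBINT y:{0..x}. (\<Sum>i\<le>k. split_prob i y * split_prob (k - i) (x - y))) =
      x * (LBINT w:{0..1}. (\<Sum>i\<le>k. split_prob i (w * x) * split_prob (k - i) (x - w * x)))"
    unfolding set_lebesgue_integral_def
    using assms
    by (subst lborel_integral_real_affine[where c = x and t = 0])
       (auto intro!: Bochner_Integration.integral_cong simp: indicator_def zero_le_mult_iff mult.commute)
  then show ?thesis
    using assms
    by (simp add: split_fps_def split_prob.simps(2) fps_mult_nth atMost_atLeast0 algebra_simps)
qed

lemma split_fps_conv_integrable:
  "set_integrable lborel {0..1} (\<lambda>w. fps_nth (split_fps (w * x) * split_fps ((1 - w) * x)) k)"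
  unfolding split_fps_def fps_mult_nth fps_nth_Abs_fps atMost_atLeast0[symmetric]
  by (rule set_integrable_lborel_bounded[OF _ split_prob_conv_le_1[OF sum_split_prob_le_1 order_refl]])
     measurable

lemma fps_nth_prod_list_nonneg:
  fixes fs :: "real fps list"
  assumes "\<And>f k. f \<in> set fs \<Longrightarrow> 0 \<le> fps_nth f k"
  shows "0 \<le> fps_nth (prod_list fs) k"
  using assms by (induction fs arbitrary: k) (auto simp: fps_mult_nth intro!: sum_nonneg mult_nonneg_nonneg)

lemma state_fps_nonneg: "0 \<le> fps_nth (state_fps t ls) k"
  unfolding state_fps_def
  by (rule fps_nth_prod_list_nonneg) (auto simp: split_fps_def split_prob_nonneg)

lemma done_prob_nonneg: "0 \<le> done_prob t n ls"
  unfolding done_prob_def by (intro sum_nonneg state_fps_nonneg)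

lemma state_fps_done:
  assumes "0 < t" "\<And>l. l \<in> set ls \<Longrightarrow> l \<le> t"
  shows "state_fps t ls = 1"
  using assms(2) unfolding state_fps_def
  by (induction ls) (use \<open>0 < t\<close> in \<open>auto simp: split_fps_le_1\<close>)

lemma done_prob_done:
  assumes "0 < t" "\<And>l. l \<in> set ls \<Longrightarrow> l \<le> t"
  shows "done_prob t n ls = 1"
proof -
  have "state_fps t ls = 1"
    using assms by (rule state_fps_done)
  then show ?thesis
    by (simp add: done_prob_def)
qed

lemma state_fps_0_not_done:
  assumes "0 < t" "ls \<noteq> []" "t < Max (set ls)"
  shows "fps_nth (state_fps t ls) 0 = 0"
proof -
  obtain as bs where "ls = as @ Max (set ls) # bs"
    using kakutani_step_split[OF \<open>ls \<noteq> []\<close>] by blast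
  then obtain m where m: "ls = as @ m # bs" "m = Max (set ls)" by metis
  show ?thesis
    using assms unfolding m(2)[symmetric] unfolding m(1) by (simp add: state_fps_def split_fps_def)
qed

lemma done_prob_0:
  assumes "0 < t" "ls \<noteq> []"
  shows "done_prob t 0 ls = (if Max (set ls) \<le> t then 1 else 0)"
proof (cases "Max (set ls) \<le> t")
  case True
  then show ?thesis
    using assms by (simp add: done_prob_done)
next
  case False
  then have "fps_nth (state_fps t ls) 0 = 0"
    using state_fps_0_not_done[OF assms] unfolding not_le by blast
  then show ?thesis
    using False by (simp only: done_prob_def if_False) simp
qed

text \<open>One step changes only the factor of the interval being split. The product c over all
  other intervals is independent of w, so by linearity of the coefficients the claim reduces to
  \<open>split_fps_Suc\<close>.\<close>

lemma state_fps_Suc: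
  assumes "0 < t" "ls \<noteq> []" "t < Max (set ls)"
  shows "fps_nth (state_fps t ls) (Suc n) = (LBINT w:{0..1}. fps_nth (state_fps t (kakutani_step w ls)) n)"
    and "set_integrable lborel {0..1} (\<lambda>w. fps_nth (state_fps t (kakutani_step w ls)) n)"
proof -
  obtain as bs where
    as: "ls = as @ Max (set ls) # bs"
    "\<And>w. kakutani_step w ls = as @ [w * Max (set ls), (1 - w) * Max (set ls)] @ bs"
    using kakutani_step_split[OF \<open>ls \<noteq> []\<close>] by blast
  define m where "m = Max (set ls)"
  define x where "x = m / t"
  have "x > 1" using assms by (simp add: x_def m_def)
  define c where "c = state_fps t as * state_fps t bs"
  have ls: "state_fps t ls = c * split_fps x"
    by (subst as(1)) (simp add: state_fps_def c_def x_def m_def mult_ac)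
  have step: "state_fps t (kakutani_step w ls) = c * (split_fps (w * x) * split_fps ((1 - w) * x))" for w
    by (simp add: as(2) state_fps_def c_def x_def m_def mult_ac)
  have step_nth: "fps_nth (state_fps t (kakutani_step w ls)) n =
    (\<Sum>i\<le>n. fps_nth c i * fps_nth (split_fps (w * x) * split_fps ((1 - w) * x)) (n - i))" for w
    unfolding step by (subst fps_mult_nth) (simp add: atMost_atLeast0)
  show "set_integrable lborel {0..1} (\<lambda>w. fps_nth (state_fps t (kakutani_step w ls)) n)"
    unfolding step_nth set_integrable_def scaleR_sum_right
    using split_fps_conv_integrable[unfolded set_integrable_def]
    by (intro Bochner_Integration.integrable_sum) (simp add: mult.left_commute[of "indicator _ _"])
  have "fps_nth (state_fps t ls) (Suc n) = (\<Sum>i\<le>Suc n. fps_nth c i * fps_nth (split_fps x) (Suc n - i))"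
    unfolding ls fps_mult_nth by (simp add: atMost_atLeast0)
  \<comment> \<open>The summand i = Suc n drops out because an interval longer than t needs at least
    one split: its series has constant coefficient 0.\<close>
  also have "\<dots> = (\<Sum>i\<le>n. fps_nth c i * fps_nth (split_fps x) (Suc (n - i)))"
    using \<open>x > 1\<close> by (simp add: split_fps_def Suc_diff_le)
  also have "\<dots> = (\<Sum>i\<le>n. LBINT w:{0..1}. fps_nth c i * fps_nth (split_fps (w * x) * split_fps ((1 - w) * x)) (n - i))"
    using \<open>x > 1\<close> by (simp add: split_fps_Suc)
  also have "\<dots> = (LBINT w:{0..1}. fps_nth (state_fps t (kakutani_step w ls)) n)"
    unfolding step_nth
    by (rule set_integral_sum_finite[symmetric]) (intro set_integrable_mult_right split_fps_conv_integrable)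
  finally show "fps_nth (state_fps t ls) (Suc n) = (LBINT w:{0..1}. fps_nth (state_fps t (kakutani_step w ls)) n)" .
qed

text \<open>The process goes on splitting after the threshold is met, whereas the count stops. Both
  sides are then 1, so the step equation holds in every state and not only while a long interval
  remains.\<close>

lemma done_prob_Suc:
  assumes "0 < t" "ls \<noteq> []"
  shows "done_prob t (Suc n) ls = (LBINT w:{0..1}. done_prob t n (kakutani_step w ls))"
proof (cases "Max (set ls) \<le> t")
  case True
  then have le: "l \<le> t" if "l \<in> set ls" for l
    using that by (metis List.finite_set Max_ge order_trans)
  obtain as bs where
    as: "ls = as @ Max (set ls) # bs"
    "\<And>w. kakutani_step w ls = as @ [w * Max (set ls), (1 - w) * Max (set ls)] @ bs"
    using kakutani_step_split[OF \<open>ls \<noteq> []\<close>] by blast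
  have sub: "set as \<subseteq> set ls" "set bs \<subseteq> set ls"
    by (subst as(1), auto)+
  have small: "w * Max (set ls) \<le> t" if "w \<in> {0..1}" for w
  \<comment> \<open>The list is arbitrary and its maximum may be negative; then multiplication by w
    \<le> 1 increases it, and the bound follows from t > 0 instead.\<close>
  proof (cases "Max (set ls) \<le> 0")
    case True
    then have "w * Max (set ls) \<le> 0" using that by (auto simp: mult_le_0_iff)
    then show ?thesis using \<open>0 < t\<close> by linarith
  next
    case False
    then have "w * Max (set ls) \<le> 1 * Max (set ls)" using that by (intro mult_right_mono) auto
    then show ?thesis using \<open>Max (set ls) \<le> t\<close> by simp
  qed
  have "done_prob t n (kakutani_step w ls) = 1" if "w \<in> {0..1}" for w
    using small[OF that] small[of "1 - w"] that le sub unfolding as(2)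
    by (intro done_prob_done \<open>0 < t\<close>) auto
  then have "(LBINT w:{0..1}. done_prob t n (kakutani_step w ls)) = (LBINT w:{0..1::real}. (1::real))"
    by (intro set_lebesgue_integral_cong) auto
  then show ?thesis
    using done_prob_done[OF \<open>0 < t\<close> le] by (simp add: set_integral_const)
next
  case False
  then have big: "t < Max (set ls)" by (simp only: not_le)
  have "done_prob t (Suc n) ls = (\<Sum>k\<le>n. fps_nth (state_fps t ls) (Suc k))"
    using state_fps_0_not_done[OF assms big] unfolding done_prob_def by (subst sum.atMost_Suc_shift) simp
  also have "\<dots> = (\<Sum>k\<le>n. LBINT w:{0..1}. fps_nth (state_fps t (kakutani_step w ls)) k)"
    using state_fps_Suc(1)[OF assms big] by simp
  also have "\<dots> = (LBINT w:{0..1}. done_prob t n (kakutani_step w ls))"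
    unfolding done_prob_def
    by (intro set_integral_sum_finite[symmetric] state_fps_Suc(2)[OF assms big])
  finally show ?thesis .
qed

lemma kakutani_step_nonempty: "ls \<noteq> [] \<Longrightarrow> kakutani_step w ls \<noteq> []"
  by (simp add: kakutani_step_def Let_def)

lemma done_prob_le_1:
  assumes "0 < t" "ls \<noteq> []"
  shows "done_prob t n ls \<le> 1"
  using \<open>ls \<noteq> []\<close>
proof (induction n arbitrary: ls)
  case 0
  then show ?case using done_prob_0[of t ls] \<open>0 < t\<close> by simp
next
  case (Suc n)
  have "done_prob t (Suc n) ls = (LBINT w:{0..1}. done_prob t n (kakutani_step w ls))"
    using Suc.prems \<open>0 < t\<close> by (simp add: done_prob_Suc)
  also have "\<dots> \<le> (LBINT w:{0..1::real}. 1)"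
    unfolding set_lebesgue_integral_def
  proof (rule integral_mono')
    show "integrable lborel (\<lambda>w::real. indicator {0..1} w *\<^sub>R (1::real))"
      using set_integrable_lborel_bounded[of "\<lambda>_. 1::real" 0 1 1] by (simp add: set_integrable_def)
  qed (use Suc.IH[OF kakutani_step_nonempty[OF Suc.prems]] in \<open>auto simp: indicator_def\<close>)
  also have "\<dots> = 1"
    by (simp add: set_integral_const)
  finally show ?case .
qed

section \<open>Measurability of the interval lengths\<close>

lemma nth_split_append:
  assumes "i < length ls" "j \<le> length ls"
  shows "(take i ls @ [a, b] @ drop (Suc i) ls) ! j =
    (if j < i then (if j < length ls then ls ! j else 0) else if j = i then a else if j = Suc i then b else ls ! (j - 1))"
  using assms by (auto simp: nth_append min_def nth_Cons split: nat.splits)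
     (auto intro!: arg_cong2[where f = nth])

text \<open>The index of the split interval is random, so the j-th new length is pasted together
  from measurable pieces according to the position of j relative to that index.\<close>

lemma measurable_kakutani_lengths_nth:
  assumes "\<And>i. 1 \<le> i \<Longrightarrow> i \<le> n \<Longrightarrow> X i \<in> borel_measurable N" "j \<le> n"
  shows "(\<lambda>\<omega>. kakutani_lengths (\<lambda>i. X i \<omega>) n ! j) \<in> borel_measurable N"
  using assms
proof (induction n arbitrary: j)
  case (Suc n)
  define L where "L \<omega> = kakutani_lengths (\<lambda>i. X i \<omega>) n" for \<omega>
  define m where "m \<omega> = Max (set (L \<omega>))" for \<omega>
  define I where "I \<omega> = (LEAST i. i < length (L \<omega>) \<and> L \<omega> ! i = Max (set (L \<omega>)))" for \<omega>
  have L[measurable]: "(\<lambda>\<omega>. L \<omega> ! k) \<in> borel_measurable N" if "k \<le> n" for k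
    unfolding L_def using Suc.prems that by (intro Suc.IH) auto
  have len: "length (L \<omega>) = Suc n" "L \<omega> \<noteq> []" for \<omega>
    by (auto simp: L_def)
  have set_L: "set (L \<omega>) = (\<lambda>k. L \<omega> ! k) ` {..n}" for \<omega>
    using len(1)[of \<omega>] by (auto simp: set_conv_nth less_Suc_eq_le)
  have m: "m \<in> borel_measurable N"
    unfolding m_def[abs_def] set_L by (rule borel_measurable_Max) auto
  have I[measurable]: "I \<in> measurable N (count_space UNIV)"
    unfolding I_def[abs_def]
  proof (rule measurable_Least)
    fix i
    show "(\<lambda>\<omega>. i < length (L \<omega>) \<and> L \<omega> ! i = Max (set (L \<omega>))) \<in> measurable N (count_space UNIV)"
    proof (cases "i \<le> n")
      case True
      note [measurable] = m[unfolded m_def] L[OF True]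
      show ?thesis unfolding len by measurable
    qed (auto simp: len)
  qed
  have eq: "kakutani_lengths (\<lambda>i. X i \<omega>) (Suc n) ! j =
      (if j < I \<omega> then (if j < Suc n then L \<omega> ! j else 0) else if j = I \<omega> then X (Suc n) \<omega> * m \<omega>
       else if j = Suc (I \<omega>) then (1 - X (Suc n) \<omega>) * m \<omega> else L \<omega> ! (j - 1))" for \<omega>
    unfolding kakutani_lengths_Suc kakutani_step_def Let_def L_def[symmetric] I_def[symmetric]
    using Least_Max_index[OF len(2)[of \<omega>]] Suc.prems(2) len(1)[of \<omega>]
    by (subst nth_split_append) (auto simp: I_def m_def)
  have [measurable]: "X (Suc n) \<in> borel_measurable N"
    using Suc.prems by auto
  note [measurable] = m
  have [measurable]: "(\<lambda>\<omega>. L \<omega> ! (j - 1)) \<in> borel_measurable N"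
    using Suc.prems(2) by (intro L) auto
  \<comment> \<open>For j = Suc n the old list has no entry j, and nothing is known about the
    measurability of that expression. The default 0 replaces it; it is never attained, since j < I
    implies j < Suc n.\<close>
  have [measurable]: "(\<lambda>\<omega>. if j < Suc n then L \<omega> ! j else 0) \<in> borel_measurable N"
    by (cases "j < Suc n") auto
  show ?case
    unfolding eq by measurable
qed auto

lemma measurable_prod_split_fps:
  fixes m :: nat
  assumes "\<And>j. j < m \<Longrightarrow> h j \<in> borel_measurable N"
  shows "(\<lambda>\<omega>. fps_nth (\<Prod>j<m. split_fps (h j \<omega>)) k) \<in> borel_measurable N"
  using assms
proof (induction m arbitrary: k)
  case 0
  then show ?case by simp
next
  case (Suc m)
  have [measurable]: "(\<lambda>\<omega>. fps_nth (\<Prod>j<m. split_fps (h j \<omega>)) k) \<in> borel_measurable N" for k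
    using Suc by auto
  have [measurable]: "h m \<in> borel_measurable N"
    using Suc.prems by simp
  show ?case
    unfolding prod.lessThan_Suc fps_mult_nth split_fps_def fps_nth_Abs_fps
    by (simp only: split_fps_def[symmetric]) measurable
qed

lemma measurable_done_prob_kakutani_lengths:
  assumes "\<And>i. 1 \<le> i \<Longrightarrow> i \<le> n \<Longrightarrow> X i \<in> borel_measurable N"
  shows "(\<lambda>\<omega>. done_prob t k (kakutani_lengths (\<lambda>i. X i \<omega>) n)) \<in> borel_measurable N"
proof -
  have "state_fps t (kakutani_lengths (\<lambda>i. X i \<omega>) n) =
      (\<Prod>j<Suc n. split_fps (kakutani_lengths (\<lambda>i. X i \<omega>) n ! j / t))" for \<omega>
    unfolding state_fps_def prod.list_conv_set_nth by (simp add: lessThan_atLeast0)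
  moreover have "(\<lambda>\<omega>. kakutani_lengths (\<lambda>i. X i \<omega>) n ! j / t) \<in> borel_measurable N" if "j < Suc n" for j
    using that assms by (intro borel_measurable_divide measurable_kakutani_lengths_nth) auto
  ultimately show ?thesis
    unfolding done_prob_def by (simp only:) (intro borel_measurable_sum measurable_prod_split_fps, auto)
qed

section \<open>Integrating out the driving uniform variables\<close>

abbreviation "uniform01 \<equiv> density lborel (indicator {0..1::real} :: real \<Rightarrow> ennreal)"

lemma prob_space_uniform01: "prob_space uniform01"
  by (rule prob_spaceI) (simp add: emeasure_density nn_integral_indicator)

lemma integral_uniform01:
  fixes f :: "real \<Rightarrow> real"
  assumes "f \<in> borel_measurable borel"
  shows "integral\<^sup>L uniform01 f = (LBINT w:{0..1}. f w)"
proof -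
  have "uniform01 = density lborel (\<lambda>x. ennreal (indicator {0..1} x))"
    by (simp add: ennreal_indicator)
  then show ?thesis
    using assms by (simp add: integral_density set_lebesgue_integral_def)
qed

text \<open>A martingale argument: integrating out the last coordinate trades one performed step for
  one step still to come, so m + k is preserved until only the initial list [1] is left.\<close>

lemma integral_done_prob:
  assumes "0 < t"
  shows "(\<integral>x. done_prob t m (kakutani_lengths x k) \<partial>(\<Pi>\<^sub>M i\<in>{1..k}. uniform01)) = done_prob t (m + k) [1]"
proof (induction k arbitrary: m)
  case 0
  interpret prob_space "\<Pi>\<^sub>M i\<in>{}::nat set. uniform01"
    by (intro prob_space_PiM prob_space_uniform01)
  show ?case using prob_space by simp
next
  case (Suc k)
  interpret product_prob_space "\<lambda>_. uniform01" "{1..k}"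
    unfolding product_prob_space_def product_prob_space_axioms_def product_sigma_finite_def
    by (auto intro!: prob_space_uniform01 prob_space_imp_sigma_finite)
  have ins: "{1..Suc k} = insert (Suc k) {1..k}" by auto
  interpret Q: prob_space "\<Pi>\<^sub>M i\<in>{1..Suc k}. uniform01"
    by (intro prob_space_PiM prob_space_uniform01)
  have meas: "(\<lambda>x. done_prob t m (kakutani_lengths x (Suc k))) \<in> borel_measurable (\<Pi>\<^sub>M i\<in>{1..Suc k}. uniform01)"
  proof (rule measurable_done_prob_kakutani_lengths[where X = "\<lambda>i x. x i"])
    fix i assume "1 \<le> i" "i \<le> Suc k"
    then have "(\<lambda>x. x i) \<in> measurable (\<Pi>\<^sub>M i\<in>{1..Suc k}. uniform01) uniform01"
      by (intro measurable_component_singleton) auto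
    then show "(\<lambda>x. x i) \<in> borel_measurable (\<Pi>\<^sub>M i\<in>{1..Suc k}. uniform01)" by simp
  qed
  have "integrable (\<Pi>\<^sub>M i\<in>{1..Suc k}. uniform01) (\<lambda>x. done_prob t m (kakutani_lengths x (Suc k)))"
    using \<open>0 < t\<close> by (intro Q.integrable_const_bound[where B = 1] meas AE_I2)
      (auto simp: done_prob_nonneg done_prob_le_1)
  then have "(\<integral>x. done_prob t m (kakutani_lengths x (Suc k)) \<partial>(\<Pi>\<^sub>M i\<in>{1..Suc k}. uniform01)) =
    (\<integral>x. (\<integral>w. done_prob t m (kakutani_lengths (x(Suc k := w)) (Suc k)) \<partial>uniform01) \<partial>(\<Pi>\<^sub>M i\<in>{1..k}. uniform01))"
    unfolding ins by (intro product_integral_insert) auto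
  also have "(\<lambda>x. (\<integral>w. done_prob t m (kakutani_lengths (x(Suc k := w)) (Suc k)) \<partial>uniform01)) =
     (\<lambda>x. done_prob t (Suc m) (kakutani_lengths x k))"
  proof
    fix x :: "nat \<Rightarrow> real"
    have "(\<integral>w. done_prob t m (kakutani_lengths (x(Suc k := w)) (Suc k)) \<partial>uniform01) =
        (LBINT w:{0..1}. done_prob t m (kakutani_lengths (x(Suc k := w)) (Suc k)))"
    proof (rule integral_uniform01)
      show "(\<lambda>w. done_prob t m (kakutani_lengths (x(Suc k := w)) (Suc k))) \<in> borel_measurable borel"
        by (rule measurable_done_prob_kakutani_lengths[where X = "\<lambda>i w. (x(Suc k := w)) i"]) auto
    qed
    also have "\<dots> = (LBINT w:{0..1}. done_prob t m (kakutani_step w (kakutani_lengths x k)))"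
    proof -
      have "kakutani_lengths (x(Suc k := w)) k = kakutani_lengths x k" for w
        by (rule kakutani_lengths_cong) auto
      then show ?thesis
        unfolding kakutani_lengths_Suc by simp
    qed
    finally show "(\<integral>w. done_prob t m (kakutani_lengths (x(Suc k := w)) (Suc k)) \<partial>uniform01) =
       done_prob t (Suc m) (kakutani_lengths x k)"
      using \<open>0 < t\<close> by (simp add: done_prob_Suc)
  qed
  finally show ?case
    using Suc.IH[of "Suc m"] by simp
qed

text \<open>The random values enter only through the joint law of the first n of them, a product of
  uniform laws. The threshold t is scaled to 1, which turns the unit interval into one of length 1 /
  t.\<close>

lemma prob_kakutani_max_le:
  fixes M :: "'a measure" and U :: "nat \<Rightarrow> 'a \<Rightarrow> real"
  assumes "prob_space M"
    and indep: "prob_space.indep_vars M (\<lambda>_. borel) U {1..}"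
    and unif: "\<And>i. i \<ge> 1 \<Longrightarrow> distributed M lborel (U i) (indicator {0..1})"
    and "0 < t" "n \<ge> 1"
  shows "measure M {\<omega> \<in> space M. kakutani_max (\<lambda>i. U i \<omega>) n \<le> t} = (\<Sum>k\<le>n. split_prob k (1 / t))"
    and "(\<lambda>\<omega>. kakutani_max (\<lambda>i. U i \<omega>) n) \<in> borel_measurable M"
proof -
  interpret prob_space M by fact
  have U[measurable]: "U i \<in> borel_measurable M" if "i \<ge> 1" for i
    using distributed_measurable[OF unif[OF that]] by simp
  have dU: "distr M borel (U i) = uniform01" if "i \<ge> 1" for i
  proof -
    have "distr M borel (U i) = distr M lborel (U i)"
      by (intro distr_cong) auto
    then show ?thesis
      using distributed_distr_eq_density[OF unif[OF that]] by simp
  qed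
  let ?P = "\<Pi>\<^sub>M i\<in>{1..n}. uniform01"
  let ?X = "\<lambda>\<omega>. \<lambda>i\<in>{1..n}. U i \<omega>"
  have "indep_vars (\<lambda>_. borel) U {1..n}"
    using indep by (rule indep_vars_subset) auto
  then have "distr M (\<Pi>\<^sub>M i\<in>{1..n}. borel) ?X = (\<Pi>\<^sub>M i\<in>{1..n}. distr M borel (U i))"
    using \<open>n \<ge> 1\<close> U by (subst (asm) indep_vars_iff_distr_eq_PiM') auto
  also have "\<dots> = ?P"
    using dU by (intro PiM_cong) auto
  finally have distr: "distr M (\<Pi>\<^sub>M i\<in>{1..n}. borel) ?X = ?P" .
  have [measurable]: "?X \<in> measurable M (\<Pi>\<^sub>M i\<in>{1..n}. borel)"
    using U by (intro measurable_restrict) auto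
  have meas: "(\<lambda>x. done_prob t 0 (kakutani_lengths x n)) \<in> borel_measurable (\<Pi>\<^sub>M i\<in>{1..n}. (borel :: real measure))"
  proof (rule measurable_done_prob_kakutani_lengths[where X = "\<lambda>i x. x i"])
    fix i assume "1 \<le> i" "i \<le> n"
    then show "(\<lambda>x. x i) \<in> borel_measurable (\<Pi>\<^sub>M i\<in>{1..n}. (borel :: real measure))"
      by (intro measurable_component_singleton) auto
  qed
  show max: "(\<lambda>\<omega>. kakutani_max (\<lambda>i. U i \<omega>) n) \<in> borel_measurable M"
  proof -
    have "set (kakutani_lengths u n) = (\<lambda>k. kakutani_lengths u n ! k) ` {..n}" for u
      by (auto simp: set_conv_nth less_Suc_eq_le)
    then have "(\<lambda>\<omega>. kakutani_max (\<lambda>i. U i \<omega>) n) =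
        (\<lambda>\<omega>. Max ((\<lambda>k. kakutani_lengths (\<lambda>i. U i \<omega>) n ! k) ` {..n}))"
      by (simp add: kakutani_max_def)
    also have "\<dots> \<in> borel_measurable M"
      using U by (intro borel_measurable_Max measurable_kakutani_lengths_nth) auto
    finally show ?thesis .
  qed
  have "measure M {\<omega> \<in> space M. kakutani_max (\<lambda>i. U i \<omega>) n \<le> t} =
      (\<integral>\<omega>. indicator {\<omega> \<in> space M. kakutani_max (\<lambda>i. U i \<omega>) n \<le> t} \<omega> \<partial>M)"
  proof -
    have "{\<omega> \<in> space M. kakutani_max (\<lambda>i. U i \<omega>) n \<le> t} \<inter> space M =
        {\<omega> \<in> space M. kakutani_max (\<lambda>i. U i \<omega>) n \<le> t}"
      by auto
    then show ?thesis
      by (subst Bochner_Integration.integral_indicator) simp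
  qed
  \<comment> \<open>With no step left, \<open>done_prob\<close> is the indicator of the event that
    the maximum is at most t.\<close>
  also have "\<dots> = (\<integral>\<omega>. done_prob t 0 (kakutani_lengths (\<lambda>i. U i \<omega>) n) \<partial>M)"
    using \<open>0 < t\<close>
    by (intro Bochner_Integration.integral_cong) (auto simp: done_prob_0 kakutani_max_def indicator_def)
  also have "\<dots> = (\<integral>\<omega>. done_prob t 0 (kakutani_lengths (?X \<omega>) n) \<partial>M)"
    by (intro Bochner_Integration.integral_cong arg_cong[where f = "done_prob t 0"] kakutani_lengths_cong) auto
  also have "\<dots> = (\<integral>x. done_prob t 0 (kakutani_lengths x n) \<partial>(distr M (\<Pi>\<^sub>M i\<in>{1..n}. borel) ?X))"
    using meas by (subst integral_distr) auto
  also have "\<dots> = done_prob t n [1]"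
    unfolding distr using integral_done_prob[OF \<open>0 < t\<close>, where m = 0 and k = n] by simp
  also have "\<dots> = (\<Sum>k\<le>n. split_prob k (1 / t))"
    by (simp add: done_prob_def state_fps_def split_fps_def)
  finally show "measure M {\<omega> \<in> space M. kakutani_max (\<lambda>i. U i \<omega>) n \<le> t} = (\<Sum>k\<le>n. split_prob k (1 / t))" .
qed

section \<open>Esseen smoothing inequality\<close>

text \<open>Domination by a product g x * h y gives integrability on the product space at once;
  every exchange of integrals in the smoothing argument has a bound of this form.\<close>

lemma Fubini_dominated:
  fixes f :: "'a \<Rightarrow> 'b \<Rightarrow> real"
  assumes "sigma_finite_measure M1" "sigma_finite_measure M2"
    and [measurable]: "case_prod f \<in> borel_measurable (M1 \<Otimes>\<^sub>M M2)"
    and g: "integrable M1 g" and h: "integrable M2 h"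
    and bd: "\<And>x y. x \<in> space M1 \<Longrightarrow> y \<in> space M2 \<Longrightarrow> \<bar>f x y\<bar> \<le> g x * h y"
  shows "(\<integral>x. (\<integral>y. f x y \<partial>M2) \<partial>M1) = (\<integral>y. (\<integral>x. f x y \<partial>M1) \<partial>M2)"
proof -
  interpret M1: sigma_finite_measure M1 by fact
  interpret M2: sigma_finite_measure M2 by fact
  interpret P: pair_sigma_finite M1 M2 ..
  have [measurable]: "g \<in> borel_measurable M1" "h \<in> borel_measurable M2"
    using g h by auto
  have "integrable (M1 \<Otimes>\<^sub>M M2) (\<lambda>z. g (fst z) * h (snd z))"
  proof (rule P.Fubini_integrable)
    have "(\<lambda>x. \<integral>y. norm (g (fst (x, y)) * h (snd (x, y))) \<partial>M2) = (\<lambda>x. \<bar>g x\<bar> * (\<integral>y. \<bar>h y\<bar> \<partial>M2))"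
      by (simp add: abs_mult)
    then show "integrable M1 (\<lambda>x. \<integral>y. norm (g (fst (x, y)) * h (snd (x, y))) \<partial>M2)"
      using g by simp
    show "AE x in M1. integrable M2 (\<lambda>y. g (fst (x, y)) * h (snd (x, y)))"
      using h by simp
  qed measurable
  then have "integrable (M1 \<Otimes>\<^sub>M M2) (case_prod f)"
    by (rule Bochner_Integration.integrable_bound)
       (auto simp: space_pair_measure intro!: AE_I2 order_trans[OF bd abs_ge_self])
  then show ?thesis
    by (rule P.Fubini_integral[symmetric])
qed

section \<open>The Fejer kernel and its Fourier transform\<close>

lemma one_minus_cos_le: "1 - cos y \<le> y\<^sup>2 / 2" for y :: real
proof -
  have "1 - cos y = 2 * (sin (y / 2))\<^sup>2"
    using cos_double_sin[of "y / 2"] by simp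
  also have "(sin (y / 2))\<^sup>2 \<le> (y / 2)\<^sup>2"
    by (rule abs_le_square_iff[THEN iffD1]) (rule abs_sin_x_le_abs_x)
  finally show ?thesis by (simp add: power2_eq_square)
qed

lemma abs_sin_diff_le: "\<bar>sin a - sin b\<bar> \<le> \<bar>a - b\<bar>" for a b :: real
proof -
  have "\<bar>sin a - sin b\<bar> = 2 * \<bar>sin ((a - b) / 2)\<bar> * \<bar>cos ((a + b) / 2)\<bar>"
    by (simp add: sin_diff_sin abs_mult)
  also have "\<dots> \<le> 2 * \<bar>sin ((a - b) / 2)\<bar> * 1"
    by (intro mult_left_mono) auto
  also have "\<dots> \<le> 2 * \<bar>(a - b) / 2\<bar>"
    using abs_sin_x_le_abs_x[of "(a - b) / 2"] by linarith
  finally show ?thesis by simp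
qed

text \<open>The nonnegative kernel, normalised to total mass pi, whose Fourier transform is a
  multiple of the triangle 1 - |\<theta>| on [-1, 1]. Smoothing with it at scale 1 / T therefore
  involves characteristic functions only up to frequency T. Division by zero sets its value at 0 to
  0 instead of 1/2, on a null set.\<close>

definition fejer :: "real \<Rightarrow> real" where
  "fejer y = (1 - cos y) / y\<^sup>2"

lemma fejer_nonneg: "0 \<le> fejer y"
  by (simp add: fejer_def)

lemma measurable_fejer [measurable]: "fejer \<in> borel_measurable borel"
  unfolding fejer_def[abs_def] by measurable

lemma fejer_le: "fejer y \<le> 3 * inverse (1 + y\<^sup>2)"
proof (cases "y = 0")
  case False
  have "(1 - cos y) * (1 + y\<^sup>2) \<le> 3 * y\<^sup>2"
  proof -
    have "(1 - cos y) * y\<^sup>2 \<le> 2 * y\<^sup>2"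
      using cos_ge_minus_one[of y] by (intro mult_right_mono) auto
    moreover have "1 - cos y \<le> y\<^sup>2" using one_minus_cos_le[of y] zero_le_power2[of y] by linarith
    ultimately show ?thesis by (simp add: algebra_simps)
  qed
  moreover have "1 + y\<^sup>2 > 0" by (simp add: add_pos_nonneg)
  ultimately show ?thesis
    using False by (simp add: fejer_def field_simps)
qed (simp add: fejer_def)

lemma integrable_fejer: "integrable lborel fejer"
proof (rule Bochner_Integration.integrable_bound)
  show "integrable lborel (\<lambda>y. 3 * inverse (1 + y\<^sup>2) :: real)"
    using integrable_inverse_1_plus_square
    by (intro integrable_mult_right) (simp add: einterval_eq_UNIV set_integrable_def)
qed (use fejer_le fejer_nonneg in \<open>auto simp: add_pos_nonneg intro!: AE_I2\<close>)

lemma fejer_fourier: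
  assumes "y \<noteq> 0"
  shows "(LBINT \<theta>:{0..1}. (1 - \<theta>) * cos (\<theta> * y)) = fejer y"
proof -
  have "(LBINT \<theta>. ((1 - \<theta>) * cos (\<theta> * y)) * indicator {0..1} \<theta>) =
     ((1 - 1) * sin (1 * y) / y - cos (1 * y) / y\<^sup>2) - ((1 - 0) * sin (0 * y) / y - cos (0 * y) / y\<^sup>2)"
    using assms
    by (intro integral_FTC_Icc_real)
       (auto intro!: derivative_eq_intros continuous_intros simp: field_simps power2_eq_square)
  then show ?thesis
    by (simp add: set_lebesgue_integral_def mult.commute fejer_def diff_divide_distrib)
qed

lemma set_integral_cos_scale:
  fixes a b c :: real
  assumes "c \<noteq> 0" "a \<le> b"
  shows "(LBINT y:{a..b}. cos (c * y)) = (sin (c * b) - sin (c * a)) / c"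
proof -
  have "(LBINT y. cos (c * y) * indicator {a..b} y) = sin (c * b) / c - sin (c * a) / c"
    using assms by (intro integral_FTC_Icc_real) (auto intro!: derivative_eq_intros continuous_intros)
  then show ?thesis
    by (simp add: set_lebesgue_integral_def mult.commute diff_divide_distrib)
qed

lemma set_integral_fejer:
  assumes "a \<le> b"
  shows "(LBINT y:{a..b}. fejer y) = (LBINT \<theta>:{0..1}. (1 - \<theta>) * ((sin (\<theta> * b) - sin (\<theta> * a)) / \<theta>))"
proof -
  have "(LBINT y:{a..b}. fejer y) = (LBINT y. indicator {a..b} y * (LBINT \<theta>:{0..1}. (1 - \<theta>) * cos (\<theta> * y)))"
    unfolding set_lebesgue_integral_def
  proof (rule integral_cong_AE)
    have "AE y in lborel. y \<noteq> (0::real)" by (rule AE_lborel_singleton)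
    then show "AE y in lborel. indicator {a..b} y *\<^sub>R fejer y =
        indicator {a..b} y * (LBINT \<theta>. indicator {0..1} \<theta> *\<^sub>R ((1 - \<theta>) * cos (\<theta> * y)))"
      by (rule AE_mp) (auto simp: fejer_fourier[symmetric] set_lebesgue_integral_def)
  qed measurable
  also have "\<dots> = (LBINT y. LBINT \<theta>. indicator {a..b} y * (indicator {0..1} \<theta> * ((1 - \<theta>) * cos (\<theta> * y))))"
    by (simp add: set_lebesgue_integral_def)
  also have "\<dots> = (LBINT \<theta>. LBINT y. indicator {a..b} y * (indicator {0..1} \<theta> * ((1 - \<theta>) * cos (\<theta> * y))))"
  proof (rule Fubini_dominated)
    show "integrable lborel (indicator {a..b} :: real \<Rightarrow> real)"
      "integrable lborel (indicator {0..1} :: real \<Rightarrow> real)"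
      by (auto simp: integrable_indicator_iff emeasure_lborel_Icc_eq)
    show "\<bar>indicator {a..b} y * (indicator {0..1} \<theta> * ((1 - \<theta>) * cos (\<theta> * y)))\<bar>
        \<le> indicator {a..b} y * indicator {0..1} \<theta>" for y \<theta> :: real
      by (auto simp: indicator_def abs_mult intro!: mult_le_one)
  qed (auto intro: lborel.sigma_finite_measure_axioms)
  also have "\<dots> = (LBINT \<theta>:{0..1}. (1 - \<theta>) * ((sin (\<theta> * b) - sin (\<theta> * a)) / \<theta>))"
    unfolding set_lebesgue_integral_def
  proof (rule integral_cong_AE)
    have "AE \<theta> in lborel. \<theta> \<noteq> (0::real)" by (rule AE_lborel_singleton)
    then show "AE \<theta> in lborel. (LBINT y. indicator {a..b} y * (indicator {0..1} \<theta> * ((1 - \<theta>) * cos (\<theta> * y)))) =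
        indicator {0..1} \<theta> *\<^sub>R ((1 - \<theta>) * ((sin (\<theta> * b) - sin (\<theta> * a)) / \<theta>))"
    proof (rule AE_mp, intro AE_I2 impI)
      fix \<theta> :: real assume "\<theta> \<noteq> 0"
      have "(LBINT y. indicator {a..b} y * (indicator {0..1} \<theta> * ((1 - \<theta>) * cos (\<theta> * y)))) =
          (LBINT y. (indicator {0..1} \<theta> * (1 - \<theta>)) * (indicator {a..b} y * cos (\<theta> * y)))"
        by (simp add: mult_ac)
      also have "\<dots> = indicator {0..1} \<theta> * (1 - \<theta>) * (LBINT y:{a..b}. cos (\<theta> * y))"
        by (simp add: set_lebesgue_integral_def)
      finally show "(LBINT y. indicator {a..b} y * (indicator {0..1} \<theta> * ((1 - \<theta>) * cos (\<theta> * y)))) =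
        indicator {0..1} \<theta> *\<^sub>R ((1 - \<theta>) * ((sin (\<theta> * b) - sin (\<theta> * a)) / \<theta>))"
        using \<open>\<theta> \<noteq> 0\<close> assms by (simp add: set_integral_cos_scale)
    qed
  qed measurable
  finally show ?thesis .
qed

section \<open>Fejer smoothing of distribution functions\<close>

context real_distribution
begin

lemma expectation_sin_shift: "(\<integral>x. sin (c * (s - x)) \<partial>M) = Im (iexp (c * s) * cnj (char M c))"
proof -
  have "iexp (c * s) * cnj (char M c) = (\<integral>x. iexp (c * s) * cnj (iexp (c * x)) \<partial>M)"
    unfolding char_def by (simp add: integral_cnj[symmetric])
  also have "\<dots> = (\<integral>x. iexp (c * (s - x)) \<partial>M)"
    by (intro Bochner_Integration.integral_cong refl)
       (simp add: exp_cnj exp_add[symmetric] algebra_simps)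
  finally have *: "iexp (c * s) * cnj (char M c) = (\<integral>x. iexp (c * (s - x)) \<partial>M)" .
  have "integrable M (\<lambda>x. iexp (c * (s - x)))"
    by (intro integrable_iexp) auto
  then have "(\<integral>x. Im (iexp (c * (s - x))) \<partial>M) = Im (\<integral>x. iexp (c * (s - x)) \<partial>M)"
    by (rule integral_Im)
  then show ?thesis
    unfolding * by (simp add: Im_exp)
qed

lemma measurable_cdf [measurable]: "cdf M \<in> borel_measurable borel"
  by (rule borel_measurable_mono) (auto simp: mono_def cdf_nondecreasing)

lemma cdf_eq_integral: "cdf M a = (\<integral>x. indicator {..a} x \<partial>M)"
  by (simp add: cdf_def)

text \<open>Two evaluation points are subtracted so that, for each x, the kernel is integrated over
  a bounded interval. The quotient of sines by \<theta> is then at most T (s - s'), which justifies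
  Fubini near \<theta> = 0; the point s' is sent to minus infinity only in
  \<open>fejer_smoothing\<close>.\<close>

lemma cdf_fejer_smoothing:
  assumes "T > 0" "s' \<le> s"
  shows "(LBINT y. (cdf M (s - y / T) - cdf M (s' - y / T)) * fejer y) =
    (LBINT \<theta>:{0..1}. (1 - \<theta>) * (((\<integral>x. sin (\<theta> * T * (s - x)) \<partial>M) - (\<integral>x. sin (\<theta> * T * (s' - x)) \<partial>M)) / \<theta>))"
proof -
  have sigma: "sigma_finite_measure M" "sigma_finite_measure (lborel :: real measure)"
    by (auto intro: sigma_finite_measure_axioms lborel.sigma_finite_measure_axioms)
  have [measurable_cong]: "sets M = sets borel" by simp
  let ?F = "\<lambda>y x. ((if x \<le> s - y / T then 1 else 0) - (if x \<le> s' - y / T then 1 else 0)) * fejer y"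
  have "(cdf M (s - y / T) - cdf M (s' - y / T)) * fejer y = (\<integral>x. ?F y x \<partial>M)" for y
  proof -
    have "(\<integral>x. ?F y x \<partial>M) = (\<integral>x. (indicator {..s - y / T} x - indicator {..s' - y / T} x) * fejer y \<partial>M)"
      by (intro Bochner_Integration.integral_cong) (auto simp: indicator_def)
    also have "\<dots> = (\<integral>x. indicator {..s - y / T} x - indicator {..s' - y / T} x \<partial>M) * fejer y"
      by simp
    also have "(\<integral>x. indicator {..s - y / T} x - indicator {..s' - y / T} x \<partial>M) =
        cdf M (s - y / T) - cdf M (s' - y / T)"
      unfolding cdf_eq_integral
      by (intro Bochner_Integration.integral_diff) (auto simp: integrable_indicator_iff less_top[symmetric])
    finally show ?thesis by (rule sym)
  qed
  then have "(LBINT y. (cdf M (s - y / T) - cdf M (s' - y / T)) * fejer y) = (LBINT y. \<integral>x. ?F y x \<partial>M)"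
    by (intro Bochner_Integration.integral_cong refl)
  also have "\<dots> = (\<integral>x. (LBINT y. ?F y x) \<partial>M)"
  proof (rule Fubini_dominated[where g = fejer and h = "\<lambda>_. 1"])
    show "\<bar>?F y x\<bar> \<le> fejer y * 1" for y x
      using fejer_nonneg[of y] by auto
  qed (auto intro: sigma integrable_fejer)
  also have "\<dots> = (\<integral>x. (LBINT \<theta>. indicator {0..1} \<theta> *
       ((1 - \<theta>) * ((sin (\<theta> * T * (s - x)) - sin (\<theta> * T * (s' - x))) / \<theta>))) \<partial>M)"
  proof (rule Bochner_Integration.integral_cong[OF refl])
    fix x
    \<comment> \<open>Solving for y turns the difference of the two half-line indicators into the
      indicator of one interval in y, up to an end point.\<close>
    have iff: "x \<le> r - y / T \<longleftrightarrow> y \<le> T * (r - x)" for r y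
      using \<open>T > 0\<close> by (simp add: field_simps)
    have le: "T * (s' - x) \<le> T * (s - x)"
      using assms by (intro mult_left_mono) auto
    have "(LBINT y. ?F y x) = (LBINT y:{T * (s' - x)..T * (s - x)}. fejer y)"
      unfolding set_lebesgue_integral_def iff
    proof (rule integral_cong_AE)
      have "AE y in lborel. y \<noteq> T * (s' - x)" by (rule AE_lborel_singleton)
      then show "AE y in lborel. ((if y \<le> T * (s - x) then 1 else 0) - (if y \<le> T * (s' - x) then 1 else 0)) * fejer y
          = indicator {T * (s' - x)..T * (s - x)} y *\<^sub>R fejer y"
        by (rule AE_mp) (use le in \<open>auto simp: indicator_def intro!: AE_I2\<close>)
    qed measurable
    also have "\<dots> = (LBINT \<theta>. indicator {0..1} \<theta> *
       ((1 - \<theta>) * ((sin (\<theta> * T * (s - x)) - sin (\<theta> * T * (s' - x))) / \<theta>)))"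
      by (subst set_integral_fejer[OF le]) (simp add: set_lebesgue_integral_def mult.assoc)
    finally show "(LBINT y. ?F y x) = (LBINT \<theta>. indicator {0..1} \<theta> *
       ((1 - \<theta>) * ((sin (\<theta> * T * (s - x)) - sin (\<theta> * T * (s' - x))) / \<theta>)))" .
  qed
  also have "\<dots> = (LBINT \<theta>. \<integral>x. indicator {0..1} \<theta> *
       ((1 - \<theta>) * ((sin (\<theta> * T * (s - x)) - sin (\<theta> * T * (s' - x))) / \<theta>)) \<partial>M)"
  proof (rule Fubini_dominated[where g = "\<lambda>_. T * (s - s')" and h = "indicator {0..1}"])
    show "integrable lborel (indicator {0..1} :: real \<Rightarrow> real)"
      by (auto simp: integrable_indicator_iff emeasure_lborel_Icc_eq)
    fix x \<theta> :: real
    show "\<bar>indicator {0..1} \<theta> * ((1 - \<theta>) * ((sin (\<theta> * T * (s - x)) - sin (\<theta> * T * (s' - x))) / \<theta>))\<bar>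
        \<le> T * (s - s') * indicator {0..1} \<theta>"
    proof (cases "\<theta> \<in> {0<..1}")
      case True
      have "\<bar>(sin (\<theta> * T * (s - x)) - sin (\<theta> * T * (s' - x))) / \<theta>\<bar> \<le> \<bar>\<theta> * T * (s - x) - \<theta> * T * (s' - x)\<bar> / \<theta>"
        using True abs_sin_diff_le by (auto intro!: divide_right_mono)
      also have "\<theta> * T * (s - x) - \<theta> * T * (s' - x) = \<theta> * (T * (s - s'))" by algebra
      also have "\<bar>\<theta> * (T * (s - s'))\<bar> / \<theta> = T * (s - s')"
        using True assms by (simp add: abs_mult)
      finally have "(1 - \<theta>) * \<bar>(sin (\<theta> * T * (s - x)) - sin (\<theta> * T * (s' - x))) / \<theta>\<bar> \<le> 1 * (T * (s - s'))"
        using True assms by (intro mult_mono) auto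
      then show ?thesis using True by (simp add: abs_mult)
    next
      case False
      then show ?thesis using assms by (cases "\<theta> = 0") (auto simp: indicator_def)
    qed
  qed (auto intro: sigma)
  also have "\<dots> = (LBINT \<theta>:{0..1}. (1 - \<theta>) * (((\<integral>x. sin (\<theta> * T * (s - x)) \<partial>M) - (\<integral>x. sin (\<theta> * T * (s' - x)) \<partial>M)) / \<theta>))"
    unfolding set_lebesgue_integral_def
  proof (intro Bochner_Integration.integral_cong refl)
    fix \<theta> :: real
    have int: "integrable M (\<lambda>x. sin (\<theta> * T * (r - x)))" for r
      by (rule integrable_const_bound[where B = 1]) auto
    show "(\<integral>x. indicator {0..1} \<theta> * ((1 - \<theta>) * ((sin (\<theta> * T * (s - x)) - sin (\<theta> * T * (s' - x))) / \<theta>)) \<partial>M) =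
      indicator {0..1} \<theta> *\<^sub>R ((1 - \<theta>) * (((\<integral>x. sin (\<theta> * T * (s - x)) \<partial>M) - (\<integral>x. sin (\<theta> * T * (s' - x)) \<partial>M)) / \<theta>))"
      using int by (simp add: Bochner_Integration.integral_diff)
  qed
  finally show ?thesis .
qed

lemma measurable_expectation_sin [measurable]:
  "(\<lambda>\<theta>. \<integral>x. sin (\<theta> * T * (s - x)) \<partial>M) \<in> borel_measurable borel"
proof -
  have [measurable]: "cnj \<in> borel_measurable borel"
    by (intro borel_measurable_continuous_onI continuous_intros)
  show ?thesis
    unfolding expectation_sin_shift by measurable
qed

lemma integrable_fejer_smoothing:
  assumes "T > 0" "s' \<le> s"
  shows "set_integrable lborel {0..1} (\<lambda>\<theta>. (1 - \<theta>) *
    (((\<integral>x. sin (\<theta> * T * (s - x)) \<partial>M) - (\<integral>x. sin (\<theta> * T * (s' - x)) \<partial>M)) / \<theta>))"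
proof (rule set_integrable_lborel_bounded[where B = "T * (s - s')"])
  fix \<theta> :: real assume \<theta>: "\<theta> \<in> {0..1}"
  have [measurable_cong]: "sets M = sets borel" by simp
  have int: "integrable M (\<lambda>x. sin (\<theta> * T * (r - x)))" for r
    by (rule integrable_const_bound[where B = 1]) auto
  have "\<bar>(\<integral>x. sin (\<theta> * T * (s - x)) \<partial>M) - (\<integral>x. sin (\<theta> * T * (s' - x)) \<partial>M)\<bar>
      = \<bar>\<integral>x. sin (\<theta> * T * (s - x)) - sin (\<theta> * T * (s' - x)) \<partial>M\<bar>"
    using int by simp
  also have "\<dots> \<le> (\<integral>x. \<bar>sin (\<theta> * T * (s - x)) - sin (\<theta> * T * (s' - x))\<bar> \<partial>M)"
    by (rule integral_abs_bound)
  also have "\<dots> \<le> (\<integral>x. \<theta> * (T * (s - s')) \<partial>M)"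
  proof (rule integral_mono)
    fix x
    have "\<bar>\<theta> * T * (s - x) - \<theta> * T * (s' - x)\<bar> = \<bar>\<theta> * (T * (s - s'))\<bar>"
      by (simp add: algebra_simps)
    also have "\<dots> = \<theta> * (T * (s - s'))"
      using \<theta> assms by simp
    finally show "\<bar>sin (\<theta> * T * (s - x)) - sin (\<theta> * T * (s' - x))\<bar> \<le> \<theta> * (T * (s - s'))"
      using abs_sin_diff_le by metis
  qed (use int in auto)
  also have "\<dots> = \<theta> * (T * (s - s'))"
    by (simp add: prob_space[simplified])
  finally have "\<bar>((\<integral>x. sin (\<theta> * T * (s - x)) \<partial>M) - (\<integral>x. sin (\<theta> * T * (s' - x)) \<partial>M)) / \<theta>\<bar> \<le> T * (s - s')"
    using \<theta> assms by (cases "\<theta> = 0") (auto simp: field_simps)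
  then have "(1 - \<theta>) * \<bar>((\<integral>x. sin (\<theta> * T * (s - x)) \<partial>M) - (\<integral>x. sin (\<theta> * T * (s' - x)) \<partial>M)) / \<theta>\<bar> \<le> 1 * (T * (s - s'))"
    using \<theta> by (intro mult_mono) auto
  then show "norm ((1 - \<theta>) * (((\<integral>x. sin (\<theta> * T * (s - x)) \<partial>M) - (\<integral>x. sin (\<theta> * T * (s' - x)) \<partial>M)) / \<theta>)) \<le> T * (s - s')"
    using \<theta> by (simp add: abs_mult)
qed measurable

lemma integrable_cdf_fejer: "integrable lborel (\<lambda>y. cdf M (s - y / T) * fejer y)"
  by (rule Bochner_Integration.integrable_bound[OF integrable_fejer])
     (auto simp: abs_mult fejer_nonneg cdf_nonneg intro!: AE_I2 mult_left_le_one_le cdf_bounded_prob)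

end

text \<open>The function \<open>e\<close> bounds the difference of the characteristic functions
  divided by \<theta>, which is Esseen's integrand after scaling the frequencies to [0, 1]. The
  factor 2 counts the evaluation points s and s'.\<close>

lemma fejer_smoothing_difference:
  fixes \<mu> \<nu> :: "real measure"
  assumes "real_distribution \<mu>" "real_distribution \<nu>" "T > 0" "s' \<le> s"
    and e: "set_integrable lborel {0..1} e" "\<And>\<theta>. \<theta> \<in> {0..1} \<Longrightarrow> 0 \<le> e \<theta>"
    and char: "\<And>\<theta>. 0 < \<theta> \<Longrightarrow> \<theta> \<le> 1 \<Longrightarrow> cmod (char \<mu> (\<theta> * T) - char \<nu> (\<theta> * T)) \<le> \<theta> * e \<theta>"
  shows "\<bar>(LBINT y. (cdf \<mu> (s - y / T) - cdf \<nu> (s - y / T)) * fejer y) -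
           (LBINT y. (cdf \<mu> (s' - y / T) - cdf \<nu> (s' - y / T)) * fejer y)\<bar> \<le> 2 * (LBINT \<theta>:{0..1}. e \<theta>)"
proof -
  interpret m: real_distribution \<mu> by fact
  interpret n: real_distribution \<nu> by fact
  define S where "S P \<theta> r = (\<integral>x. sin (\<theta> * T * (r - x)) \<partial>P)" for P :: "real measure" and \<theta> r
  let ?h = "\<lambda>\<theta>. (1 - \<theta>) * ((S \<mu> \<theta> s - S \<mu> \<theta> s') / \<theta>) - (1 - \<theta>) * ((S \<nu> \<theta> s - S \<nu> \<theta> s') / \<theta>)"
  let ?d = "(LBINT y. (cdf \<mu> (s - y / T) - cdf \<nu> (s - y / T)) * fejer y) -
           (LBINT y. (cdf \<mu> (s' - y / T) - cdf \<nu> (s' - y / T)) * fejer y)"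
  have S_le: "\<bar>S \<mu> \<theta> r - S \<nu> \<theta> r\<bar> \<le> \<theta> * e \<theta>" if "0 < \<theta>" "\<theta> \<le> 1" for \<theta> r
  proof -
    have "S \<mu> \<theta> r - S \<nu> \<theta> r = Im (iexp (\<theta> * T * r) * cnj (char \<mu> (\<theta> * T) - char \<nu> (\<theta> * T)))"
      unfolding S_def m.expectation_sin_shift n.expectation_sin_shift by (simp add: algebra_simps)
    then have "\<bar>S \<mu> \<theta> r - S \<nu> \<theta> r\<bar> \<le> cmod (iexp (\<theta> * T * r) * cnj (char \<mu> (\<theta> * T) - char \<nu> (\<theta> * T)))"
      using abs_Im_le_cmod by metis
    also have "\<dots> = cmod (char \<mu> (\<theta> * T) - char \<nu> (\<theta> * T))"
      by (simp add: norm_mult complex_mod_cnj del: complex_cnj_diff)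
    also have "\<dots> \<le> \<theta> * e \<theta>" by (rule char[OF that])
    finally show ?thesis .
  qed
  note ints = m.integrable_cdf_fejer n.integrable_cdf_fejer
  have "?d =
        (LBINT y. (cdf \<mu> (s - y / T) - cdf \<mu> (s' - y / T)) * fejer y) -
        (LBINT y. (cdf \<nu> (s - y / T) - cdf \<nu> (s' - y / T)) * fejer y)"
    by (simp add: left_diff_distrib ints)
  also have "\<dots> = (LBINT \<theta>:{0..1}. (1 - \<theta>) * ((S \<mu> \<theta> s - S \<mu> \<theta> s') / \<theta>)) -
      (LBINT \<theta>:{0..1}. (1 - \<theta>) * ((S \<nu> \<theta> s - S \<nu> \<theta> s') / \<theta>))"
    unfolding S_def using assms by (simp add: m.cdf_fejer_smoothing n.cdf_fejer_smoothing)
  also have "\<dots> = (LBINT \<theta>:{0..1}. ?h \<theta>)"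
    unfolding S_def using m.integrable_fejer_smoothing[OF assms(3,4)] n.integrable_fejer_smoothing[OF assms(3,4)]
    by (rule set_integral_diff(2)[symmetric])
  finally have eq: "?d = \<dots>" .
  have pt: "\<bar>?h \<theta>\<bar> \<le> 2 * e \<theta>"
    if \<theta>: "\<theta> \<in> {0..1}" for \<theta>
  proof (cases "\<theta> = 0")
    case False
    then have pos: "0 < \<theta>" "\<theta> \<le> 1" using \<theta> by auto
    have "?h \<theta> =
        (1 - \<theta>) * (((S \<mu> \<theta> s - S \<nu> \<theta> s) - (S \<mu> \<theta> s' - S \<nu> \<theta> s')) / \<theta>)"
      using pos by (simp add: field_simps)
    also have "\<bar>\<dots>\<bar> = (1 - \<theta>) * (\<bar>(S \<mu> \<theta> s - S \<nu> \<theta> s) - (S \<mu> \<theta> s' - S \<nu> \<theta> s')\<bar> / \<theta>)"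
      using pos by (simp add: abs_mult)
    also have "\<dots> \<le> 1 * ((2 * (\<theta> * e \<theta>)) / \<theta>)"
      using pos S_le[OF pos, of s] S_le[OF pos, of s'] by (intro mult_mono divide_right_mono) auto
    finally show ?thesis using pos by simp
  qed (use e(2)[OF \<theta>] in auto)
  show ?thesis
    unfolding eq
  proof -
    have "\<bar>LBINT \<theta>:{0..1}. ?h \<theta>\<bar>
        \<le> (LBINT \<theta>. \<bar>indicator {0..1} \<theta> *\<^sub>R ?h \<theta>\<bar>)"
      unfolding set_lebesgue_integral_def by (rule integral_abs_bound)
    also have "\<dots> \<le> (LBINT \<theta>. indicator {0..1} \<theta> *\<^sub>R (2 * e \<theta>))"
    proof (rule integral_mono')
      show "integrable lborel (\<lambda>\<theta>. indicator {0..1} \<theta> *\<^sub>R (2 * e \<theta>))"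
        using set_integrable_mult_right[OF e(1), of 2] by (simp add: set_integrable_def)
    qed (use pt e(2) in \<open>auto simp: indicator_def\<close>)
    also have "\<dots> = (LBINT \<theta>:{0..1}. 2 * e \<theta>)"
      unfolding set_lebesgue_integral_def ..
    also have "\<dots> = 2 * (LBINT \<theta>:{0..1}. e \<theta>)"
      by (rule set_integral_mult_right)
    finally show "\<bar>LBINT \<theta>:{0..1}. ?h \<theta>\<bar>
        \<le> 2 * (LBINT \<theta>:{0..1}. e \<theta>)" .
  qed
qed

text \<open>Let s' run through the negative integers: both distribution functions tend to 0 there,
  dominated by the kernel, while the bound of \<open>fejer_smoothing_difference\<close> does not
  depend on s'.\<close>

lemma fejer_smoothing:
  fixes \<mu> \<nu> :: "real measure"
  assumes "real_distribution \<mu>" "real_distribution \<nu>" "T > 0"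
    and e: "set_integrable lborel {0..1} e" "\<And>\<theta>. \<theta> \<in> {0..1} \<Longrightarrow> 0 \<le> e \<theta>"
    and char: "\<And>\<theta>. 0 < \<theta> \<Longrightarrow> \<theta> \<le> 1 \<Longrightarrow> cmod (char \<mu> (\<theta> * T) - char \<nu> (\<theta> * T)) \<le> \<theta> * e \<theta>"
  shows "\<bar>LBINT y. (cdf \<mu> (s - y / T) - cdf \<nu> (s - y / T)) * fejer y\<bar> \<le> 2 * (LBINT \<theta>:{0..1}. e \<theta>)"
proof -
  interpret m: real_distribution \<mu> by fact
  interpret n: real_distribution \<nu> by fact
  define H where "H s = (LBINT y. (cdf \<mu> (s - y / T) - cdf \<nu> (s - y / T)) * fejer y)" for s
  have "(\<lambda>k. H (- real k)) \<longlonglongrightarrow> (LBINT y::real. 0)"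
    unfolding H_def
  proof (rule integral_dominated_convergence[where w = fejer])
    show "AE y in lborel. (\<lambda>k. (cdf \<mu> (- real k - y / T) - cdf \<nu> (- real k - y / T)) * fejer y) \<longlonglongrightarrow> 0"
    proof (rule AE_I2)
      fix y :: real
      have lim: "filterlim (\<lambda>k. - real k - y / T) at_bot sequentially"
        by real_asymp
      show "(\<lambda>k. (cdf \<mu> (- real k - y / T) - cdf \<nu> (- real k - y / T)) * fejer y) \<longlonglongrightarrow> 0"
        using filterlim_compose[OF m.cdf_lim_at_bot lim] filterlim_compose[OF n.cdf_lim_at_bot lim]
        by (auto intro!: tendsto_eq_intros)
    qed
    show "AE y in lborel. norm ((cdf \<mu> (- real k - y / T) - cdf \<nu> (- real k - y / T)) * fejer y) \<le> fejer y" for k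
    proof (rule AE_I2)
      fix y :: real
      have "\<bar>cdf \<mu> (- real k - y / T) - cdf \<nu> (- real k - y / T)\<bar> \<le> 1"
        using m.cdf_nonneg m.cdf_bounded_prob n.cdf_nonneg n.cdf_bounded_prob
        by (smt (verit))
      then show "norm ((cdf \<mu> (- real k - y / T) - cdf \<nu> (- real k - y / T)) * fejer y) \<le> fejer y"
        using fejer_nonneg[of y] by (simp add: abs_mult mult_left_le_one_le)
    qed
  qed (auto intro: integrable_fejer)
  then have "(\<lambda>k. \<bar>H s - H (- real k)\<bar>) \<longlonglongrightarrow> \<bar>H s - 0\<bar>"
    by (intro tendsto_intros) simp
  moreover have "\<forall>\<^sub>F k in sequentially. \<bar>H s - H (- real k)\<bar> \<le> 2 * (LBINT \<theta>:{0..1}. e \<theta>)"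
  proof -
    have "\<forall>\<^sub>F k in sequentially. - real k \<le> s" by real_asymp
    then show ?thesis
      by eventually_elim (unfold H_def, rule fejer_smoothing_difference, use assms in auto)
  qed
  ultimately have "\<bar>H s - 0\<bar> \<le> 2 * (LBINT \<theta>:{0..1}. e \<theta>)"
    by (intro tendsto_upperbound[of _ "\<bar>H s - 0\<bar>" sequentially]) auto
  then show ?thesis by (simp add: H_def)
qed

lemma integral_fejer_pos: "0 < (LBINT y. fejer y)"
proof -
  define c where "c = (1 - cos 1) / (4::real)"
  have "cos 1 < cos (0::real)"
    using pi_gt3 by (intro cos_monotone_0_pi) auto
  then have "c > 0" by (simp add: c_def)
  have "c \<le> fejer y" if "y \<in> {1..2}" for y
  proof -
    have "cos y \<le> cos 1"
      using that pi_gt3 by (intro cos_monotone_0_pi_le) auto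
    moreover have "y\<^sup>2 \<le> 2\<^sup>2" using that by (intro power_mono) auto
    ultimately show ?thesis
      unfolding c_def fejer_def using that \<open>cos 1 < cos 0\<close> by (intro frac_le) auto
  qed
  then have "(LBINT y:{1..2::real}. c) \<le> (LBINT y. fejer y)"
    unfolding set_lebesgue_integral_def
    by (intro integral_mono' integrable_fejer) (auto simp: indicator_def fejer_nonneg)
  then show ?thesis
    using \<open>c > 0\<close> by (simp add: set_integral_const)
qed

text \<open>Any fraction above 1/2 would do in Esseen's balance; with 3/4 inside the window, the
  loss outside is at most a quarter of the supremum and can be absorbed.\<close>

lemma fejer_mass:
  obtains A where "A > 0" "(LBINT y:{-A..A}. fejer y) \<ge> 3/4 * (LBINT y. fejer y)"
proof -
  have "(\<lambda>k. LBINT y. indicator {- real k..real k} y *\<^sub>R fejer y) \<longlonglongrightarrow> (LBINT y. fejer y)"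
  proof (rule integral_dominated_convergence[where w = fejer])
    show "AE y in lborel. (\<lambda>k. indicator {- real k..real k} y *\<^sub>R fejer y) \<longlonglongrightarrow> fejer y"
    proof (intro AE_I2 tendsto_eventually)
      fix y :: real
      have "\<forall>\<^sub>F k in sequentially. real k \<ge> \<bar>y\<bar>" by real_asymp
      then show "\<forall>\<^sub>F k in sequentially. indicator {- real k..real k} y *\<^sub>R fejer y = fejer y"
        by eventually_elim (auto simp: indicator_def)
    qed
  qed (auto intro: integrable_fejer simp: fejer_nonneg indicator_def)
  moreover have "3/4 * (LBINT y. fejer y) < (LBINT y. fejer y)"
    using integral_fejer_pos by simp
  ultimately have "\<forall>\<^sub>F k in sequentially. 3/4 * (LBINT y. fejer y) < (LBINT y. indicator {- real k..real k} y *\<^sub>R fejer y)"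
    by (rule order_tendstoD)
  moreover have "\<forall>\<^sub>F k in sequentially. real k > 0" by real_asymp
  ultimately have "\<forall>\<^sub>F k in sequentially. real k > 0 \<and> (LBINT y:{- real k..real k}. fejer y) \<ge> 3/4 * (LBINT y. fejer y)"
    by eventually_elim (auto simp: set_lebesgue_integral_def)
  then obtain k where "real k > 0" "(LBINT y:{- real k..real k}. fejer y) \<ge> 3/4 * (LBINT y. fejer y)"
    using eventually_happens'[OF sequentially_bot] by blast
  then show ?thesis
    by (rule that)
qed

text \<open>A discrepancy d at r persists on a one-sided window: \<mu> is monotone, and \<nu> can
  change by at most m times the window length. Smoothing centred in that window sees nearly d there
  and at least minus the supremum \<eta> of all discrepancies elsewhere. As most kernel mass lies in
  the window, \<eta> is controlled by the smoothed difference.\<close>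

lemma esseen_smoothing:
  "\<exists>C\<ge>0. \<forall>\<mu> \<nu> T m e s. real_distribution \<mu> \<longrightarrow> real_distribution \<nu> \<longrightarrow> T > 0 \<longrightarrow> m \<ge> 0 \<longrightarrow>
     (\<forall>a b. a \<le> b \<longrightarrow> cdf \<nu> b - cdf \<nu> a \<le> m * (b - a)) \<longrightarrow>
     set_integrable lborel {0..1} e \<longrightarrow> (\<forall>\<theta>\<in>{0..1}. 0 \<le> e \<theta>) \<longrightarrow>
     (\<forall>\<theta>. 0 < \<theta> \<longrightarrow> \<theta> \<le> 1 \<longrightarrow> cmod (char \<mu> (\<theta> * T) - char \<nu> (\<theta> * T)) \<le> \<theta> * e \<theta>) \<longrightarrow>
     \<bar>cdf \<mu> s - cdf \<nu> s\<bar> \<le> C * ((LBINT \<theta>:{0..1}. e \<theta>) + m / T)"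
proof -
  obtain A where A: "A > 0" "(LBINT y:{-A..A}. fejer y) \<ge> 3/4 * (LBINT y. fejer y)"
    by (rule fejer_mass)
  define W where "W = (LBINT y. fejer y)"
  define p where "p = (LBINT y:{-A..A}. fejer y)"
  have W: "W > 0" using integral_fejer_pos by (simp add: W_def)
  have p: "3/4 * W \<le> p" "p \<le> W"
    using A(2) unfolding W_def p_def set_lebesgue_integral_def
    by (auto intro!: integral_mono' integrable_fejer simp: indicator_def fejer_nonneg)
  have int_A: "integrable lborel (\<lambda>y. indicator {-A..A} y * fejer y)"
    by (rule Bochner_Integration.integrable_bound[OF integrable_fejer]) (auto simp: indicator_def)
  \<comment> \<open>A lower bound for the smoothed value of D: at least d - k on the window of mass
    at least 3 W / 4, at least -\<eta> on the rest.\<close>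
  have core: "3/4 * d * W - k * W - \<eta> * W / 4 \<le> 2 * J"
    if "0 \<le> d" "0 \<le> k" "0 \<le> \<eta>" "integrable lborel (\<lambda>y. D y * fejer y)"
      "\<And>y. \<bar>D y\<bar> \<le> \<eta>" "\<And>y. y \<in> {-A..A} \<Longrightarrow> d - k \<le> D y"
      "\<bar>LBINT y. D y * fejer y\<bar> \<le> 2 * J" for d k \<eta> J :: real and D
  proof -
    have "(d - k) * p - \<eta> * (W - p) = (LBINT y. (d - k + \<eta>) * (indicator {-A..A} y * fejer y) - \<eta> * fejer y)"
      using int_A integrable_fejer by (simp add: p_def W_def set_lebesgue_integral_def algebra_simps)
    also have "\<dots> \<le> (LBINT y. D y * fejer y)"
    proof (rule integral_mono)
      show "integrable lborel (\<lambda>y. (d - k + \<eta>) * (indicator {-A..A} y * fejer y) - \<eta> * fejer y)"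
        using int_A integrable_fejer by simp
      fix y
      have "- \<eta> \<le> D y" using that(5)[of y] by linarith
      then have "- \<eta> * fejer y \<le> D y * fejer y"
        by (intro mult_right_mono fejer_nonneg)
      moreover have "(d - k) * fejer y \<le> D y * fejer y" if "y \<in> {-A..A}"
        using \<open>\<And>y. y \<in> {-A..A} \<Longrightarrow> d - k \<le> D y\<close>[OF that] by (intro mult_right_mono fejer_nonneg)
      ultimately show "(d - k + \<eta>) * (indicator {-A..A} y * fejer y) - \<eta> * fejer y \<le> D y * fejer y"
        by (cases "y \<in> {-A..A}") (auto simp: algebra_simps)
    qed fact
    also have "\<dots> \<le> 2 * J" using that(7) by linarith
    finally have "d * p - k * p - \<eta> * (W - p) \<le> 2 * J" by (simp add: algebra_simps)
    moreover have "d * (3/4 * W) \<le> d * p" "k * p \<le> k * W" "\<eta> * (W - p) \<le> \<eta> * (W / 4)"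
      using p that(1-3) by (auto intro!: mult_left_mono simp del: divide_le_eq_numeral1 le_divide_eq_numeral1 times_divide_eq_left times_divide_eq_right)
    ultimately show ?thesis by (simp add: algebra_simps)
  qed
  define C where "C = 4 / W + 4 * A"
  have "\<bar>cdf \<mu> s - cdf \<nu> s\<bar> \<le> C * ((LBINT \<theta>:{0..1}. e \<theta>) + m / T)"
    if H: "real_distribution \<mu>" "real_distribution \<nu>" "T > 0" "m \<ge> 0"
      "\<forall>a b. a \<le> b \<longrightarrow> cdf \<nu> b - cdf \<nu> a \<le> m * (b - a)"
      "set_integrable lborel {0..1} e" "\<forall>\<theta>\<in>{0..1}. 0 \<le> e \<theta>"
      "\<forall>\<theta>. 0 < \<theta> \<longrightarrow> \<theta> \<le> 1 \<longrightarrow> cmod (char \<mu> (\<theta> * T) - char \<nu> (\<theta> * T)) \<le> \<theta> * e \<theta>"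
    for \<mu> \<nu> T m e s
  proof -
    interpret m: real_distribution \<mu> by fact
    interpret n: real_distribution \<nu> by fact
    define J where "J = (LBINT \<theta>:{0..1}. e \<theta>)"
    define \<Delta> where "\<Delta> r = cdf \<mu> r - cdf \<nu> r" for r
    define \<eta> where "\<eta> = (SUP r. \<bar>\<Delta> r\<bar>)"
    have \<Delta>1: "\<bar>\<Delta> r\<bar> \<le> 1" for r
      unfolding \<Delta>_def using m.cdf_nonneg[of r] m.cdf_bounded_prob[of r] n.cdf_nonneg[of r] n.cdf_bounded_prob[of r]
      by linarith
    have \<eta>: "\<bar>\<Delta> r\<bar> \<le> \<eta>" for r
      unfolding \<eta>_def using \<Delta>1 by (intro cSUP_upper bdd_aboveI[where M = 1]) auto
    have \<eta>0: "\<eta> \<ge> 0" using \<eta>[of 0] by linarith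
    have J0: "J \<ge> 0"
      unfolding J_def set_lebesgue_integral_def using H(7)
      by (intro integral_nonneg_AE AE_I2) (auto simp: indicator_def)
    define k where "k = m * (2 * A / T)"
    have k0: "k \<ge> 0" using H A by (simp add: k_def)
    have sm: "\<bar>LBINT y. \<Delta> (r - y / T) * fejer y\<bar> \<le> 2 * J" for r
      unfolding \<Delta>_def J_def by (rule fejer_smoothing) (use H in auto)
    have int: "integrable lborel (\<lambda>y. \<Delta> (r - y / T) * fejer y)" for r
      unfolding \<Delta>_def left_diff_distrib
      by (intro Bochner_Integration.integrable_diff m.integrable_cdf_fejer n.integrable_cdf_fejer)
    have key: "3/4 * \<bar>\<Delta> r\<bar> * W - k * W - \<eta> * W / 4 \<le> 2 * J" for r
    proof (cases "\<Delta> r \<ge> 0")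
      case True
      show ?thesis
      \<comment> \<open>The centre r + A / T maps the window [-A, A] onto [r, r + 2 A / T], to the
        right of r, where a positive discrepancy cannot fall quickly. For a negative one the window
        is taken to the left of r.\<close>
      proof (rule core[where D = "\<lambda>y. \<Delta> (r + A / T - y / T)"])
        fix y assume y: "y \<in> {-A..A}"
        define u where "u = r + A / T - y / T"
        have u: "r \<le> u" "u - r \<le> 2 * A / T"
          using divide_right_mono[of "-A" y T] divide_right_mono[of y A T] y \<open>T > 0\<close> by (auto simp: u_def)
        have "cdf \<nu> u - cdf \<nu> r \<le> m * (u - r)" using H(5) u by blast
        also have "\<dots> \<le> k" unfolding k_def using u H by (intro mult_left_mono) auto
        finally show "\<bar>\<Delta> r\<bar> - k \<le> \<Delta> (r + A / T - y / T)"
          using m.cdf_nondecreasing[OF u(1)] True unfolding u_def[symmetric] \<Delta>_def by linarith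
      qed (use k0 \<eta>0 \<eta> sm int in auto)
    next
      case False
      show ?thesis
      proof (rule core[where D = "\<lambda>y. - \<Delta> (r - A / T - y / T)"])
        fix y assume y: "y \<in> {-A..A}"
        define u where "u = r - A / T - y / T"
        have u: "u \<le> r" "r - u \<le> 2 * A / T"
          using divide_right_mono[of "-A" y T] divide_right_mono[of y A T] y \<open>T > 0\<close> by (auto simp: u_def)
        have "cdf \<nu> r - cdf \<nu> u \<le> m * (r - u)" using H(5) u by blast
        also have "\<dots> \<le> k" unfolding k_def using u H by (intro mult_left_mono) auto
        finally show "\<bar>\<Delta> r\<bar> - k \<le> - \<Delta> (r - A / T - y / T)"
          using m.cdf_nondecreasing[OF u(1)] False unfolding u_def[symmetric] \<Delta>_def by linarith
      qed (use k0 \<eta>0 \<eta> sm int in auto)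
    qed
    have "\<bar>\<Delta> r\<bar> \<le> (2 * J / W + k + \<eta> / 4) * (4/3)" for r
    proof -
      have "3/4 * \<bar>\<Delta> r\<bar> * W \<le> 2 * J + k * W + \<eta> * W / 4" using key[of r] by linarith
      then show ?thesis using W by (simp add: field_simps)
    qed
    \<comment> \<open>The right-hand side does not depend on r, so the supremum inherits the bound;
      the coefficient of \<eta> on the right is 1/3, and solving gives \<eta> \<le> 4 J / W + 2
      k.\<close>
    then have "\<eta> \<le> (2 * J / W + k + \<eta> / 4) * (4/3)"
      unfolding \<eta>_def by (intro cSUP_least) auto
    then have "\<eta> \<le> 4 * J / W + 2 * k" by (simp add: algebra_simps)
    also have "\<dots> = 4 / W * J + 4 * A * (m / T)" by (simp add: k_def)
    also have "\<dots> \<le> C * J + C * (m / T)"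
      using W A J0 H by (intro add_mono mult_right_mono) (auto simp: C_def)
    finally show ?thesis
      using \<eta>[of s] unfolding \<Delta>_def J_def by (simp add: algebra_simps)
  qed
  moreover have "C \<ge> 0" using W A by (simp add: C_def)
  ultimately show ?thesis by blast
qed

section \<open>Gaussian approximate solution of the convolution equation\<close>

lemma set_integral_FTC_Icc:
  fixes f F :: "real \<Rightarrow> real"
  assumes "a \<le> b" "\<And>y. a \<le> y \<Longrightarrow> y \<le> b \<Longrightarrow> (F has_real_derivative f y) (at y)" "continuous_on {a..b} f"
  shows "(LBINT y:{a..b}. f y) = F b - F a"
proof -
  have "(LBINT y. f y * indicator {a..b} y) = F b - F a"
  proof (rule integral_FTC_atLeastAtMost[OF \<open>a \<le> b\<close>, of F f, unfolded real_scaleR_def, simplified mult.commute[of "indicator _ _"]])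
    show "(F has_vector_derivative f y) (at y within {a..b})" if "a \<le> y" "y \<le> b" for y
      using assms(2)[OF that] by (simp add: has_real_derivative_iff_has_vector_derivative has_vector_derivative_at_within)
  qed fact
  then show ?thesis
    by (simp add: set_lebesgue_integral_def mult.commute)
qed

text \<open>The right-hand side minus the left has derivative (u - 1)^2 / (u (u + 1)^2). The cruder
  ln y \<ge> 1 - 1 / y would be too weak for the variance: at x = 2 it would only bound it below by
  -2.\<close>

lemma ln_ge_pade:
  fixes y :: real
  assumes "1 \<le> y"
  shows "2 * (y - 1) / (y + 1) \<le> ln y"
proof -
  have "(\<lambda>y. ln y - 2 * (y - 1) / (y + 1)) 1 \<le> (\<lambda>y. ln y - 2 * (y - 1) / (y + 1)) y"
  proof (rule DERIV_nonneg_imp_nondecreasing[OF assms])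
    fix u :: real assume "1 \<le> u" "u \<le> y"
    then have "((\<lambda>y. ln y - 2 * (y - 1) / (y + 1)) has_real_derivative 1 / u - 4 / (u + 1)\<^sup>2) (at u)"
      by (auto intro!: derivative_eq_intros simp: field_simps power2_eq_square)
    moreover have "1 / u - 4 / (u + 1)\<^sup>2 = (u - 1)\<^sup>2 / (u * (u + 1)\<^sup>2)"
      using \<open>1 \<le> u\<close> by (simp add: divide_simps) (simp add: power2_eq_square algebra_simps)
    ultimately show "\<exists>z. ((\<lambda>y. ln y - 2 * (y - 1) / (y + 1)) has_real_derivative z) (at u) \<and> 0 \<le> z"
      using \<open>1 \<le> u\<close> by (intro exI[of _ "1 / u - 4 / (u + 1)\<^sup>2"]) auto
  qed
  then show ?thesis by simp
qed

section \<open>Centred mean and variance of the count\<close>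

definition var_rate :: real where
  "var_rate = 8 * ln 2 - 5"

text \<open>Mean (after subtracting \<open>2 * x\<close>) and variance of the number of final pieces of an interval
  of length \<open>x\<close> that is split until all pieces have length at most 1.\<close>

definition dev_mean :: "real \<Rightarrow> real" where
  "dev_mean x = (if x \<le> 1 then 1 - 2 * x else 0)"

definition dev_var :: "real \<Rightarrow> real" where
  "dev_var x = (if x \<le> 1 then 0 else if x \<le> 2 then 2 + 2 * x - 4 * x\<^sup>2 + 8 * x * ln x else var_rate * x)"

lemma measurable_dev_mean [measurable]: "dev_mean \<in> borel_measurable borel"
  unfolding dev_mean_def[abs_def] by measurable

lemma measurable_dev_var [measurable]: "dev_var \<in> borel_measurable borel"
  unfolding dev_var_def[abs_def] by measurable

lemma dev_var_ge_pade:
  fixes x :: real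
  assumes "1 \<le> x" "x \<le> 2"
  shows "2 * (x - 1) / (x + 1) \<le> 2 + 2 * x - 4 * x\<^sup>2 + 8 * x * ln x"
proof -
  have "2 * (x - 1) / (x + 1) \<le> 2 + 2 * x - 4 * x\<^sup>2 + 8 * x * (2 * (x - 1) / (x + 1))"
  proof -
    \<comment> \<open>After the logarithm is replaced by its Pade bound, the remaining difference
      factors with x - 1 and 2 - x, so it is nonnegative exactly up to the end point 2 of the
      interval concerned.\<close>
    have eq: "2 + 2 * x - 4 * x\<^sup>2 + 8 * x * (2 * (x - 1) / (x + 1)) - 2 * (x - 1) / (x + 1)
        = (x - 1) * (2 * (2 * x - 1) * (2 - x)) / (x + 1)"
      using assms by (simp add: divide_simps) (simp add: power2_eq_square algebra_simps)
    have "0 \<le> (x - 1) * (2 * (2 * x - 1) * (2 - x)) / (x + 1)"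
      using assms by (intro divide_nonneg_nonneg mult_nonneg_nonneg) auto
    then show ?thesis using eq by linarith
  qed
  also have "8 * x * (2 * (x - 1) / (x + 1)) \<le> 8 * x * ln x"
    using ln_ge_pade[OF assms(1)] assms by (intro mult_left_mono) auto
  finally show ?thesis by simp
qed

lemma var_rate_ge: "1 / 3 \<le> var_rate"
  using dev_var_ge_pade[of 2] by (simp add: var_rate_def)

lemma var_rate_le: "var_rate \<le> 3"
  using ln_2_less_1 by (simp add: var_rate_def)

lemma dev_var_nonneg: "0 \<le> dev_var x"
proof (cases "1 < x \<and> x \<le> 2")
  case True
  then have "0 \<le> 2 * (x - 1) / (x + 1)" by auto
  then have "0 \<le> 2 + 2 * x - 4 * x\<^sup>2 + 8 * x * ln x"
    using True dev_var_ge_pade[of x] by linarith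
  then show ?thesis using True by (simp add: dev_var_def)
next
  case False
  then show ?thesis using var_rate_ge by (auto simp: dev_var_def)
qed

text \<open>The variance vanishes as x tends to 1, so a uniform positive bound needs an interval
  away from 1; 2/5 is the value of the rational bound at 3/2. The decay of the characteristic
  function starts from here.\<close>

lemma dev_var_ge:
  assumes "3 / 2 \<le> x" "x \<le> 2"
  shows "2 / 5 \<le> dev_var x"
proof -
  have "2 / 5 \<le> 2 * (x - 1) / (x + 1)"
    using assms by (simp add: field_simps)
  then have "2 / 5 \<le> 2 + 2 * x - 4 * x\<^sup>2 + 8 * x * ln x"
    using assms dev_var_ge_pade[of x] by linarith
  then show ?thesis using assms by (simp add: dev_var_def)
qed

text \<open>In the variance defect V(y) + V(x - y) - V(x) the linear parts cancel, so this bound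
  keeps the defect below 3 * 50 = 150 uniformly in x.\<close>

lemma dev_var_linear_bound:
  assumes "0 \<le> x"
  shows "\<bar>dev_var x - var_rate * x\<bar> \<le> 50"
proof (cases "x \<le> 2")
  case True
  have vx: "0 \<le> var_rate * x" using assms var_rate_ge by (intro mult_nonneg_nonneg) auto
  have vx': "var_rate * x \<le> 3 * 2"
    using assms True var_rate_le by (intro mult_mono) auto
  have "dev_var x \<le> 40"
  proof (cases "x \<le> 1")
    case False
    have "ln x \<le> 2" using ln_le_minus_one[of x] False True by simp
    then have "8 * x * ln x \<le> 8 * 2 * 2"
      using False True by (intro mult_mono) auto
    moreover have "2 * x \<le> 4" "4 * x\<^sup>2 \<ge> 0" using True by auto
    ultimately have "2 + 2 * x - 4 * x\<^sup>2 + 8 * x * ln x \<le> 40" by linarith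
    then show ?thesis using False True by (simp add: dev_var_def)
  qed (simp add: dev_var_def)
  then show ?thesis using vx vx' dev_var_nonneg[of x] by linarith
qed (simp add: dev_var_def)

lemma abs_dev_mean_le:
  assumes "0 \<le> x"
  shows "\<bar>dev_mean x\<bar> \<le> 1"
  using assms by (auto simp: dev_mean_def)

lemma set_integrable_dev_mean:
  "set_integrable lborel {0..x} dev_mean" "set_integrable lborel {0..x} (\<lambda>y. dev_mean (x - y))"
  "set_integrable lborel {0..x} (\<lambda>y. (dev_mean y)\<^sup>2)" "set_integrable lborel {0..x} (\<lambda>y. (dev_mean (x - y))\<^sup>2)"
  "set_integrable lborel {0..x} (\<lambda>y. dev_mean y * dev_mean (x - y))"
proof -
  have *: "\<bar>dev_mean y\<bar> \<le> 1" "\<bar>dev_mean (x - y)\<bar> \<le> 1" if "y \<in> {0..x}" for y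
    using abs_dev_mean_le that by auto
  show "set_integrable lborel {0..x} dev_mean" "set_integrable lborel {0..x} (\<lambda>y. dev_mean (x - y))"
    "set_integrable lborel {0..x} (\<lambda>y. (dev_mean y)\<^sup>2)" "set_integrable lborel {0..x} (\<lambda>y. (dev_mean (x - y))\<^sup>2)"
    "set_integrable lborel {0..x} (\<lambda>y. dev_mean y * dev_mean (x - y))"
    using * by (auto intro!: set_integrable_lborel_bounded[where B = 1] mult_le_one
        simp: abs_mult abs_square_le_1 simp del: atLeastAtMost_iff)
qed

lemma set_integrable_dev_var:
  "set_integrable lborel {0..x} dev_var" "set_integrable lborel {0..x} (\<lambda>y. dev_var (x - y))"
proof -
  have *: "\<bar>dev_var y\<bar> \<le> 50 + 3 * x" if "0 \<le> y" "y \<le> x" for y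
  proof -
    have "var_rate * y \<le> 3 * x"
      using that var_rate_le var_rate_ge by (intro mult_mono) auto
    then show ?thesis using dev_var_linear_bound[OF that(1)] dev_var_nonneg[of y] by linarith
  qed
  show "set_integrable lborel {0..x} dev_var" "set_integrable lborel {0..x} (\<lambda>y. dev_var (x - y))"
    by (rule set_integrable_lborel_bounded[where B = "50 + 3 * x"], use * in auto)+
qed

text \<open>The positive and negative parts of 1 - 2 y on [0, 1] balance. This cancellation singles
  out the slope 2 of the mean and removes the first-order term of the residual.\<close>

lemma integral_dev_mean:
  assumes "1 < x"
  shows "(LBINT y:{0..x}. dev_mean y) = 0"
proof -
  have "(LBINT y:{0..x}. dev_mean y) = (LBINT y:{0..1}. 1 - 2 * y)"
    unfolding set_lebesgue_integral_def using assms
    by (intro Bochner_Integration.integral_cong) (auto simp: indicator_def dev_mean_def)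
  also have "\<dots> = (1 - 1\<^sup>2) - (0 - 0\<^sup>2)"
    by (rule set_integral_FTC_Icc) (auto intro!: derivative_eq_intros continuous_intros)
  finally show ?thesis by simp
qed

lemma integral_dev_mean_sq:
  assumes "1 < x"
  shows "(LBINT y:{0..x}. (dev_mean y)\<^sup>2) = 1 / 3"
proof -
  have "(LBINT y:{0..x}. (dev_mean y)\<^sup>2) = (LBINT y:{0..1}. (1 - 2 * y)\<^sup>2)"
    unfolding set_lebesgue_integral_def using assms
    by (intro Bochner_Integration.integral_cong) (auto simp: indicator_def dev_mean_def)
  also have "\<dots> = (1 - 2 * 1\<^sup>2 + 4 * 1 ^ 3 / 3) - (0 - 2 * 0\<^sup>2 + 4 * 0 ^ 3 / 3)"
    by (rule set_integral_FTC_Icc)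
       (auto intro!: derivative_eq_intros continuous_intros simp: power2_eq_square algebra_simps)
  finally show ?thesis by simp
qed

text \<open>Both factors are nonzero only if y and x - y are at most 1, which is impossible beyond x
  = 2. Hence the variance recursion has a quadratic-logarithmic solution up to 2 and a linear one
  afterwards.\<close>

lemma integral_dev_mean_conv:
  assumes "1 < x"
  shows "(LBINT y:{0..x}. dev_mean y * dev_mean (x - y)) =
    (if x \<le> 2 then ((1 - 2 * x) + 2 * x - 4 / 3) -
        ((1 - 2 * x) * (x - 1) + 2 * x * (x - 1)\<^sup>2 - 4 * (x - 1) ^ 3 / 3) else 0)"
proof -
  have eq: "(LBINT y:{0..x}. dev_mean y * dev_mean (x - y)) = (LBINT y:{x - 1..1}. (1 - 2 * y) * (1 - 2 * (x - y)))"
    unfolding set_lebesgue_integral_def using assms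
    by (intro Bochner_Integration.integral_cong) (auto simp: indicator_def dev_mean_def)
  show ?thesis
  proof (cases "x \<le> 2")
    case True
    have "(LBINT y:{x - 1..1}. (1 - 2 * y) * (1 - 2 * (x - y))) =
        ((1 - 2 * x) * 1 + 2 * x * 1\<^sup>2 - 4 * 1 ^ 3 / 3) -
        ((1 - 2 * x) * (x - 1) + 2 * x * (x - 1)\<^sup>2 - 4 * (x - 1) ^ 3 / 3)"
      using True
      by (intro set_integral_FTC_Icc)
         (auto intro!: derivative_eq_intros continuous_intros simp: power2_eq_square algebra_simps)
    then show ?thesis using True eq by simp
  next
    case False
    then show ?thesis using eq by (simp add: set_lebesgue_integral_def)
  qed
qed

lemma integral_dev_var:
  assumes "1 < x"
  shows "(LBINT y:{0..x}. dev_var y) =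
    (if x \<le> 2 then 2 * x - x\<^sup>2 - 4 * x ^ 3 / 3 + 4 * x\<^sup>2 * ln x + 1 / 3
     else 16 * ln 2 - 31 / 3 + var_rate * (x\<^sup>2 - 4) / 2)"
proof -
  define q :: "real \<Rightarrow> real" where "q y = 2 + 2 * y - 4 * y\<^sup>2 + 8 * y * ln y" for y
  have q_int: "(LBINT y:{1..b}. q y) = 2 * b - b\<^sup>2 - 4 * b ^ 3 / 3 + 4 * b\<^sup>2 * ln b + 1 / 3" if "1 \<le> b" for b
  proof -
    have "(LBINT y:{1..b}. q y) = (2 * b - b\<^sup>2 - 4 * b ^ 3 / 3 + 4 * b\<^sup>2 * ln b) -
        (2 * 1 - 1\<^sup>2 - 4 * 1 ^ 3 / 3 + 4 * 1\<^sup>2 * ln 1)"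
      unfolding q_def using that
      by (intro set_integral_FTC_Icc)
         (auto intro!: derivative_eq_intros continuous_intros simp: power2_eq_square field_simps)
    then show ?thesis by simp
  qed
  show ?thesis
  proof (cases "x \<le> 2")
    case True
    have "(LBINT y:{0..x}. dev_var y) = (LBINT y:{1..x}. q y)"
      unfolding set_lebesgue_integral_def using True
      by (intro Bochner_Integration.integral_cong) (auto simp: indicator_def dev_var_def q_def)
    then show ?thesis using True assms q_int[of x] by simp
  next
    case False
    have [measurable]: "q \<in> borel_measurable borel" unfolding q_def[abs_def] by measurable
    have ints: "set_integrable lborel {1..2} q" "set_integrable lborel {2..x} (\<lambda>y. var_rate * y)"
      by (intro borel_integrable_atLeastAtMost', auto simp: q_def[abs_def] intro!: continuous_intros)+
    have "(LBINT y:{0..x}. dev_var y) = (LBINT y. indicator {1..2} y *\<^sub>R q y + indicator {2..x} y *\<^sub>R (var_rate * y))"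
      unfolding set_lebesgue_integral_def
    proof (rule integral_cong_AE)
      have "AE y in lborel. y \<noteq> (2::real)" by (rule AE_lborel_singleton)
      then show "AE y in lborel. indicator {0..x} y *\<^sub>R dev_var y =
          indicator {1..2} y *\<^sub>R q y + indicator {2..x} y *\<^sub>R (var_rate * y)"
        by (rule AE_mp) (use False in \<open>auto simp: indicator_def dev_var_def q_def intro!: AE_I2\<close>)
    qed measurable
    also have "\<dots> = (LBINT y:{1..2}. q y) + (LBINT y:{2..x}. var_rate * y)"
      using ints unfolding set_integrable_def set_lebesgue_integral_def
      by (rule Bochner_Integration.integral_add)
    also have "(LBINT y:{2..x}. var_rate * y) = var_rate * x\<^sup>2 / 2 - var_rate * 2\<^sup>2 / 2"
      using False by (intro set_integral_FTC_Icc)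
         (auto intro!: derivative_eq_intros continuous_intros simp: power2_eq_square field_simps)
    also have "(LBINT y:{1..2}. q y) = 16 * ln 2 - 31 / 3"
      using q_int[of 2] by simp
    finally show ?thesis using False by (simp add: field_simps)
  qed
qed

text \<open>The law of total variance at the first split: mean conditional variance plus mean square
  of the conditional deviation. It determines \<open>dev_var\<close>; matching the integral up to 2
  with the linear solution beyond fixes the slope 8 ln 2 - 5.\<close>

lemma dev_var_recursion:
  assumes "1 < x"
  shows "(LBINT y:{0..x}. (dev_var y + dev_var (x - y) - dev_var x) + (dev_mean y + dev_mean (x - y))\<^sup>2) = 0"
proof -
  have const: "set_integrable lborel {0..x} (\<lambda>y. dev_var x)"
    by (intro set_integrable_lborel_bounded[where B = "\<bar>dev_var x\<bar>"]) auto
  have "(LBINT y:{0..x}. (dev_var y + dev_var (x - y) - dev_var x) + (dev_mean y + dev_mean (x - y))\<^sup>2) =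
     (LBINT y:{0..x}. (dev_var y + dev_var (x - y) - dev_var x) +
        ((dev_mean y)\<^sup>2 + (dev_mean (x - y))\<^sup>2 + 2 * (dev_mean y * dev_mean (x - y))))"
    by (simp add: power2_sum mult.assoc)
  also have "\<dots> = ((LBINT y:{0..x}. dev_var y) + (LBINT y:{0..x}. dev_var (x - y)) - (LBINT y:{0..x}. dev_var x)) +
      ((LBINT y:{0..x}. (dev_mean y)\<^sup>2) + (LBINT y:{0..x}. (dev_mean (x - y))\<^sup>2) +
        2 * (LBINT y:{0..x}. dev_mean y * dev_mean (x - y)))"
    using set_integrable_dev_mean[of x] set_integrable_dev_var[of x] const by simp
  also have "(LBINT y:{0..x}. dev_var x) = x * dev_var x"
    using assms by (simp add: set_integral_const)
  finally have *: "(LBINT y:{0..x}. (dev_var y + dev_var (x - y) - dev_var x) + (dev_mean y + dev_mean (x - y))\<^sup>2) =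
      2 * (LBINT y:{0..x}. dev_var y) - x * dev_var x + 2 / 3 + 2 * (LBINT y:{0..x}. dev_mean y * dev_mean (x - y))"
    using set_integral_reflect[where h = dev_var and x = x] set_integral_reflect[where h = "\<lambda>y. (dev_mean y)\<^sup>2" and x = x] integral_dev_mean_sq[OF assms]
    by simp
  show ?thesis
    unfolding * integral_dev_mean_conv[OF assms] integral_dev_var[OF assms]
    using assms
    by (auto simp: dev_var_def var_rate_def field_simps power2_eq_square power3_eq_cube)
qed

section \<open>The Gaussian guess and its residual\<close>

definition gauss_approx :: "real \<Rightarrow> real \<Rightarrow> complex" where
  "gauss_approx \<theta> x = exp (\<i> * of_real (\<theta> * dev_mean x) - of_real (\<theta>\<^sup>2 * dev_var x / 2))"

lemma measurable_gauss_approx [measurable]: "gauss_approx \<theta> \<in> borel_measurable borel"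
  unfolding gauss_approx_def[abs_def] by measurable

lemma norm_gauss_approx: "norm (gauss_approx \<theta> x) = exp (- \<theta>\<^sup>2 * dev_var x / 2)"
  by (simp add: gauss_approx_def)

lemma norm_gauss_approx_le_1: "norm (gauss_approx \<theta> x) \<le> 1"
  using dev_var_nonneg[of x] by (simp add: norm_gauss_approx)

text \<open>The exponent has modulus at most (2 + 150 / 2) |\<theta>| and real part at most 75 in
  modulus, which gives the Taylor remainder. Squaring it also leaves terms in \<theta>^3 a b and
  \<theta>^4 b^2 beyond the second-order polynomial; 10000 generously covers 150 + 150^2 /
  8.\<close>

lemma exp_second_order_remainder:
  fixes \<theta> a b :: real
  assumes "\<bar>\<theta>\<bar> \<le> 1" "\<bar>a\<bar> \<le> 2" "\<bar>b\<bar> \<le> 150"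
  shows "norm (exp (\<i> * of_real (\<theta> * a) - of_real (\<theta>\<^sup>2 * b / 2)) -
      (1 + \<i> * of_real (\<theta> * a) - of_real (\<theta>\<^sup>2 / 2 * (b + a\<^sup>2)))) \<le> (exp 75 * 77 ^ 3 + 10000) * \<bar>\<theta>\<bar> ^ 3"
proof -
  define E where "E = \<i> * of_real (\<theta> * a) - of_real (\<theta>\<^sup>2 * b / 2)"
  have t2: "\<theta>\<^sup>2 \<le> \<bar>\<theta>\<bar>" 
    using assms(1) by (metis abs_ge_zero mult_left_le power2_abs power2_eq_square)
  have "\<bar>\<theta>\<^sup>2 * b / 2\<bar> \<le> \<bar>\<theta>\<bar> * 150 / 2"
    unfolding abs_mult abs_divide abs_numeral using assms t2 by (intro divide_right_mono mult_mono) auto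
  moreover have "\<bar>\<theta> * a\<bar> \<le> \<bar>\<theta>\<bar> * 2"
    unfolding abs_mult using assms by (intro mult_left_mono) auto
  ultimately have E: "norm E \<le> 77 * \<bar>\<theta>\<bar>"
  proof -
    have "norm E \<le> norm (\<i> * of_real (\<theta> * a)) + norm (complex_of_real (\<theta>\<^sup>2 * b / 2))"
      unfolding E_def by (rule norm_triangle_ineq4)
    also have "\<dots> = \<bar>\<theta> * a\<bar> + \<bar>\<theta>\<^sup>2 * b / 2\<bar>"
      by (simp only: norm_mult norm_of_real norm_ii mult_1)
    finally show ?thesis
      using \<open>\<bar>\<theta>\<^sup>2 * b / 2\<bar> \<le> \<bar>\<theta>\<bar> * 150 / 2\<close> \<open>\<bar>\<theta> * a\<bar> \<le> \<bar>\<theta>\<bar> * 2\<close> by linarith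
  qed
  have ReE: "\<bar>Re E\<bar> \<le> 75"
    using \<open>\<bar>\<theta>\<^sup>2 * b / 2\<bar> \<le> \<bar>\<theta>\<bar> * 150 / 2\<close> assms(1) by (simp add: E_def)
  have "norm (exp E - (\<Sum>k\<le>2. E ^ k / fact k)) \<le> exp \<bar>Re E\<bar> * norm E ^ Suc 2 / fact 2"
    by (rule Taylor_exp)
  also have "\<dots> \<le> exp \<bar>Re E\<bar> * norm E ^ 3"
    by (simp add: divide_le_eq)
  also have "\<dots> \<le> exp 75 * (77 * \<bar>\<theta>\<bar>) ^ 3"
    using power_mono[OF E, of 3] ReE by (intro mult_mono) auto
  finally have T: "norm (exp E - (1 + E + E\<^sup>2 / 2)) \<le> exp 75 * 77 ^ 3 * \<bar>\<theta>\<bar> ^ 3"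
    by (simp add: numeral_2_eq_2 power_mult_distrib)
  have eq: "(1 + E + E\<^sup>2 / 2) - (1 + \<i> * of_real (\<theta> * a) - of_real (\<theta>\<^sup>2 / 2 * (b + a\<^sup>2)))
     = of_real (\<theta> ^ 4 * b\<^sup>2 / 8) - \<i> * of_real (\<theta> ^ 3 * a * b / 2)"
    by (simp add: E_def complex_eq_iff power2_eq_square field_simps eval_nat_numeral)
  have "norm ((1 + E + E\<^sup>2 / 2) - (1 + \<i> * of_real (\<theta> * a) - of_real (\<theta>\<^sup>2 / 2 * (b + a\<^sup>2))))
      \<le> \<bar>\<theta> ^ 4 * b\<^sup>2 / 8\<bar> + \<bar>\<theta> ^ 3 * a * b / 2\<bar>"
    unfolding eq by (rule order_trans[OF norm_triangle_ineq4]) (simp only: norm_mult norm_of_real norm_ii mult_1 order_refl)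
  also have "\<bar>\<theta> ^ 4 * b\<^sup>2 / 8\<bar> \<le> \<bar>\<theta>\<bar> ^ 3 * 150\<^sup>2 / 8"
  proof -
    have "\<bar>\<theta>\<bar> ^ 4 \<le> \<bar>\<theta>\<bar> ^ 3" using assms(1) by (intro power_decreasing) auto
    moreover have "\<bar>b\<bar>\<^sup>2 \<le> 150\<^sup>2" using assms(3) by (intro power_mono) auto
    ultimately show ?thesis
      unfolding abs_mult abs_divide abs_numeral power_abs by (intro divide_right_mono mult_mono) auto
  qed
  also have "\<bar>\<theta> ^ 3 * a * b / 2\<bar> \<le> \<bar>\<theta>\<bar> ^ 3 * 2 * 150 / 2"
    unfolding abs_mult abs_divide abs_numeral power_abs using assms by (intro divide_right_mono mult_mono) auto
  finally have "norm ((1 + E + E\<^sup>2 / 2) - (1 + \<i> * of_real (\<theta> * a) - of_real (\<theta>\<^sup>2 / 2 * (b + a\<^sup>2))))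
      \<le> 10000 * \<bar>\<theta>\<bar> ^ 3"
    by simp (use zero_le_power[of "\<bar>\<theta>\<bar>" 3] in linarith)
  with T show ?thesis
    unfolding E_def[symmetric] using norm_triangle_ineq[of "exp E - (1 + E + E\<^sup>2 / 2)"
       "(1 + E + E\<^sup>2 / 2) - (1 + \<i> * of_real (\<theta> * a) - of_real (\<theta>\<^sup>2 / 2 * (b + a\<^sup>2)))"]
    by (simp add: algebra_simps)
qed

text \<open>Divide by the value at x and expand in \<theta>. The constant term integrates to x, the
  first order vanishes by \<open>integral_dev_mean\<close>, the second by
  \<open>dev_var_recursion\<close>. Keeping the factor |g(x)| in the bound preserves its decay for
  later.\<close>

lemma gauss_approx_residual:
  assumes "\<bar>\<theta>\<bar> \<le> 1" "1 < x"
  shows "norm ((LBINT y:{0..x}. gauss_approx \<theta> y * gauss_approx \<theta> (x - y)) - of_real x * gauss_approx \<theta> x)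
     \<le> 4 * (exp 75 * 77 ^ 3 + 10000) * \<bar>\<theta>\<bar> ^ 3 * norm (gauss_approx \<theta> x)"
proof -
  define C :: real where "C = exp 75 * 77 ^ 3 + 10000"
  have "C > 0" by (simp add: C_def add_pos_pos)
  define a where "a y = dev_mean y + dev_mean (x - y)" for y
  define b where "b y = dev_var y + dev_var (x - y) - dev_var x" for y
  define R where "R y = exp (\<i> * of_real (\<theta> * a y) - of_real (\<theta>\<^sup>2 * b y / 2)) -
      (1 + \<i> * of_real (\<theta> * a y) - of_real (\<theta>\<^sup>2 / 2 * (b y + (a y)\<^sup>2)))" for y
  have [measurable]: "a \<in> borel_measurable borel" "b \<in> borel_measurable borel"
    unfolding a_def[abs_def] b_def[abs_def] by measurable
  have [measurable]: "R \<in> borel_measurable borel"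
    unfolding R_def[abs_def] by measurable
  have a_le: "\<bar>a y\<bar> \<le> 2" if "y \<in> {0..x}" for y
    using that abs_dev_mean_le[of y] abs_dev_mean_le[of "x - y"] by (simp add: a_def)
  have b_le: "\<bar>b y\<bar> \<le> 150" if "y \<in> {0..x}" for y
  proof -
    have "b y = (dev_var y - var_rate * y) + (dev_var (x - y) - var_rate * (x - y)) - (dev_var x - var_rate * x)"
      by (simp add: b_def algebra_simps)
    then show ?thesis
      using dev_var_linear_bound[of y] dev_var_linear_bound[of "x - y"] dev_var_linear_bound[of x] that assms(2)
      by simp
  qed
  have R_le: "norm (R y) \<le> C * \<bar>\<theta>\<bar> ^ 3" if "y \<in> {0..x}" for y
    unfolding R_def C_def using assms(1) a_le[OF that] b_le[OF that] by (rule exp_second_order_remainder)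
  \<comment> \<open>When both pieces exceed 2, mean and variance are exactly additive and the
    expansion has no remainder. This keeps the residual bounded independently of x.\<close>
  have R_0: "R y = 0" if "2 < y" "2 < x - y" for y
    using that by (simp add: R_def a_def b_def dev_mean_def dev_var_def algebra_simps)
  have int_R: "set_integrable lborel {0..x} R"
    by (rule set_integrable_lborel_bounded[OF _ R_le]) auto
  have int_1: "set_integrable lborel {0..x} (\<lambda>y. 1 :: complex)"
    by (rule set_integrable_lborel_bounded[where B = 1]) auto
  have int_a: "set_integrable lborel {0..x} (\<lambda>y. \<i> * of_real (\<theta> * a y))"
    by (rule set_integrable_lborel_bounded[where B = "\<bar>\<theta>\<bar> * 2"])
       (auto simp: norm_mult intro!: mult_left_mono a_le)
  have int_b: "set_integrable lborel {0..x} (\<lambda>y. complex_of_real (\<theta>\<^sup>2 / 2 * (b y + (a y)\<^sup>2)))"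
  proof (rule set_integrable_lborel_bounded[where B = "\<theta>\<^sup>2 / 2 * (150 + 2\<^sup>2)"])
    fix y assume "y \<in> {0..x}"
    then have "\<bar>b y\<bar> \<le> 150" "\<bar>a y\<bar>\<^sup>2 \<le> 2\<^sup>2"
      using b_le power_mono[OF a_le abs_ge_zero] by blast+
    then have "\<bar>b y + (a y)\<^sup>2\<bar> \<le> 150 + 2\<^sup>2"
      unfolding power2_abs using zero_le_power2[of "a y"] by linarith
    then have "\<theta>\<^sup>2 / 2 * \<bar>b y + (a y)\<^sup>2\<bar> \<le> \<theta>\<^sup>2 / 2 * (150 + 2\<^sup>2)"
      by (intro mult_left_mono) auto
    then show "norm (complex_of_real (\<theta>\<^sup>2 / 2 * (b y + (a y)\<^sup>2))) \<le> \<theta>\<^sup>2 / 2 * (150 + 2\<^sup>2)"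
      by (simp only: norm_of_real abs_mult) simp
  qed measurable
  have prod: "gauss_approx \<theta> y * gauss_approx \<theta> (x - y) =
      gauss_approx \<theta> x * (((1 + \<i> * of_real (\<theta> * a y)) - of_real (\<theta>\<^sup>2 / 2 * (b y + (a y)\<^sup>2))) + R y)" for y
  proof -
    have "gauss_approx \<theta> y * gauss_approx \<theta> (x - y) =
        gauss_approx \<theta> x * exp (\<i> * of_real (\<theta> * a y) - of_real (\<theta>\<^sup>2 * b y / 2))"
      using assms(2) unfolding gauss_approx_def exp_add[symmetric]
      by (intro arg_cong[where f = exp]) (simp add: a_def b_def dev_mean_def field_simps)
    then show ?thesis by (simp add: R_def)
  qed
  have "(LBINT y:{0..x}. gauss_approx \<theta> y * gauss_approx \<theta> (x - y)) =
      gauss_approx \<theta> x * (LBINT y:{0..x}. ((1 + \<i> * of_real (\<theta> * a y)) - of_real (\<theta>\<^sup>2 / 2 * (b y + (a y)\<^sup>2))) + R y)"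
    unfolding prod by (rule set_integral_mult_right)
  also have "(LBINT y:{0..x}. ((1 + \<i> * of_real (\<theta> * a y)) - of_real (\<theta>\<^sup>2 / 2 * (b y + (a y)\<^sup>2))) + R y) =
      (LBINT y:{0..x}. (1 + \<i> * of_real (\<theta> * a y)) - of_real (\<theta>\<^sup>2 / 2 * (b y + (a y)\<^sup>2))) + (LBINT y:{0..x}. R y)"
    by (intro set_integral_add set_integral_diff int_R int_1 int_a int_b)
  also have "(LBINT y:{0..x}. (1 + \<i> * of_real (\<theta> * a y)) - of_real (\<theta>\<^sup>2 / 2 * (b y + (a y)\<^sup>2))) =
      (LBINT y:{0..x}. 1 + \<i> * of_real (\<theta> * a y)) - (LBINT y:{0..x}. complex_of_real (\<theta>\<^sup>2 / 2 * (b y + (a y)\<^sup>2)))"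
    by (intro set_integral_add set_integral_diff int_R int_1 int_a int_b)
  also have "(LBINT y:{0..x}. 1 + \<i> * of_real (\<theta> * a y)) =
      (LBINT y:{0..x}. 1) + (LBINT y:{0..x}. \<i> * of_real (\<theta> * a y))"
    by (intro set_integral_add set_integral_diff int_R int_1 int_a int_b)
  also have "(LBINT y:{0..x}. \<i> * of_real (\<theta> * a y)) = \<i> * of_real (\<theta> * (LBINT y:{0..x}. a y))"
    by (simp only: set_integral_mult_right set_integral_complex_of_real)
  also have "(LBINT y:{0..x}. a y) = 0"
    using set_integrable_dev_mean[of x] set_integral_reflect[where h = dev_mean and x = x] integral_dev_mean[OF assms(2)]
    unfolding a_def by simp
  also have "(LBINT y:{0..x}. complex_of_real (\<theta>\<^sup>2 / 2 * (b y + (a y)\<^sup>2))) =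
      of_real (\<theta>\<^sup>2 / 2 * (LBINT y:{0..x}. b y + (a y)\<^sup>2))"
    by (simp only: set_integral_mult_right set_integral_complex_of_real)
  also have "(LBINT y:{0..x}. b y + (a y)\<^sup>2) = 0"
    unfolding a_def b_def by (rule dev_var_recursion[OF assms(2)])
  also have "(LBINT y:{0..x}. 1 :: complex) = of_real x"
    using assms by (simp add: set_integral_const scaleR_conv_of_real)
  finally have main: "(LBINT y:{0..x}. gauss_approx \<theta> y * gauss_approx \<theta> (x - y)) - of_real x * gauss_approx \<theta> x
      = gauss_approx \<theta> x * (LBINT y:{0..x}. R y)"
    by (simp add: algebra_simps)
  have "norm (LBINT y:{0..x}. R y) \<le> (LBINT y. norm (indicator {0..x} y *\<^sub>R R y))"
    unfolding set_lebesgue_integral_def by (rule integral_norm_bound)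
  \<comment> \<open>Only y \<le> 2 or x - y \<le> 2 contributes: two windows of length 2, whence the
    factor 4.\<close>
  also have "\<dots> \<le> (LBINT y. (C * \<bar>\<theta>\<bar> ^ 3) * (indicator {0..2} y + indicator {x - 2..x} y))"
  proof (rule integral_mono')
    show "integrable lborel (\<lambda>y. (C * \<bar>\<theta>\<bar> ^ 3) * (indicator {0..2} y + indicator {x - 2..x} y) :: real)"
      by (intro integrable_mult_right Bochner_Integration.integrable_add)
         (auto simp: integrable_indicator_iff emeasure_lborel_Icc_eq)
    fix y
    have c: "0 \<le> C * \<bar>\<theta>\<bar> ^ 3" using \<open>C > 0\<close> by simp
    show "norm (indicator {0..x} y *\<^sub>R R y) \<le> (C * \<bar>\<theta>\<bar> ^ 3) * (indicator {0..2} y + indicator {x - 2..x} y)"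
    proof (cases "y \<in> {0..x}")
      case True
      show ?thesis
      proof (cases "2 < y \<and> 2 < x - y")
        case True
        then show ?thesis using R_0[of y] c by simp
      next
        case False
        then have "1 \<le> (indicator {0..2} y + indicator {x - 2..x} y :: real)"
          using \<open>y \<in> {0..x}\<close> by (auto simp: indicator_def)
        then have "C * \<bar>\<theta>\<bar> ^ 3 * 1 \<le> C * \<bar>\<theta>\<bar> ^ 3 * (indicator {0..2} y + indicator {x - 2..x} y)"
          using c by (intro mult_left_mono) auto
        then show ?thesis using R_le[OF \<open>y \<in> {0..x}\<close>] \<open>y \<in> {0..x}\<close> by simp
      qed
    next
      case False
      then show ?thesis using c by simp
    qed
    show "0 \<le> (C * \<bar>\<theta>\<bar> ^ 3) * (indicator {0..2} y + indicator {x - 2..x} y :: real)"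
      using \<open>C > 0\<close> by (intro mult_nonneg_nonneg) auto
  qed
  also have "\<dots> = (C * \<bar>\<theta>\<bar> ^ 3) * 4"
    by (subst integral_mult_right_zero, subst Bochner_Integration.integral_add)
       (auto simp: integrable_indicator_iff emeasure_lborel_Icc_eq)
  finally have "norm (LBINT y:{0..x}. R y) \<le> 4 * C * \<bar>\<theta>\<bar> ^ 3" by simp
  then show ?thesis
    unfolding main norm_mult C_def[symmetric]
    by (subst mult.commute, intro mult_right_mono) auto
qed

section \<open>Characteristic function of the splitting count\<close>

text \<open>The characteristic function of splits + 1 - 2 x, that is, of the number of pieces minus
  2 x. The additional 1 absorbs the factor z of \<open>split_gf_convolution\<close>, so the equation
  becomes x f = f * f without a prefactor.\<close>

definition count_char :: "real \<Rightarrow> real \<Rightarrow> complex" where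
  "count_char \<theta> x = cis (\<theta> * (1 - 2 * x)) * split_gf (cis \<theta>) x"

lemma measurable_count_char [measurable]: "count_char \<theta> \<in> borel_measurable borel"
proof -
  have [measurable]: "split_gf (cis \<theta>) \<in> borel_measurable borel"
    by (rule measurable_split_gf) simp
  have [measurable]: "(\<lambda>x. cis (\<theta> * (1 - 2 * x))) \<in> borel_measurable borel"
    unfolding cis_conv_exp by measurable
  show ?thesis
    unfolding count_char_def[abs_def] by measurable
qed

lemma norm_count_char_le_1: "norm (count_char \<theta> x) \<le> 1"
  using norm_split_gf_le_1[of "cis \<theta>" x] by (simp add: count_char_def norm_mult)

text \<open>Up to length 1 nothing is split: the count is deterministic and its variance is 0, so
  the guess is exact and the error starts from zero at x = 1.\<close>

lemma count_char_eq_gauss_approx: "x \<le> 1 \<Longrightarrow> count_char \<theta> x = gauss_approx \<theta> x"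
  by (simp add: count_char_def split_gf_le_1 gauss_approx_def dev_mean_def dev_var_def cis_conv_exp)

lemma count_char_convolution:
  assumes "x > 1"
  shows "of_real x * count_char \<theta> x = (LBINT y:{0..x}. count_char \<theta> y * count_char \<theta> (x - y))"
proof -
  have "count_char \<theta> y * count_char \<theta> (x - y) =
      (cis (\<theta> * (1 - 2 * x)) * cis \<theta>) * (split_gf (cis \<theta>) y * split_gf (cis \<theta>) (x - y))" for y
  proof -
    have "cis (\<theta> * (1 - 2 * y)) * cis (\<theta> * (1 - 2 * (x - y))) = cis (\<theta> * (1 - 2 * x)) * cis \<theta>"
      by (simp add: cis_mult algebra_simps)
    moreover have "count_char \<theta> y * count_char \<theta> (x - y) =
        (cis (\<theta> * (1 - 2 * y)) * cis (\<theta> * (1 - 2 * (x - y)))) * (split_gf (cis \<theta>) y * split_gf (cis \<theta>) (x - y))"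
      by (simp only: count_char_def mult_ac)
    ultimately show ?thesis by simp
  qed
  then have "(LBINT y:{0..x}. count_char \<theta> y * count_char \<theta> (x - y)) =
      (cis (\<theta> * (1 - 2 * x)) * cis \<theta>) * (LBINT y:{0..x}. split_gf (cis \<theta>) y * split_gf (cis \<theta>) (x - y))"
    by (simp only: set_integral_mult_right)
  also have "\<dots> = cis (\<theta> * (1 - 2 * x)) * (of_real x * split_gf (cis \<theta>) x)"
    using split_gf_convolution[of "cis \<theta>" x] assms by simp
  finally show ?thesis
    by (simp add: count_char_def mult_ac)
qed

lemma norm_set_integral_le:
  fixes f :: "real \<Rightarrow> 'b::{banach, second_countable_topology}"
  assumes "set_integrable lborel A h" "\<And>y. y \<in> A \<Longrightarrow> norm (f y) \<le> h y"
  shows "norm (LBINT y:A. f y) \<le> (LBINT y:A. h y)"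
proof -
  have "norm (LBINT y:A. f y) \<le> (LBINT y. norm (indicator A y *\<^sub>R f y))"
    unfolding set_lebesgue_integral_def by (rule integral_norm_bound)
  also have "\<dots> \<le> (LBINT y. indicator A y *\<^sub>R h y)"
  proof (rule integral_mono')
    show "integrable lborel (\<lambda>y. indicator A y *\<^sub>R h y)"
      using assms(1) by (simp add: set_integrable_def)
    show "norm (indicator A y *\<^sub>R f y) \<le> indicator A y *\<^sub>R h y" for y
      using assms(2)[of y] by (cases "y \<in> A") auto
    show "0 \<le> indicator A y *\<^sub>R h y" for y
      using order_trans[OF norm_ge_zero assms(2)[of y]] by (cases "y \<in> A") auto
  qed
  finally show ?thesis
    by (simp add: set_lebesgue_integral_def)
qed

definition residual_const :: real where
  "residual_const = 4 * (exp 75 * 77 ^ 3 + 10000)"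

lemma residual_const_pos: "residual_const > 0"
  by (simp add: residual_const_def add_pos_pos)

definition char_error :: "real \<Rightarrow> real \<Rightarrow> complex" where
  "char_error \<theta> x = count_char \<theta> x - gauss_approx \<theta> x"

lemma measurable_char_error [measurable]: "char_error \<theta> \<in> borel_measurable borel"
  unfolding char_error_def[abs_def] by measurable

lemma char_error_zero: "x \<le> 1 \<Longrightarrow> char_error \<theta> x = 0"
  by (simp add: char_error_def count_char_eq_gauss_approx)

lemma norm_char_error_le_2: "norm (char_error \<theta> x) \<le> 2"
  using norm_triangle_ineq4[of "count_char \<theta> x" "gauss_approx \<theta> x"]
    norm_count_char_le_1[of \<theta> x] norm_gauss_approx_le_1[of \<theta> x]
  by (simp add: char_error_def)

text \<open>The moduli of f and g stay in the integrand instead of being replaced by 1; this is what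
  later lets their decay enter the Gronwall argument.\<close>

lemma char_error_recursion:
  assumes "\<bar>\<theta>\<bar> \<le> 1" "1 < x"
  shows "x * norm (char_error \<theta> x) \<le>
    (LBINT y:{0..x}. norm (char_error \<theta> y) * (norm (count_char \<theta> (x - y)) + norm (gauss_approx \<theta> (x - y))))
    + residual_const * \<bar>\<theta>\<bar> ^ 3 * norm (gauss_approx \<theta> x)"
proof -
  let ?f = "count_char \<theta>" and ?g = "gauss_approx \<theta>" and ?D = "char_error \<theta>"
  have bnd: "norm (?f y) \<le> 1" "norm (?g y) \<le> 1" "norm (?D y) \<le> 2" for y
    by (rule norm_count_char_le_1 norm_gauss_approx_le_1 norm_char_error_le_2)+
  have m2: "norm (a * b) \<le> 2" if "norm a \<le> 2" "norm b \<le> 1" for a b :: complex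
    using mult_mono[OF that] by (simp add: norm_mult)
  have m2': "norm (a * b) \<le> 2" if "norm a \<le> 1" "norm b \<le> 2" for a b :: complex
    using mult_mono[OF that] by (simp add: norm_mult)
  have ints: "set_integrable lborel {0..x} (\<lambda>y. ?f y * ?f (x - y))" "set_integrable lborel {0..x} (\<lambda>y. ?g y * ?g (x - y))"
    "set_integrable lborel {0..x} (\<lambda>y. ?D y * ?f (x - y))" "set_integrable lborel {0..x} (\<lambda>y. ?g y * ?D (x - y))"
    "set_integrable lborel {0..x} (\<lambda>y. ?D y * ?g (x - y))"
    by (rule set_integrable_lborel_bounded[where B = 2], measurable,
        (rule m2 m2' bnd order_trans[OF bnd(1)] order_trans[OF bnd(2)] | simp)+)+
  have "of_real x * ?D x = (LBINT y:{0..x}. ?f y * ?f (x - y)) - (LBINT y:{0..x}. ?g y * ?g (x - y))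
      + ((LBINT y:{0..x}. ?g y * ?g (x - y)) - of_real x * ?g x)"
    using count_char_convolution[OF assms(2), of \<theta>] by (simp add: char_error_def algebra_simps)
  also have "(LBINT y:{0..x}. ?f y * ?f (x - y)) - (LBINT y:{0..x}. ?g y * ?g (x - y)) =
      (LBINT y:{0..x}. ?f y * ?f (x - y) - ?g y * ?g (x - y))"
    using ints by simp
  \<comment> \<open>The factorisation f f - g g = D f + g D; reflecting the second integral makes D
    the factor at y in both.\<close>
  also have "\<dots> = (LBINT y:{0..x}. ?D y * ?f (x - y) + ?g y * ?D (x - y))"
    by (simp add: char_error_def algebra_simps)
  also have "\<dots> = (LBINT y:{0..x}. ?D y * ?f (x - y)) + (LBINT y:{0..x}. ?g y * ?D (x - y))"
    using ints by simp
  also have "(LBINT y:{0..x}. ?g y * ?D (x - y)) = (LBINT y:{0..x}. ?D y * ?g (x - y))"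
    using set_integral_reflect[where h = "\<lambda>y. ?D y * ?g (x - y)" and x = x] by (simp add: mult.commute)
  also have "(LBINT y:{0..x}. ?D y * ?f (x - y)) + (LBINT y:{0..x}. ?D y * ?g (x - y)) =
      (LBINT y:{0..x}. ?D y * ?f (x - y) + ?D y * ?g (x - y))"
    using ints by simp
  finally have "norm (of_real x * ?D x) \<le> norm (LBINT y:{0..x}. ?D y * ?f (x - y) + ?D y * ?g (x - y)) +
      norm ((LBINT y:{0..x}. ?g y * ?g (x - y)) - of_real x * ?g x)"
    by (simp only: norm_triangle_ineq)
  also have "norm (LBINT y:{0..x}. ?D y * ?f (x - y) + ?D y * ?g (x - y)) \<le>
      (LBINT y:{0..x}. norm (?D y) * (norm (?f (x - y)) + norm (?g (x - y))))"
  proof (rule norm_set_integral_le)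
    show "set_integrable lborel {0..x} (\<lambda>y. norm (?D y) * (norm (?f (x - y)) + norm (?g (x - y))))"
    proof (rule set_integrable_lborel_bounded[where B = "2 * (1 + 1)"])
      fix y
      have "norm (?D y) * (norm (?f (x - y)) + norm (?g (x - y))) \<le> 2 * (1 + 1)"
        by (intro mult_mono add_mono bnd) auto
      then show "norm (norm (?D y) * (norm (?f (x - y)) + norm (?g (x - y)))) \<le> 2 * (1 + 1)" by simp
    qed measurable
    show "norm (?D y * ?f (x - y) + ?D y * ?g (x - y)) \<le> norm (?D y) * (norm (?f (x - y)) + norm (?g (x - y)))" for y
      by (metis norm_triangle_ineq norm_mult distrib_left)
  qed
  also have "norm ((LBINT y:{0..x}. ?g y * ?g (x - y)) - of_real x * ?g x) \<le>
      residual_const * \<bar>\<theta>\<bar> ^ 3 * norm (?g x)"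
    unfolding residual_const_def by (rule gauss_approx_residual[OF assms])
  finally show ?thesis
    using assms(2) by (simp add: norm_mult)
qed

text \<open>The crude version with |f|, |g| \<le> 1, that is, Gronwall with A = 2. It carries no
  decay and serves only on [3/2, 2], as the seed of the decay estimate.\<close>

lemma char_error_le_linear:
  assumes "\<bar>\<theta>\<bar> \<le> 1" "1 < x"
  shows "norm (char_error \<theta> x) \<le> residual_const * \<bar>\<theta>\<bar> ^ 3 * x"
proof -
  let ?h = "\<lambda>y u. norm (char_error \<theta> u) * (norm (count_char \<theta> (y - u)) + norm (gauss_approx \<theta> (y - u)))"
  have "norm (char_error \<theta> x) \<le> residual_const * \<bar>\<theta>\<bar> ^ 3 / 1 powr 2 * x powr (2 - 1)"
  proof (rule gronwall_averaged[where X = x and B = 2])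
    show "0 \<le> residual_const * \<bar>\<theta>\<bar> ^ 3" using residual_const_pos by simp
    show "norm (char_error \<theta> y) \<le> 2" for y by (rule norm_char_error_le_2)
    show "norm (char_error \<theta> y) = 0" if "y \<le> 1" for y using that by (simp add: char_error_zero)
    fix y :: real assume y: "1 < y"
    have "(LBINT u:{0..y}. ?h y u) \<le>
        (LBINT u:{0..y}. 2 * norm (char_error \<theta> u))"
    proof (rule set_integral_mono)
      have *: "?h y u \<le> norm (char_error \<theta> u) * (1 + 1)" for u
        by (intro mult_left_mono add_mono norm_count_char_le_1 norm_gauss_approx_le_1) auto
      show "set_integrable lborel {0..y} (\<lambda>u. ?h y u)"
      proof (rule set_integrable_lborel_bounded[where B = 4])
        show "norm (?h y u) \<le> 4" for u
          using *[of u] norm_char_error_le_2[of \<theta> u] by simp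
      qed measurable
      show "set_integrable lborel {0..y} (\<lambda>u. 2 * norm (char_error \<theta> u))"
        by (rule set_integrable_lborel_bounded[where B = 4]) (use norm_char_error_le_2 in auto)
      show "?h y u \<le> 2 * norm (char_error \<theta> u)" for u
        using *[of u] by simp
    qed
    also have "\<dots> = 2 * (LBINT u:{0..y}. norm (char_error \<theta> u))" by simp
    moreover have "residual_const * \<bar>\<theta>\<bar> ^ 3 * norm (gauss_approx \<theta> y) \<le> residual_const * \<bar>\<theta>\<bar> ^ 3 * 1"
      using residual_const_pos by (intro mult_left_mono norm_gauss_approx_le_1) auto
    ultimately show "y * norm (char_error \<theta> y) \<le> 2 * (LBINT u:{0..y}. norm (char_error \<theta> u)) + residual_const * \<bar>\<theta>\<bar> ^ 3"
      using char_error_recursion[OF assms(1) y] by linarith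
  qed (use assms in auto)
  then show ?thesis using assms by simp
qed

section \<open>Exponential decay for small angles\<close>

definition small_angle :: real where
  "small_angle = 1 / (40 * residual_const + 1)"

text \<open>The third bound is the purpose of the definition: for angles this small, the cubic error
  of \<open>char_error_le_linear\<close> at x \<le> 2 is at most \<theta>^2 / 20.\<close>

lemma small_angle: "0 < small_angle" "small_angle \<le> 1" "40 * residual_const * small_angle \<le> 1"
  using residual_const_pos by (auto simp: small_angle_def)

text \<open>Variance at least 2/5 makes the Gaussian guess at most exp (- \<theta>^2 / 5), hence at
  most 1 - \<theta>^2 / 10; the error gives back no more than half of this gain.\<close>

lemma norm_count_char_le_middle:
  assumes "\<bar>\<theta>\<bar> \<le> small_angle" "3 / 2 \<le> x" "x \<le> 2"
  shows "norm (count_char \<theta> x) \<le> 1 - \<theta>\<^sup>2 / 20"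
proof -
  have th1: "\<bar>\<theta>\<bar> \<le> 1" using assms small_angle by linarith
  then have th2: "\<theta>\<^sup>2 \<le> 1" by (simp add: abs_square_le_1)
  have "norm (count_char \<theta> x) \<le> norm (gauss_approx \<theta> x) + norm (char_error \<theta> x)"
    unfolding char_error_def by (metis norm_triangle_sub)
  also have "norm (gauss_approx \<theta> x) \<le> exp (- (\<theta>\<^sup>2 / 5))"
  proof -
    have "\<theta>\<^sup>2 * (2 / 5) \<le> \<theta>\<^sup>2 * dev_var x"
      using dev_var_ge[OF assms(2,3)] by (intro mult_left_mono) auto
    then show ?thesis by (simp add: norm_gauss_approx)
  qed
  also have "exp (- (\<theta>\<^sup>2 / 5)) \<le> 1 - \<theta>\<^sup>2 / 10"
  proof -
    have "exp (- (\<theta>\<^sup>2 / 5)) \<le> 1 / (1 + \<theta>\<^sup>2 / 5)"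
      using exp_ge_add_one_self[of "\<theta>\<^sup>2 / 5"] by (simp add: exp_minus inverse_eq_divide frac_le add_pos_nonneg)
    also have "\<dots> \<le> 1 - \<theta>\<^sup>2 / 10"
    proof -
      have "1 \<le> (1 - \<theta>\<^sup>2 / 10) * (1 + \<theta>\<^sup>2 / 5)"
      proof -
        have "\<theta>\<^sup>2 * \<theta>\<^sup>2 \<le> \<theta>\<^sup>2 * 1" using th2 by (intro mult_left_mono) auto
        moreover have "(1 - \<theta>\<^sup>2 / 10) * (1 + \<theta>\<^sup>2 / 5) = 1 + \<theta>\<^sup>2 / 10 - \<theta>\<^sup>2 * \<theta>\<^sup>2 / 50"
          by (simp add: field_simps)
        ultimately show ?thesis using zero_le_power2[of \<theta>] by linarith
      qed
      then show ?thesis by (simp add: divide_le_eq add_pos_nonneg)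
    qed
    finally show ?thesis .
  qed
  also have "norm (char_error \<theta> x) \<le> \<theta>\<^sup>2 / 20"
  proof -
    have "norm (char_error \<theta> x) \<le> residual_const * \<bar>\<theta>\<bar> ^ 3 * x"
      using assms th1 by (intro char_error_le_linear) auto
    also have "\<dots> \<le> residual_const * \<bar>\<theta>\<bar> ^ 3 * 2"
      using assms residual_const_pos by (intro mult_left_mono) auto
    also have "\<dots> = (40 * residual_const * \<bar>\<theta>\<bar>) * \<theta>\<^sup>2 / 20"
      by (simp add: power3_eq_cube power2_eq_square)
    also have "\<dots> \<le> 1 * \<theta>\<^sup>2 / 20"
    proof -
      have "40 * residual_const * \<bar>\<theta>\<bar> \<le> 40 * residual_const * small_angle"
        using assms residual_const_pos by (intro mult_left_mono) auto
      then show ?thesis using small_angle(3) by (intro divide_right_mono mult_right_mono) auto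
    qed
    finally show ?thesis by simp
  qed
  finally show ?thesis by linarith
qed

text \<open>A supersolution of the convolution equation: the mass that is added where the modulus of
  \<open>count_char\<close> may be 1 is more than compensated on the interval from 3/2 to 2.\<close>

definition super_bump :: "real \<Rightarrow> real \<Rightarrow> real" where
  "super_bump \<eta> x = (if x \<le> 3 / 2 then \<eta> else if x \<le> 2 then - 5 * \<eta> else 0)"

definition supersolution :: "real \<Rightarrow> real \<Rightarrow> real" where
  "supersolution \<eta> x = exp (- \<eta> * x / 2) * (1 + super_bump \<eta> x)"

lemma measurable_super_bump [measurable]: "super_bump \<eta> \<in> borel_measurable borel"
  unfolding super_bump_def[abs_def] by measurable

lemma measurable_supersolution [measurable]: "supersolution \<eta> \<in> borel_measurable borel"
  unfolding supersolution_def[abs_def] by measurable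

context
  fixes \<eta> :: real
  assumes eta: "0 \<le> \<eta>" "\<eta> \<le> 1 / 100"
begin

lemma super_bump_bounds: "- 5 * \<eta> \<le> super_bump \<eta> x" "super_bump \<eta> x \<le> \<eta>" "\<bar>super_bump \<eta> x\<bar> \<le> 5 * \<eta>"
  using eta by (auto simp: super_bump_def)

lemma supersolution_nonneg: "0 \<le> supersolution \<eta> x"
  unfolding supersolution_def using super_bump_bounds(1)[of x] eta by (intro mult_nonneg_nonneg) auto

lemma supersolution_le: "supersolution \<eta> x \<le> exp (- \<eta> * x / 2) * (1 + \<eta>)"
  unfolding supersolution_def using super_bump_bounds(2)[of x] by (intro mult_left_mono) auto

lemma supersolution_le_2: "0 \<le> x \<Longrightarrow> supersolution \<eta> x \<le> 2"
proof -
  assume "0 \<le> x"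
  then have "exp (- \<eta> * x / 2) * (1 + \<eta>) \<le> 1 * 2"
    using eta by (intro mult_mono) auto
  then show ?thesis using supersolution_le[of x] by linarith
qed

text \<open>Gain 3/2 * \<eta> against loss 1/2 * 5 \<eta>: the height -5 \<eta> is chosen so that
  the net mass is negative.\<close>

lemma integral_super_bump:
  assumes "2 < x"
  shows "(LBINT y:{0..x}. super_bump \<eta> y) = - \<eta>"
proof -
  have "(LBINT y:{0..x}. super_bump \<eta> y) =
      (LBINT y. \<eta> * indicator {0..3/2} y + (- 5 * \<eta>) * indicator {3/2<..2::real} y)"
    unfolding set_lebesgue_integral_def using assms
    by (intro Bochner_Integration.integral_cong) (auto simp: indicator_def super_bump_def)
  also have "\<dots> = (LBINT y. \<eta> * indicator {0..3/2::real} y) + (LBINT y. (- 5 * \<eta>) * indicator {3/2<..2::real} y)"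
  proof (rule Bochner_Integration.integral_add)
    have "emeasure lborel {3/2<..2::real} < \<infinity>"
      by (subst emeasure_lborel_Ioc) (simp, simp only: infinity_ennreal_def ennreal_less_top)
    then show "integrable lborel (\<lambda>y. (- 5 * \<eta>) * indicator {3/2<..2::real} y)"
      by (intro integrable_mult_right integrable_real_indicator) auto
  qed (auto simp: integrable_indicator_iff emeasure_lborel_Icc_eq)
  finally show ?thesis by simp
qed

text \<open>The exponential factors out of the convolution, leaving the integral of (1 + bump) times
  its reflection. The two linear terms contribute -2 \<eta>; the quadratic term lives on y \<le> 2
  and is at most 2 * 25 \<eta>^2.\<close>

lemma supersolution_convolution:
  assumes "2 < x"
  shows "(LBINT y:{0..x}. supersolution \<eta> y * supersolution \<eta> (x - y)) \<le> x * supersolution \<eta> x"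
proof -
  let ?e = "super_bump \<eta>"
  have ee: "\<bar>?e y * ?e (x - y)\<bar> \<le> 25 * \<eta>\<^sup>2" for y
    using mult_mono[OF super_bump_bounds(3)[of y] super_bump_bounds(3)[of "x - y"]] eta
    by (simp add: abs_mult power2_eq_square)
  have ints: "set_integrable lborel {0..x} (\<lambda>y. 1 :: real)" "set_integrable lborel {0..x} ?e"
    "set_integrable lborel {0..x} (\<lambda>y. ?e (x - y))"
    "set_integrable lborel {0..x} (\<lambda>y. ?e y * ?e (x - y))"
    using eta
    by (auto intro!: set_integrable_lborel_bounded[where B = "1 + 5 * \<eta> + 25 * \<eta>\<^sup>2"]
        order_trans[OF super_bump_bounds(3)] order_trans[OF ee])
  have "supersolution \<eta> y * supersolution \<eta> (x - y) =
      exp (- \<eta> * x / 2) * (1 + ?e y + ?e (x - y) + ?e y * ?e (x - y))" for y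
  proof -
    have "exp (- \<eta> * y / 2) * exp (- \<eta> * (x - y) / 2) = exp (- \<eta> * x / 2)"
      by (simp add: exp_add[symmetric] field_simps)
    then show ?thesis
      unfolding supersolution_def by (simp add: algebra_simps)
  qed
  then have "(LBINT y:{0..x}. supersolution \<eta> y * supersolution \<eta> (x - y)) =
      exp (- \<eta> * x / 2) * (LBINT y:{0..x}. 1 + ?e y + ?e (x - y) + ?e y * ?e (x - y))"
    by (simp only: set_integral_mult_right)
  also have "(LBINT y:{0..x}. 1 + ?e y + ?e (x - y) + ?e y * ?e (x - y)) =
      (LBINT y:{0..x}. 1) + (LBINT y:{0..x}. ?e y) + (LBINT y:{0..x}. ?e (x - y)) + (LBINT y:{0..x}. ?e y * ?e (x - y))"
    using ints by simp
  also have "\<dots> = x - 2 * \<eta> + (LBINT y:{0..x}. ?e y * ?e (x - y))"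
    using integral_super_bump[OF assms] set_integral_reflect[where h = ?e and x = x] assms
    by (simp add: set_integral_const)
  also have "(LBINT y:{0..x}. ?e y * ?e (x - y)) \<le> (LBINT y:{0..2::real}. 25 * \<eta>\<^sup>2)"
    unfolding set_lebesgue_integral_def
  proof (rule integral_mono')
    show "integrable lborel (\<lambda>y. indicator {0..2::real} y *\<^sub>R (25 * \<eta>\<^sup>2))"
      by (simp add: integrable_indicator_iff emeasure_lborel_Icc_eq)
    show "indicator {0..x} y *\<^sub>R (?e y * ?e (x - y)) \<le> indicator {0..2} y *\<^sub>R (25 * \<eta>\<^sup>2)" for y
    proof (cases "y \<in> {0..2}")
      case True
      have "?e y * ?e (x - y) \<le> 25 * \<eta>\<^sup>2" using ee[of y] by linarith
      then show ?thesis using True assms by simp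
    next
      case False
      then have "y \<in> {0..x} \<Longrightarrow> ?e y = 0" by (simp add: super_bump_def)
      then show ?thesis using False by (cases "y \<in> {0..x}") simp_all
    qed
  qed auto
  also have "\<dots> = 50 * \<eta>\<^sup>2"
    by (simp add: set_integral_const)
  \<comment> \<open>With \<eta> \<le> 1 / 100 the quadratic contribution is at most \<eta> / 2, less
    than the linear loss.\<close>
  also have "x - 2 * \<eta> + 50 * \<eta>\<^sup>2 \<le> x"
  proof -
    have "\<eta> * \<eta> \<le> \<eta> * (1 / 100)" using eta by (intro mult_left_mono) auto
    then show ?thesis using eta by (simp add: power2_eq_square)
  qed
  finally show ?thesis
    using assms by (simp add: supersolution_def super_bump_def mult.commute)
qed

end

text \<open>A comparison principle: the positive part of |f| - G vanishes up to 2 and satisfies the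
  averaged inequality beyond with E = 0, so it vanishes everywhere. The value \<eta> = \<theta>^2 /
  120 makes 6 \<eta> equal to the gain \<theta>^2 / 20 available on [3/2, 2].\<close>

lemma norm_count_char_le_supersolution:
  assumes "\<bar>\<theta>\<bar> \<le> small_angle" "0 \<le> x"
  shows "norm (count_char \<theta> x) \<le> supersolution (\<theta>\<^sup>2 / 120) x"
proof -
  define \<eta> where "\<eta> = \<theta>\<^sup>2 / 120"
  have th1: "\<bar>\<theta>\<bar> \<le> 1" using assms small_angle by linarith
  then have "\<theta>\<^sup>2 \<le> 1" by (simp add: abs_square_le_1)
  then have eta: "0 \<le> \<eta>" "\<eta> \<le> 1 / 100" by (auto simp: \<eta>_def)
  let ?f = "\<lambda>y. norm (count_char \<theta> y)" and ?G = "supersolution \<eta>"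
  have base: "?f y \<le> ?G y" if "y \<le> 2" for y
  proof (cases "y \<le> 3 / 2")
    case True
    \<comment> \<open>Up to 3/2 only |f| \<le> 1 is used; the raised factor 1 + \<eta> must outweigh
      the exponential, which loses at most 3 \<eta> / 4 there.\<close>
    have "1 \<le> (1 - 3 * \<eta> / 4) * (1 + \<eta>)"
    proof -
      have "\<eta> * \<eta> \<le> \<eta> * (1 / 100)" using eta by (intro mult_left_mono) auto
      then show ?thesis using eta by (simp add: algebra_simps)
    qed
    also have "\<dots> \<le> exp (- \<eta> * y / 2) * (1 + \<eta>)"
    proof (rule mult_right_mono)
      have "\<eta> * y \<le> \<eta> * (3 / 2)" using True eta by (intro mult_left_mono) auto
      then show "1 - 3 * \<eta> / 4 \<le> exp (- \<eta> * y / 2)"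
        using exp_ge_add_one_self[of "- \<eta> * y / 2"] by simp
    qed (use eta in auto)
    finally show ?thesis
      using True norm_count_char_le_1[of \<theta> y] by (simp add: supersolution_def super_bump_def)
  next
    case False
    have "?f y \<le> 1 - 6 * \<eta>"
      using norm_count_char_le_middle[OF assms(1), of y] False that by (simp add: \<eta>_def)
    \<comment> \<open>The gain 6 \<eta> is split: 5 \<eta> for the lowered bump and \<eta> for the
      exponential on y \<le> 2.\<close>
    also have "\<dots> \<le> (1 - \<eta>) * (1 - 5 * \<eta>)"
      using eta by (simp add: algebra_simps)
    also have "\<dots> \<le> exp (- \<eta> * y / 2) * (1 - 5 * \<eta>)"
    proof (rule mult_right_mono)
      have "\<eta> * y \<le> \<eta> * 2" using that eta by (intro mult_left_mono) auto
      then show "1 - \<eta> \<le> exp (- \<eta> * y / 2)"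
        using exp_ge_add_one_self[of "- \<eta> * y / 2"] by simp
    qed (use eta in auto)
    finally show ?thesis
      using False that by (simp add: supersolution_def super_bump_def)
  qed
  have "?f x \<le> ?G x"
  proof (cases "x \<le> 2")
    case False
    define b where "b y = max 0 (?f y - ?G y)" for y
    have b0: "0 \<le> b y" and b1: "b y \<le> 1" and bf: "?f y \<le> ?G y + b y" for y
      using norm_count_char_le_1[of \<theta> y] supersolution_nonneg[OF eta, of y] by (auto simp: b_def)
    have [measurable]: "b \<in> borel_measurable borel" unfolding b_def[abs_def] by measurable
    have "b x \<le> 0 / 2 powr 3 * x powr (3 - 1)"
    proof (rule gronwall_averaged[where X = x and B = 1])
      show "b y = 0" if "y \<le> 2" for y using base[OF that] by (simp add: b_def)
      fix y assume y: "2 < y" "y \<le> x"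
      have int_G: "set_integrable lborel {0..y} (\<lambda>u. ?G u * ?G (y - u))"
      proof (rule set_integrable_lborel_bounded[where B = "2 * 2"])
        fix u assume "u \<in> {0..y}"
        then have "?G u * ?G (y - u) \<le> 2 * 2"
          by (intro mult_mono supersolution_le_2[OF eta] supersolution_nonneg[OF eta]) auto
        then show "norm (?G u * ?G (y - u)) \<le> 2 * 2"
          using supersolution_nonneg[OF eta] by (simp add: abs_mult)
      qed measurable
      have int_b: "set_integrable lborel {0..y} b" "set_integrable lborel {0..y} (\<lambda>u. b (y - u))"
        using b0 b1 by (auto intro!: set_integrable_lborel_bounded[where B = 1])
      have "y * ?f y = norm (LBINT u:{0..y}. count_char \<theta> u * count_char \<theta> (y - u))"
      proof -
        have "norm (complex_of_real y * count_char \<theta> y) = y * norm (count_char \<theta> y)"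
          using y by (simp add: norm_mult)
        then show ?thesis
          using count_char_convolution[of y \<theta>] y by simp
      qed
      also have "\<dots> \<le> (LBINT u:{0..y}. ?G u * ?G (y - u) + (2 * b (y - u) + b u))"
      proof (rule norm_set_integral_le)
        show "set_integrable lborel {0..y} (\<lambda>u. ?G u * ?G (y - u) + (2 * b (y - u) + b u))"
          by (intro set_integral_add set_integrable_mult_right int_G int_b)
        fix u assume u: "u \<in> {0..y}"
        \<comment> \<open>Expanding |f| \<le> G + b one factor at a time, with G \<le> 2 and |f|
          \<le> 1, leaves 2 b + b beside the product of the G: hence A = 3.\<close>
        have "norm (count_char \<theta> u) * norm (count_char \<theta> (y - u)) \<le> (?G u + b u) * norm (count_char \<theta> (y - u))"
          by (intro mult_right_mono bf) auto
        moreover have "?G u * norm (count_char \<theta> (y - u)) \<le> ?G u * (?G (y - u) + b (y - u))"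
          by (intro mult_left_mono bf supersolution_nonneg[OF eta])
        moreover have "b u * norm (count_char \<theta> (y - u)) \<le> b u * 1"
          by (intro mult_left_mono norm_count_char_le_1 b0)
        moreover have "?G u * b (y - u) \<le> 2 * b (y - u)"
          using u by (intro mult_right_mono[OF supersolution_le_2[OF eta] b0]) auto
        ultimately show "norm (count_char \<theta> u * count_char \<theta> (y - u)) \<le> ?G u * ?G (y - u) + (2 * b (y - u) + b u)"
          unfolding norm_mult distrib_left distrib_right mult_1_right by linarith
      qed
      also have "\<dots> = (LBINT u:{0..y}. ?G u * ?G (y - u)) + (2 * (LBINT u:{0..y}. b (y - u)) + (LBINT u:{0..y}. b u))"
        using int_G int_b by simp
      finally have "y * norm (count_char \<theta> y) \<le> (LBINT u:{0..y}. ?G u * ?G (y - u)) +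
          (2 * (LBINT u:{0..y}. b (y - u)) + (LBINT u:{0..y}. b u))" .
      moreover have "(LBINT u:{0..y}. b (y - u)) = (LBINT u:{0..y}. b u)"
        by (rule set_integral_reflect[where h = b and x = y])
      moreover have "(LBINT u:{0..y}. ?G u * ?G (y - u)) \<le> y * ?G y"
        by (rule supersolution_convolution[OF eta y(1)])
      ultimately have "y * (norm (count_char \<theta> y) - ?G y) \<le> 3 * (LBINT u:{0..y}. b u)"
        unfolding right_diff_distrib by linarith
      moreover have "0 \<le> (LBINT u:{0..y}. b u)"
        unfolding set_lebesgue_integral_def using b0 by (intro integral_nonneg_AE AE_I2) auto
      ultimately show "y * b y \<le> 3 * (LBINT u:{0..y}. b u) + 0"
        by (simp add: b_def max_def)
    qed (use False b0 b1 in auto)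
    then show ?thesis by (simp add: b_def)
  qed (use base in auto)
  then show ?thesis by (simp add: \<eta>_def)
qed

text \<open>Both |f| and |g| are at most (1 + 2 \<eta>) exp (- \<eta> y / 2). As exponentials
  multiply along y and x - y, the weighted error |D| exp (\<eta> y / 2) satisfies the averaged
  inequality with A = 2 + 4 \<eta>. The excess of A over 2 costs a power of x with exponent 4 \<eta>
  = \<theta>^2 / 30.\<close>

lemma char_error_le_powr:
  assumes "\<bar>\<theta>\<bar> \<le> small_angle" "1 < x"
  shows "norm (char_error \<theta> x) \<le> 2 * residual_const * \<bar>\<theta>\<bar> ^ 3 * x powr (1 + \<theta>\<^sup>2 / 30) * exp (- \<theta>\<^sup>2 * x / 240)"
proof -
  let ?h = "\<lambda>y u. norm (char_error \<theta> u) * (norm (count_char \<theta> (y - u)) + norm (gauss_approx \<theta> (y - u)))"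
  define \<eta> where "\<eta> = \<theta>\<^sup>2 / 120"
  have th1: "\<bar>\<theta>\<bar> \<le> 1" using assms small_angle by linarith
  then have th2: "\<theta>\<^sup>2 \<le> 1" by (simp add: abs_square_le_1)
  then have eta: "0 \<le> \<eta>" "\<eta> \<le> 1 / 100" by (auto simp: \<eta>_def)
  have f_le: "norm (count_char \<theta> y) \<le> exp (- \<eta> * y / 2) * (1 + 2 * \<eta>)" if "0 \<le> y" for y
  proof -
    have "norm (count_char \<theta> y) \<le> exp (- \<eta> * y / 2) * (1 + \<eta>)"
      using norm_count_char_le_supersolution[OF assms(1) that] supersolution_le[OF eta, of y]
      unfolding \<eta>_def[symmetric] by linarith
    also have "\<dots> \<le> exp (- \<eta> * y / 2) * (1 + 2 * \<eta>)"
      using eta by (intro mult_left_mono) auto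
    finally show ?thesis .
  qed
  have g_le: "norm (gauss_approx \<theta> y) \<le> exp (- \<eta> * y / 2) * (1 + 2 * \<eta>)" if "0 \<le> y" for y
  proof (cases "y \<le> 2")
    case True
    \<comment> \<open>On y \<le> 2 the Gaussian guess is only bounded by 1 while the exponential
      loses up to \<eta>; a factor 1 + \<eta> would fall just short, so 1 + 2 \<eta> is used for f
      and g alike.\<close>
    have "1 \<le> (1 - \<eta>) * (1 + 2 * \<eta>)"
    proof -
      have "\<eta> * \<eta> \<le> \<eta> * (1 / 100)" using eta by (intro mult_left_mono) auto
      then show ?thesis using eta by (simp add: algebra_simps)
    qed
    also have "\<dots> \<le> exp (- \<eta> * y / 2) * (1 + 2 * \<eta>)"
    proof (rule mult_right_mono)
      have "\<eta> * y \<le> \<eta> * 2" using True eta by (intro mult_left_mono) auto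
      then show "1 - \<eta> \<le> exp (- \<eta> * y / 2)"
        using exp_ge_add_one_self[of "- \<eta> * y / 2"] by simp
    qed (use eta in auto)
    finally show ?thesis using norm_gauss_approx_le_1[of \<theta> y] by linarith
  next
    case False
    have "\<theta>\<^sup>2 * y * (1 / 120) \<le> \<theta>\<^sup>2 * y * var_rate"
      using var_rate_ge that by (intro mult_left_mono) auto
    then have "norm (gauss_approx \<theta> y) \<le> exp (- \<eta> * y / 2) * 1"
      using False by (simp add: norm_gauss_approx dev_var_def \<eta>_def mult_ac)
    also have "\<dots> \<le> exp (- \<eta> * y / 2) * (1 + 2 * \<eta>)"
      using eta by (intro mult_left_mono) auto
    finally show ?thesis .
  qed
  define b where "b y = norm (char_error \<theta> y) * exp (\<eta> * y / 2)" for y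
  have [measurable]: "b \<in> borel_measurable borel" unfolding b_def[abs_def] by measurable
  have b0: "0 \<le> b y" for y by (simp add: b_def)
  have b_le: "b y \<le> 2 * exp (\<eta> * x / 2)" if "y \<le> x" for y
    unfolding b_def using that eta
    by (intro mult_mono norm_char_error_le_2) (auto intro!: mult_left_mono divide_right_mono)
  have "b x \<le> 2 * residual_const * \<bar>\<theta>\<bar> ^ 3 / 1 powr (2 + 4 * \<eta>) * x powr ((2 + 4 * \<eta>) - 1)"
  proof (rule gronwall_averaged[where X = x and B = "2 * exp (\<eta> * x / 2)"])
    show "0 \<le> 2 * residual_const * \<bar>\<theta>\<bar> ^ 3" using residual_const_pos by simp
    show "b y = 0" if "y \<le> 1" for y using that by (simp add: b_def char_error_zero)
    fix y assume y: "1 < y" "y \<le> x"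
    have int_b: "set_integrable lborel {0..y} b"
      using b0 b_le y by (intro set_integrable_lborel_bounded[where B = "2 * exp (\<eta> * x / 2)"]) auto
    have "(LBINT u:{0..y}. ?h y u) \<le>
        (LBINT u:{0..y}. (exp (- \<eta> * y / 2) * (2 + 4 * \<eta>)) * b u)"
    proof (rule set_integral_mono)
      show "set_integrable lborel {0..y} (\<lambda>u. ?h y u)"
      proof (rule set_integrable_lborel_bounded[where B = "2 * (1 + 1)"])
        fix u
        have "?h y u \<le> 2 * (1 + 1)"
          by (intro mult_mono add_mono norm_count_char_le_1 norm_gauss_approx_le_1 norm_char_error_le_2) auto
        then show "norm (?h y u) \<le> 2 * (1 + 1)"
          by simp
      qed measurable
      show "set_integrable lborel {0..y} (\<lambda>u. (exp (- \<eta> * y / 2) * (2 + 4 * \<eta>)) * b u)"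
        using int_b by simp
      fix u assume u: "u \<in> {0..y}"
      have "?h y u \<le>
          norm (char_error \<theta> u) * (exp (- \<eta> * (y - u) / 2) * (1 + 2 * \<eta>) + exp (- \<eta> * (y - u) / 2) * (1 + 2 * \<eta>))"
        using u by (intro mult_left_mono add_mono f_le g_le) auto
      also have "exp (- \<eta> * (y - u) / 2) = exp (- \<eta> * y / 2) * exp (\<eta> * u / 2)"
        by (simp add: exp_add[symmetric] field_simps)
      finally show "?h y u \<le>
          (exp (- \<eta> * y / 2) * (2 + 4 * \<eta>)) * b u"
        by (simp add: b_def algebra_simps)
    qed
    also have "\<dots> = exp (- \<eta> * y / 2) * ((2 + 4 * \<eta>) * (LBINT u:{0..y}. b u))"
      by simp
    finally have "y * norm (char_error \<theta> y) \<le> exp (- \<eta> * y / 2) * ((2 + 4 * \<eta>) * (LBINT u:{0..y}. b u))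
        + residual_const * \<bar>\<theta>\<bar> ^ 3 * norm (gauss_approx \<theta> y)"
      using char_error_recursion[OF th1 y(1)] by linarith
    also have "residual_const * \<bar>\<theta>\<bar> ^ 3 * norm (gauss_approx \<theta> y) \<le>
        residual_const * \<bar>\<theta>\<bar> ^ 3 * (exp (- \<eta> * y / 2) * 2)"
    proof -
      have "norm (gauss_approx \<theta> y) \<le> exp (- \<eta> * y / 2) * (1 + 2 * \<eta>)"
        using y by (intro g_le) simp
      also have "\<dots> \<le> exp (- \<eta> * y / 2) * 2"
        using eta by (intro mult_left_mono) auto
      finally show ?thesis
        using residual_const_pos by (intro mult_left_mono) simp_all
    qed
    finally have "y * norm (char_error \<theta> y) \<le>
        exp (- \<eta> * y / 2) * ((2 + 4 * \<eta>) * (LBINT u:{0..y}. b u) + 2 * residual_const * \<bar>\<theta>\<bar> ^ 3)"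
      by (simp add: algebra_simps)
    then have "y * norm (char_error \<theta> y) * exp (\<eta> * y / 2) \<le>
        exp (- \<eta> * y / 2) * ((2 + 4 * \<eta>) * (LBINT u:{0..y}. b u) + 2 * residual_const * \<bar>\<theta>\<bar> ^ 3) * exp (\<eta> * y / 2)"
      by (intro mult_right_mono) auto
    also have "\<dots> = (2 + 4 * \<eta>) * (LBINT u:{0..y}. b u) + 2 * residual_const * \<bar>\<theta>\<bar> ^ 3"
      by (simp add: exp_minus)
    finally show "y * b y \<le> (2 + 4 * \<eta>) * (LBINT u:{0..y}. b u) + 2 * residual_const * \<bar>\<theta>\<bar> ^ 3"
      by (simp add: b_def mult.assoc)
  qed (use assms b0 b_le eta in auto)
  then have "norm (char_error \<theta> x) * exp (\<eta> * x / 2) \<le> 2 * residual_const * \<bar>\<theta>\<bar> ^ 3 * x powr (1 + 4 * \<eta>)"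
    by (simp add: b_def)
  then have "norm (char_error \<theta> x) * exp (\<eta> * x / 2) * exp (- \<eta> * x / 2) \<le>
      2 * residual_const * \<bar>\<theta>\<bar> ^ 3 * x powr (1 + 4 * \<eta>) * exp (- \<eta> * x / 2)"
    by (intro mult_right_mono) auto
  moreover have "norm (char_error \<theta> x) * exp (\<eta> * x / 2) * exp (- \<eta> * x / 2) = norm (char_error \<theta> x)"
    unfolding mult.assoc exp_add[symmetric] by simp
  moreover have "4 * \<eta> = \<theta>\<^sup>2 / 30" "- \<eta> * x / 2 = - \<theta>\<^sup>2 * x / 240"
    by (simp_all add: \<eta>_def)
  ultimately show ?thesis
    by (simp only:)
qed

text \<open>The spurious power x^(\<theta>^2 / 30) is absorbed by giving up half of the exponential
  rate, from 1/240 to 1/480.\<close>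

lemma count_char_gaussian:
  assumes "\<bar>\<theta>\<bar> \<le> small_angle" "2 < x"
  shows "norm (count_char \<theta> x - of_real (exp (- \<theta>\<^sup>2 * var_rate * x / 2))) \<le>
    32 * residual_const * \<bar>\<theta>\<bar> ^ 3 * x * exp (- \<theta>\<^sup>2 * x / 480)"
proof -
  have th1: "\<bar>\<theta>\<bar> \<le> 1" using assms small_angle by linarith
  then have th2: "\<theta>\<^sup>2 \<le> 1" by (simp add: abs_square_le_1)
  have "gauss_approx \<theta> x = of_real (exp (- \<theta>\<^sup>2 * var_rate * x / 2))"
    using assms(2) by (simp add: gauss_approx_def dev_mean_def dev_var_def exp_of_real[symmetric] mult.assoc)
  then have "norm (count_char \<theta> x - of_real (exp (- \<theta>\<^sup>2 * var_rate * x / 2))) = norm (char_error \<theta> x)"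
    by (simp add: char_error_def)
  also have le: "norm (char_error \<theta> x) \<le> 2 * residual_const * \<bar>\<theta>\<bar> ^ 3 * (x powr (1 + \<theta>\<^sup>2 / 30) * exp (- \<theta>\<^sup>2 * x / 240))"
    using char_error_le_powr[OF assms(1), of x] assms(2) by (simp add: mult.assoc)
  also have "\<dots> \<le> 2 * residual_const * \<bar>\<theta>\<bar> ^ 3 * (16 * x * exp (- \<theta>\<^sup>2 * x / 480))"
  proof (rule mult_left_mono)
    \<comment> \<open>The number 16 is chosen because 30 * 16 = 480: the linear part x / 16 then
      uses exactly half of the rate, and the rest costs a factor of at most 16.\<close>
    have "ln x = ln (x / 16) + ln 16" using assms(2) by (simp add: ln_div)
    also have "ln (x / 16) \<le> x / 16" using ln_le_minus_one[of "x / 16"] assms(2) by simp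
    finally have "\<theta>\<^sup>2 / 30 * ln x \<le> \<theta>\<^sup>2 / 30 * (x / 16 + ln 16)"
      by (intro mult_left_mono) auto
    also have "\<dots> \<le> \<theta>\<^sup>2 * x / 480 + ln 16"
    proof -
      have "\<theta>\<^sup>2 / 30 * ln 16 \<le> 1 * ln 16" using th2 by (intro mult_right_mono) auto
      then show ?thesis by (simp add: algebra_simps)
    qed
    finally have "exp (\<theta>\<^sup>2 / 30 * ln x) \<le> exp (\<theta>\<^sup>2 * x / 480 + ln 16)" by simp
    then have *: "x powr (\<theta>\<^sup>2 / 30) \<le> 16 * exp (\<theta>\<^sup>2 * x / 480)"
      using assms(2) by (simp add: powr_def exp_add)
    have "x powr (1 + \<theta>\<^sup>2 / 30) * exp (- \<theta>\<^sup>2 * x / 240) = x * x powr (\<theta>\<^sup>2 / 30) * exp (- \<theta>\<^sup>2 * x / 240)"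
      using assms(2) by (simp add: powr_add)
    also have "\<dots> \<le> x * (16 * exp (\<theta>\<^sup>2 * x / 480)) * exp (- \<theta>\<^sup>2 * x / 240)"
      using * assms(2) by (intro mult_right_mono mult_left_mono) auto
    also have "\<dots> = 16 * x * (exp (\<theta>\<^sup>2 * x / 480) * exp (- \<theta>\<^sup>2 * x / 240))" by simp
    also have "exp (\<theta>\<^sup>2 * x / 480) * exp (- \<theta>\<^sup>2 * x / 240) = exp (- \<theta>\<^sup>2 * x / 480)"
      by (simp add: exp_add[symmetric])
    finally show "x powr (1 + \<theta>\<^sup>2 / 30) * exp (- \<theta>\<^sup>2 * x / 240) \<le> 16 * x * exp (- \<theta>\<^sup>2 * x / 480)" .
  qed (use residual_const_pos in simp)
  also have "\<dots> = 32 * residual_const * \<bar>\<theta>\<bar> ^ 3 * x * exp (- \<theta>\<^sup>2 * x / 480)"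
    by simp
  finally show ?thesis .
qed

section \<open>Berry--Esseen bound for the splitting count\<close>

lemma Phi_eq_cdf: "Phi = cdf std_normal_distribution"
  by (simp add: fun_eq_iff Phi_def cdf_def)

interpretation std_normal: real_distribution std_normal_distribution
  by (rule real_dist_normal_dist)

lemma Phi_mono: "a \<le> b \<Longrightarrow> Phi a \<le> Phi b"
  unfolding Phi_eq_cdf by (rule std_normal.cdf_nondecreasing)

lemma Phi_bounds: "0 \<le> Phi a" "Phi a \<le> 1"
  unfolding Phi_eq_cdf by (rule std_normal.cdf_nonneg, rule std_normal.cdf_bounded_prob)

lemma Phi_diff_le:
  assumes "a \<le> b" "\<And>z. z \<in> {a..b} \<Longrightarrow> std_normal_density z \<le> m"
  shows "Phi b - Phi a \<le> m * (b - a)"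
proof -
  have Phi_int: "Phi c = (LBINT z. std_normal_density z * indicator {..c} z)" for c
    unfolding Phi_eq_cdf std_normal.cdf_eq_integral by (subst integral_density) auto
  have int: "integrable lborel (\<lambda>z. std_normal_density z * indicator {..c} z)" for c
    by (rule Bochner_Integration.integrable_bound[OF integrable_normal_density[of 1 0]]) (auto simp: indicator_def)
  have "Phi b - Phi a = (LBINT z. std_normal_density z * indicator {..b} z - std_normal_density z * indicator {..a} z)"
    unfolding Phi_int using int by simp
  also have "\<dots> \<le> (LBINT z. m * indicator {a..b} z)"
  proof (rule integral_mono')
    show "integrable lborel (\<lambda>z. m * indicator {a..b} z)"
      by (auto simp: integrable_indicator_iff emeasure_lborel_Icc_eq)
    have "std_normal_density a \<le> m" using assms by auto
    then have "0 \<le> m" using normal_density_nonneg[of 0 1 a] by linarith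
    then show "0 \<le> m * indicator {a..b} z" for z by simp
    show "std_normal_density z * indicator {..b} z - std_normal_density z * indicator {..a} z \<le> m * indicator {a..b} z" for z
      using assms(1) assms(2)[of z] \<open>0 \<le> m\<close> by (auto simp: indicator_def)
  qed
  also have "\<dots> = m * (b - a)" using assms(1) by simp
  finally show ?thesis .
qed

lemma std_normal_density_le_1: "std_normal_density z \<le> 1"
proof -
  have "1 \<le> sqrt (2 * pi)" using pi_gt3 by simp
  then have "1 / sqrt (2 * pi) * exp (- z\<^sup>2 / 2) \<le> 1 * 1"
    by (intro mult_mono) (auto simp: divide_le_eq)
  then show ?thesis by (simp add: std_normal_density_def)
qed

lemma std_normal_density_le_inverse_square: "z\<^sup>2 * std_normal_density z \<le> 1"
proof -
  have "2 \<le> sqrt (2 * pi)" using pi_gt3 by (intro real_le_rsqrt) simp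
  have "z\<^sup>2 / 2 * exp (- z\<^sup>2 / 2) \<le> 1"
    using exp_ge_add_one_self[of "z\<^sup>2 / 2"] by (simp add: exp_minus field_simps)
  then have "z\<^sup>2 * exp (- z\<^sup>2 / 2) \<le> 2" by simp
  also have "2 \<le> sqrt (2 * pi)" by fact
  finally show ?thesis by (simp add: std_normal_density_def field_simps)
qed

lemma Phi_lipschitz: "\<bar>Phi b - Phi a\<bar> \<le> \<bar>b - a\<bar>"
proof (cases "a \<le> b")
  case True
  then show ?thesis using Phi_diff_le[of a b 1] Phi_mono[of a b] std_normal_density_le_1 by auto
next
  case False
  then show ?thesis using Phi_diff_le[of b a 1] Phi_mono[of b a] std_normal_density_le_1 by auto
qed

lemma Phi_diff_le_inverse_square:
  assumes "0 < r" "\<And>z. z \<in> {min a b..max a b} \<Longrightarrow> r \<le> z\<^sup>2"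
  shows "\<bar>Phi b - Phi a\<bar> \<le> \<bar>b - a\<bar> / r"
proof -
  have dens: "std_normal_density z \<le> 1 / r" if "z \<in> {min a b..max a b}" for z
  proof -
    have "r * std_normal_density z \<le> z\<^sup>2 * std_normal_density z"
      using assms(2)[OF that] by (intro mult_right_mono) auto
    also have "\<dots> \<le> 1" by (rule std_normal_density_le_inverse_square)
    finally show ?thesis using \<open>0 < r\<close> by (simp add: field_simps)
  qed
  show ?thesis
  proof (cases "a \<le> b")
    case True
    then show ?thesis using Phi_diff_le[of a b "1 / r"] Phi_mono[of a b] dens by simp
  next
    case False
    then show ?thesis using Phi_diff_le[of b a "1 / r"] Phi_mono[of b a] dens by simp
  qed
qed

text \<open>Chebyshev's inequality is strong enough: it is applied at s of order sqrt n, where 1 /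
  s^2 is of order 1 / n.\<close>

lemma Phi_tail:
  assumes "0 < s"
  shows "1 - Phi s \<le> 1 / s\<^sup>2" "Phi (- s) \<le> 1 / s\<^sup>2"
proof -
  have X: "distributed std_normal_distribution lborel (\<lambda>z. z) std_normal_density"
    by (auto simp: distributed_def distr_id2)
  have "measure std_normal_distribution {z \<in> space std_normal_distribution. s \<le> \<bar>z - std_normal.expectation (\<lambda>z. z)\<bar>}
      \<le> std_normal.variance (\<lambda>z. z) / s\<^sup>2"
    using integrable_std_normal_distribution_moment[of 2] assms
    by (intro std_normal.Chebyshev_inequality) auto
  then have cheb: "measure std_normal_distribution {z. s \<le> \<bar>z\<bar>} \<le> 1 / s\<^sup>2"
    using std_normal.standard_normal_distributed_expectation[OF X] std_normal.standard_normal_distributed_variance[OF X]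
    by simp
  have "Phi (- s) \<le> measure std_normal_distribution {z. s \<le> \<bar>z\<bar>}"
    unfolding Phi_def by (intro std_normal.finite_measure_mono) auto
  then show "Phi (- s) \<le> 1 / s\<^sup>2" using cheb by simp
  have "1 - Phi s = measure std_normal_distribution (space std_normal_distribution - {..s})"
    unfolding Phi_def by (subst std_normal.prob_compl) auto
  also have "\<dots> \<le> measure std_normal_distribution {z. s \<le> \<bar>z\<bar>}"
    by (intro std_normal.finite_measure_mono) auto
  finally show "1 - Phi s \<le> 1 / s\<^sup>2" using cheb by simp
qed

lemma integral_gaussian_unit_le:
  assumes "0 < c"
  shows "set_integrable lborel {0..1} (\<lambda>\<theta>. exp (- c * \<theta>\<^sup>2 / 2))"
    and "(LBINT \<theta>:{0..1}. exp (- c * \<theta>\<^sup>2 / 2)) \<le> sqrt (2 * pi / c)"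
proof -
  define \<sigma> where "\<sigma> = 1 / sqrt c"
  have \<sigma>: "\<sigma> > 0" "\<sigma>\<^sup>2 = 1 / c" using assms by (auto simp: \<sigma>_def power_divide)
  have eq: "exp (- c * \<theta>\<^sup>2 / 2) = sqrt (2 * pi / c) * normal_density 0 \<sigma> \<theta>" for \<theta>
    using assms \<sigma> by (simp add: normal_density_def)
  have int: "integrable lborel (\<lambda>\<theta>. sqrt (2 * pi / c) * normal_density 0 \<sigma> \<theta>)"
    using \<sigma> by (intro integrable_mult_right integrable_normal_density)
  show "set_integrable lborel {0..1} (\<lambda>\<theta>. exp (- c * \<theta>\<^sup>2 / 2))"
    by (rule set_integrable_lborel_bounded[where B = 1]) (use assms in auto)
  have "(LBINT \<theta>:{0..1}. exp (- c * \<theta>\<^sup>2 / 2)) \<le> (LBINT \<theta>. sqrt (2 * pi / c) * normal_density 0 \<sigma> \<theta>)"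
    unfolding set_lebesgue_integral_def eq
    by (rule integral_mono'[OF int]) (use assms in \<open>auto simp: indicator_def\<close>)
  also have "\<dots> = sqrt (2 * pi / c)"
    using \<sigma> by (simp add: integral_normal_density)
  finally show "(LBINT \<theta>:{0..1}. exp (- c * \<theta>\<^sup>2 / 2)) \<le> sqrt (2 * pi / c)" .
qed

section \<open>The count as a random variable and its rate of convergence\<close>

definition count_pmf :: "real \<Rightarrow> nat pmf" where
  "count_pmf x = embed_pmf (\<lambda>k. split_prob k x)"

lemma pmf_count_pmf: "pmf (count_pmf x) k = split_prob k x"
  unfolding count_pmf_def
proof (rule pmf_embed_pmf)
  show "(\<integral>\<^sup>+ k. ennreal (split_prob k x) \<partial>count_space UNIV) = 1"
    using suminf_split_prob[of x] summable_split_prob[of x]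
    by (simp add: nn_integral_count_space_nat suminf_ennreal2 split_prob_nonneg)
qed (rule split_prob_nonneg)

lemma expectation_count_pmf:
  "(\<integral>k. iexp (\<theta> * (real k + 1 - 2 * x)) \<partial>measure_pmf (count_pmf x)) = count_char \<theta> x"
proof -
  let ?h = "\<lambda>k. iexp (\<theta> * (real k + 1 - 2 * x))"
  have int: "integrable (measure_pmf (count_pmf x)) ?h"
    by (rule measure_pmf.integrable_const_bound[where B = 1]) auto
  have dens: "measure_pmf (count_pmf x) = density (count_space UNIV) (\<lambda>k. ennreal (split_prob k x))"
    by (simp add: measure_pmf_eq_density pmf_count_pmf)
  have "integrable (count_space UNIV) (\<lambda>k. split_prob k x *\<^sub>R ?h k)"
    using int unfolding dens by (subst (asm) integrable_density) (auto simp: split_prob_nonneg)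
  then have "(\<lambda>k. split_prob k x *\<^sub>R ?h k) sums (\<integral>k. split_prob k x *\<^sub>R ?h k \<partial>count_space UNIV)"
    by (rule sums_integral_count_space_nat)
  also have "(\<integral>k. split_prob k x *\<^sub>R ?h k \<partial>count_space UNIV) = (\<integral>k. ?h k \<partial>measure_pmf (count_pmf x))"
    unfolding dens by (subst integral_density) (auto simp: split_prob_nonneg)
  finally have S: "(\<lambda>k. split_prob k x *\<^sub>R ?h k) sums (\<integral>k. ?h k \<partial>measure_pmf (count_pmf x))" .
  have gf: "(\<lambda>k. cis (\<theta> * (1 - 2 * x)) * (split_prob k x *\<^sub>R cis \<theta> ^ k)) sums count_char \<theta> x"
    unfolding count_char_def by (intro sums_mult split_gf_sums) simp
  have eq: "cis (\<theta> * (1 - 2 * x)) * (split_prob k x *\<^sub>R cis \<theta> ^ k) = split_prob k x *\<^sub>R ?h k" for k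
  proof -
    have "cis (\<theta> * (1 - 2 * x)) * cis \<theta> ^ k = ?h k"
      by (simp add: Complex.DeMoivre cis_mult cis_conv_exp[symmetric] algebra_simps flip: of_real_mult of_real_add of_real_diff)
    then show ?thesis by simp
  qed
  show ?thesis
    using S gf unfolding eq by (rule sums_unique2)
qed

text \<open>Esseen's inequality with cut-off T = sqrt (v x) \<delta>, where v is
  \<open>var_rate\<close>: all frequencies then stay within \<open>small_angle\<close>, and 1 / T is
  already of order 1 / sqrt x. The remaining integrand is a constant times exp (- c x \<theta>^2 /
  2), whose integral has the same order.\<close>

lemma split_count_berry_esseen:
  "\<exists>C\<ge>0. \<forall>x n. 2 < x \<longrightarrow>
     \<bar>(\<Sum>k\<le>n. split_prob k x) - Phi ((real n + 1 - 2 * x) / sqrt (var_rate * x))\<bar> \<le> C / sqrt x"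
proof -
  obtain C0 where "C0 \<ge> 0" and C0: "\<And>\<mu> \<nu> T m e s. real_distribution \<mu> \<Longrightarrow> real_distribution \<nu> \<Longrightarrow> T > 0 \<Longrightarrow> m \<ge> 0 \<Longrightarrow>
     (\<forall>a b. a \<le> b \<longrightarrow> cdf \<nu> b - cdf \<nu> a \<le> m * (b - a)) \<Longrightarrow>
     set_integrable lborel {0..1} e \<Longrightarrow> (\<forall>\<theta>\<in>{0..1}. 0 \<le> e \<theta>) \<Longrightarrow>
     (\<forall>\<theta>. 0 < \<theta> \<longrightarrow> \<theta> \<le> 1 \<longrightarrow> cmod (char \<mu> (\<theta> * T) - char \<nu> (\<theta> * T)) \<le> \<theta> * e \<theta>) \<Longrightarrow>
     \<bar>cdf \<mu> s - cdf \<nu> s\<bar> \<le> C0 * ((LBINT \<theta>:{0..1}. e \<theta>) + m / T)"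
    using esseen_smoothing by blast
  define \<delta> where "\<delta> = small_angle"
  have \<delta>: "0 < \<delta>" "\<delta> \<le> 1" using small_angle by (auto simp: \<delta>_def)
  \<comment> \<open>With \<phi> = \<theta> \<delta>, the exponent \<phi>^2 x / 480 of
    \<open>count_char_gaussian\<close> becomes c x \<theta>^2.\<close>
  define c where "c = \<delta>\<^sup>2 / 480"
  have c: "c > 0" using \<delta> by (simp add: c_def)
  define K where "K = 32 * residual_const * \<delta> ^ 3 * 2 / c"
  have K: "K \<ge> 0" using residual_const_pos \<delta> c by (simp add: K_def)
  define C where "C = C0 * (K * sqrt (2 * pi / c) + 1 / (sqrt var_rate * \<delta>))"
  have v: "var_rate > 0" using var_rate_ge by linarith
  have "\<bar>(\<Sum>k\<le>n. split_prob k x) - Phi ((real n + 1 - 2 * x) / sqrt (var_rate * x))\<bar> \<le> C / sqrt x"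
    if x: "2 < x" for x n
  proof -
    define a where "a = sqrt (var_rate * x)"
    have a: "a > 0" "a\<^sup>2 = var_rate * x" using v x by (auto simp: a_def)
    define \<mu> where "\<mu> = distr (measure_pmf (count_pmf x)) borel (\<lambda>k. (real k + 1 - 2 * x) / a)"
    interpret m: real_distribution \<mu>
      unfolding \<mu>_def by (rule prob_space.real_distribution_distr[OF prob_space_measure_pmf]) simp
    define e where "e \<theta> = K * exp (- (c * x) * \<theta>\<^sup>2 / 2)" for \<theta>
    have cx: "c * x > 0" using c x by simp
    have char: "char \<mu> (\<theta> * (a * \<delta>)) = count_char (\<theta> * \<delta>) x" for \<theta>
    proof -
      have "char \<mu> (\<theta> * (a * \<delta>)) = (\<integral>k. iexp (\<theta> * (a * \<delta>) * ((real k + 1 - 2 * x) / a)) \<partial>measure_pmf (count_pmf x))"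
        unfolding char_def \<mu>_def by (subst integral_distr) auto
      also have "\<dots> = (\<integral>k. iexp ((\<theta> * \<delta>) * (real k + 1 - 2 * x)) \<partial>measure_pmf (count_pmf x))"
        using a by (intro Bochner_Integration.integral_cong refl arg_cong[where f = iexp]) simp
      finally show ?thesis by (simp only: expectation_count_pmf)
    qed
    have char_le: "cmod (char \<mu> (\<theta> * (a * \<delta>)) - char std_normal_distribution (\<theta> * (a * \<delta>))) \<le> \<theta> * e \<theta>"
      if "0 < \<theta>" "\<theta> \<le> 1" for \<theta>
    proof -
      define \<phi> where "\<phi> = \<theta> * \<delta>"
      have \<phi>: "\<bar>\<phi>\<bar> \<le> small_angle" "0 < \<phi>"
        using that \<delta> mult_right_mono[of \<theta> 1 \<delta>] by (auto simp: \<phi>_def \<delta>_def[symmetric])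
      have "char std_normal_distribution (\<theta> * (a * \<delta>)) = of_real (exp (- \<phi>\<^sup>2 * var_rate * x / 2))"
        by (simp add: char_std_normal_distribution \<phi>_def power_mult_distrib a(2) mult_ac)
      then have "cmod (char \<mu> (\<theta> * (a * \<delta>)) - char std_normal_distribution (\<theta> * (a * \<delta>))) \<le>
          32 * residual_const * \<bar>\<phi>\<bar> ^ 3 * x * exp (- \<phi>\<^sup>2 * x / 480)"
        using count_char_gaussian[OF \<phi>(1) x] unfolding char \<phi>_def[symmetric] by simp
      also have "\<dots> = \<theta> * (32 * residual_const * \<delta> ^ 3 / c) * ((c * x * \<theta>\<^sup>2) * exp (- (c * x * \<theta>\<^sup>2)))"
      proof -
        have "- \<phi>\<^sup>2 * x / 480 = - (c * x * \<theta>\<^sup>2)" by (simp add: \<phi>_def c_def power_mult_distrib)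
        moreover have "\<bar>\<phi>\<bar> ^ 3 * x = \<theta> * (\<delta> ^ 3 / c) * (c * x * \<theta>\<^sup>2)"
          using that \<delta> c by (simp add: \<phi>_def power_mult_distrib power3_eq_cube power2_eq_square abs_mult)
        ultimately show ?thesis by (simp add: mult.assoc)
      qed
      \<comment> \<open>The growing factor u = c x \<theta>^2 is removed by u exp (-u) \<le> 2 exp
        (-u / 2); this is the 2 in K.\<close>
      also have "\<dots> \<le> \<theta> * (32 * residual_const * \<delta> ^ 3 / c) * (2 * exp (- (c * x) * \<theta>\<^sup>2 / 2))"
      proof (rule mult_left_mono)
        define u where "u = c * x * \<theta>\<^sup>2"
        have "u / 2 \<le> exp (u / 2)" using exp_ge_add_one_self[of "u / 2"] by linarith
        then have "u * exp (- u) \<le> (2 * exp (u / 2)) * exp (- u)" by (intro mult_right_mono) auto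
        also have "\<dots> = 2 * exp (- u / 2)" by (simp add: mult.assoc exp_add[symmetric])
        finally show "(c * x * \<theta>\<^sup>2) * exp (- (c * x * \<theta>\<^sup>2)) \<le> 2 * exp (- (c * x) * \<theta>\<^sup>2 / 2)"
          by (simp add: u_def)
      qed (use that residual_const_pos \<delta> c in auto)
      also have "\<dots> = \<theta> * e \<theta>" by (simp add: e_def K_def)
      finally show ?thesis .
    qed
    have "\<bar>cdf \<mu> ((real n + 1 - 2 * x) / a) - cdf std_normal_distribution ((real n + 1 - 2 * x) / a)\<bar> \<le>
        C0 * ((LBINT \<theta>:{0..1}. e \<theta>) + 1 / (a * \<delta>))"
    proof (rule C0)
      show "\<forall>r s. r \<le> s \<longrightarrow> cdf std_normal_distribution s - cdf std_normal_distribution r \<le> 1 * (s - r)"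
        unfolding Phi_eq_cdf[symmetric] using Phi_diff_le std_normal_density_le_1 by blast
      show "set_integrable lborel {0..1} e"
        unfolding e_def[abs_def] using integral_gaussian_unit_le(1)[OF cx] by simp
      show "\<forall>\<theta>\<in>{0..1}. 0 \<le> e \<theta>" using K by (simp add: e_def)
    qed (use char_le a \<delta> m.real_distribution_axioms std_normal.real_distribution_axioms in auto)
    also have "cdf \<mu> ((real n + 1 - 2 * x) / a) = (\<Sum>k\<le>n. split_prob k x)"
    proof -
      have "cdf \<mu> ((real n + 1 - 2 * x) / a) =
          measure (measure_pmf (count_pmf x)) {k. (real k + 1 - 2 * x) / a \<le> (real n + 1 - 2 * x) / a}"
        unfolding cdf_def \<mu>_def by (subst measure_distr) (auto simp: vimage_def)
      also have "{k. (real k + 1 - 2 * x) / a \<le> (real n + 1 - 2 * x) / a} = {..n}"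
        using a by (auto simp: divide_le_cancel)
      finally show ?thesis
        by (simp add: measure_measure_pmf_finite pmf_count_pmf)
    qed
    also have "C0 * ((LBINT \<theta>:{0..1}. e \<theta>) + 1 / (a * \<delta>)) \<le> C / sqrt x"
    proof -
      have "(LBINT \<theta>:{0..1}. e \<theta>) \<le> K * sqrt (2 * pi / (c * x))"
        unfolding e_def using mult_left_mono[OF integral_gaussian_unit_le(2)[OF cx] K] by simp
      also have "K * sqrt (2 * pi / (c * x)) = K * sqrt (2 * pi / c) / sqrt x"
        by (simp add: real_sqrt_divide real_sqrt_mult)
      finally have "(LBINT \<theta>:{0..1}. e \<theta>) + 1 / (a * \<delta>) \<le>
          K * sqrt (2 * pi / c) / sqrt x + 1 / (sqrt var_rate * \<delta>) / sqrt x"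
        by (simp add: a_def real_sqrt_mult mult_ac)
      then have "C0 * ((LBINT \<theta>:{0..1}. e \<theta>) + 1 / (a * \<delta>)) \<le>
          C0 * (K * sqrt (2 * pi / c) / sqrt x + 1 / (sqrt var_rate * \<delta>) / sqrt x)"
        using \<open>C0 \<ge> 0\<close> by (rule mult_left_mono)
      also have "\<dots> = C / sqrt x"
        unfolding C_def by (simp only: add_divide_distrib[symmetric] times_divide_eq_right)
      finally show ?thesis .
    qed
    finally show ?thesis
      by (simp add: Phi_eq_cdf a_def)
  qed
  moreover have "C \<ge> 0"
    using \<open>C0 \<ge> 0\<close> K c v \<delta> by (simp add: C_def)
  ultimately show ?thesis by blast
qed

section \<open>The largest interval\<close>

lemma inverse_sqrt_diff_le:
  fixes \<tau> :: real
  assumes "\<bar>\<tau>\<bar> \<le> 1 / 2"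
  shows "\<bar>1 / sqrt (1 + \<tau>) - 1\<bar> \<le> 2 * \<bar>\<tau>\<bar>"
proof -
  define r where "r = sqrt (1 + \<tau>)"
  have r2: "r * r = 1 + \<tau>" using assms by (simp add: r_def)
  have r: "1 / 2 \<le> r"
    unfolding r_def using assms by (intro real_le_rsqrt) (simp add: power2_eq_square)
  have "1 / r - 1 = (1 - r * r) / (r * (1 + r))"
    using r by (simp add: divide_simps) (simp add: algebra_simps)
  also have "\<dots> = - \<tau> / (r * (1 + r))" by (simp add: r2)
  finally have "\<bar>1 / r - 1\<bar> = \<bar>\<tau>\<bar> / (r * (1 + r))"
    using r by (simp add: abs_divide abs_mult)
  also have "\<dots> \<le> \<bar>\<tau>\<bar> / (1 / 2 * 1)"
    using r by (intro divide_left_mono mult_mono mult_pos_pos) auto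
  finally show ?thesis by (simp add: r_def)
qed

text \<open>Between s and s / sqrt (1 + \<tau>) every z has z^2 \<ge> 2/3 s^2, so the density is at
  most 3 / (2 s^2), while the distance is at most 2 |\<tau>| |s|. The form with the factor |s| fits
  the application, where \<tau> is proportional to s and the quotient is uniform in s.\<close>

lemma Phi_rescale:
  assumes "\<bar>\<tau>\<bar> \<le> 1 / 2"
  shows "\<bar>Phi (s / sqrt (1 + \<tau>)) - Phi s\<bar> * \<bar>s\<bar> \<le> 3 * \<bar>\<tau>\<bar>"
proof (cases "s = 0")
  case False
  define q where "q = s / sqrt (1 + \<tau>)"
  have q2: "q\<^sup>2 = s\<^sup>2 / (1 + \<tau>)" using assms by (simp add: q_def power_divide)
  \<comment> \<open>The 2/3 is the reciprocal of the largest possible 1 + \<tau> = 3/2.\<close>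
  have "2 / 3 * s\<^sup>2 \<le> q\<^sup>2"
  proof -
    have "s\<^sup>2 / (3 / 2) \<le> s\<^sup>2 / (1 + \<tau>)" using assms by (intro divide_left_mono) auto
    then show ?thesis by (simp add: q2)
  qed
  moreover have "2 / 3 * s\<^sup>2 \<le> s\<^sup>2" by simp
  moreover have "0 \<le> s \<longleftrightarrow> 0 \<le> q"
  proof -
    have "sqrt (1 + \<tau>) > 0" using assms by (simp add: abs_le_iff)
    then show ?thesis unfolding q_def by (subst pos_le_divide_eq) auto
  qed
  ultimately have z2: "2 / 3 * s\<^sup>2 \<le> z\<^sup>2" if "z \<in> {min s q..max s q}" for z
  proof -
    have "s\<^sup>2 \<le> z\<^sup>2 \<or> q\<^sup>2 \<le> z\<^sup>2"
    proof (cases "0 \<le> s")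
      case True
      then have "0 \<le> q" using \<open>0 \<le> s \<longleftrightarrow> 0 \<le> q\<close> by simp
      then show ?thesis using True that by (auto intro!: power_mono simp: min_def split: if_splits)
    next
      case False
      then have "q < 0" using \<open>0 \<le> s \<longleftrightarrow> 0 \<le> q\<close> by simp
      then show ?thesis using False that abs_le_square_iff[of s z] abs_le_square_iff[of q z]
        by (auto simp: max_def split: if_splits)
    qed
    then show ?thesis
      using \<open>2 / 3 * s\<^sup>2 \<le> q\<^sup>2\<close> \<open>2 / 3 * s\<^sup>2 \<le> s\<^sup>2\<close> by linarith
  qed
  have pos: "0 < 2 / 3 * s\<^sup>2" using False by simp
  have "\<bar>Phi q - Phi s\<bar> \<le> \<bar>q - s\<bar> / (2 / 3 * s\<^sup>2)"
    by (rule Phi_diff_le_inverse_square[OF pos z2])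
  also have "\<bar>q - s\<bar> = \<bar>s\<bar> * \<bar>1 / sqrt (1 + \<tau>) - 1\<bar>"
    unfolding abs_mult[symmetric] by (simp add: q_def algebra_simps)
  also have "\<bar>s\<bar> * \<bar>1 / sqrt (1 + \<tau>) - 1\<bar> / (2 / 3 * s\<^sup>2) \<le> \<bar>s\<bar> * (2 * \<bar>\<tau>\<bar>) / (2 / 3 * s\<^sup>2)"
    using inverse_sqrt_diff_le[OF assms] pos by (intro divide_right_mono mult_left_mono) auto
  also have "\<dots> = 3 * \<bar>\<tau>\<bar> / \<bar>s\<bar>"
    using False by (simp add: power2_eq_square field_simps)
  finally show ?thesis
    using False by (simp add: q_def field_simps)
qed simp

theorem theorem1p2:
  fixes M :: "'a measure" and U :: "nat \<Rightarrow> 'a \<Rightarrow> real"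
  assumes "prob_space M"
    and "prob_space.indep_vars M (\<lambda>_. borel) U {1..}"
    and "\<And>i. i \<ge> 1 \<Longrightarrow> distributed M lborel (U i) (indicator {0..1})"
  shows "\<exists>C::real. C \<ge> 0 \<and> (\<forall>n::nat. n \<ge> 1 \<longrightarrow>
           (SUP x::real. \<bar>measure M {\<omega> \<in> space M.
               sqrt (real n ^ 3 / (16 * ln 2 - 10)) * (kakutani_max (\<lambda>i. U i \<omega>) n - 2 / real n) \<le> x}
             - Phi x\<bar>) \<le> C / sqrt (real n))"
proof -
  interpret prob_space M by fact
  obtain C0 where "C0 \<ge> 0" and C0: "\<And>x n. 2 < x \<Longrightarrow>
     \<bar>(\<Sum>k\<le>n. split_prob k x) - Phi ((real n + 1 - 2 * x) / sqrt (var_rate * x))\<bar> \<le> C0 / sqrt x"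
    using split_count_berry_esseen by blast
  define v where "v = var_rate"
  have v: "1 / 3 \<le> v" "v \<le> 3" using var_rate_ge var_rate_le by (auto simp: v_def)
  \<comment> \<open>Twice the variance rate: at x near n / 2 the count has variance v n / 2, and
    converting it into a fluctuation of the maximum around 2 / n multiplies by 4 / n^4, which leaves
    2 v / n^3.\<close>
  define \<sigma> where "\<sigma> = sqrt (2 * v)"
  have \<sigma>: "\<sigma> > 0" "\<sigma>\<^sup>2 = 2 * v" using v by (auto simp: \<sigma>_def)
  have \<sigma>2: "16 * ln 2 - 10 = \<sigma>\<^sup>2" by (simp add: \<sigma>(2) v_def var_rate_def)
  define F where "F n s = measure M {\<omega> \<in> space M.
      sqrt (real n ^ 3 / (16 * ln 2 - 10)) * (kakutani_max (\<lambda>i. U i \<omega>) n - 2 / real n) \<le> s}" for n s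
  define C1 where "C1 = C0 * 2 + 3 + 3 * \<sigma> / 2"
  define C where "C = C1 + \<sigma>\<^sup>2 + 3"
  have C1: "C1 \<ge> 0" using \<open>C0 \<ge> 0\<close> \<sigma> by (simp add: C1_def)
  have F01: "0 \<le> F n s" "F n s \<le> 1" for n s by (auto simp: F_def)
  have iff: "sqrt (real n ^ 3 / (16 * ln 2 - 10)) * (m - 2 / real n) \<le> s \<longleftrightarrow>
      m \<le> 2 / real n * (1 + s * \<sigma> / (2 * sqrt (real n)))" if "n \<ge> 1" for n m s
  proof -
    have n: "real n > 0" using that by simp
    have "real n ^ 3 = (real n * sqrt (real n))\<^sup>2" by (simp add: power_mult_distrib power3_eq_cube power2_eq_square)
    then have sq: "sqrt (real n ^ 3 / (16 * ln 2 - 10)) = real n * sqrt (real n) / \<sigma>"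
      unfolding \<sigma>2 using \<sigma> n by (simp add: real_sqrt_divide real_sqrt_unique)
    define k where "k = real n * sqrt (real n) / \<sigma>"
    have k: "k > 0" using n \<sigma> by (simp add: k_def)
    have "k * (m - 2 / real n) \<le> s \<longleftrightarrow> m - 2 / real n \<le> s / k"
      using k by (simp add: pos_le_divide_eq mult.commute)
    also have "s / k = 2 / real n * (s * \<sigma> / (2 * sqrt (real n)))"
      using n \<sigma> by (simp add: k_def)
    finally show ?thesis
      unfolding sq k_def[symmetric] by (simp add: algebra_simps)
  qed
  have F_mono: "F n s \<le> F n s'" if "s \<le> s'" "n \<ge> 1" for n s s'
  proof -
    have [measurable]: "(\<lambda>\<omega>. kakutani_max (\<lambda>i. U i \<omega>) n) \<in> borel_measurable M"
      using prob_kakutani_max_le(2)[OF assms, of 1 n] that by simp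
    show ?thesis
      unfolding F_def using that by (intro finite_measure_mono) auto
  qed
  \<comment> \<open>The range of s is the one where \<tau> has modulus at most 1/2, and n \<ge> 7
    then gives x \<ge> n / 3 > 2, as the Berry-Esseen bound for the count requires.\<close>
  have core: "\<bar>F n s - Phi s\<bar> \<le> C1 / sqrt (real n)" if "n \<ge> 7" "\<bar>s\<bar> \<le> sqrt (real n) / \<sigma>" for n s
  proof -
    have n: "real n \<ge> 7" "real n > 0" "sqrt (real n) > 0" using that(1) by auto
    define \<tau> where "\<tau> = s * \<sigma> / (2 * sqrt (real n))"
    have \<tau>: "\<bar>\<tau>\<bar> \<le> 1 / 2"
    proof -
      have "\<bar>\<tau>\<bar> = \<bar>s\<bar> * \<sigma> / (2 * sqrt (real n))" using \<sigma> n by (simp add: \<tau>_def abs_mult)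
      also have "\<dots> \<le> (sqrt (real n) / \<sigma>) * \<sigma> / (2 * sqrt (real n))"
        using that(2) \<sigma> n by (intro divide_right_mono mult_right_mono) auto
      finally show ?thesis using \<sigma> n by simp
    qed
    define t where "t = 2 / real n * (1 + \<tau>)"
    have t: "t > 0" using \<tau> n by (simp add: t_def abs_le_iff)
    define x where "x = 1 / t"
    have x_eq: "x = real n / (2 * (1 + \<tau>))" using n by (simp add: x_def t_def)
    have x_ge: "real n / 3 \<le> x"
      unfolding x_eq using \<tau> n by (intro divide_left_mono) auto
    have "x > 2" using x_ge n by simp
    have "F n s = (\<Sum>k\<le>n. split_prob k x)"
      unfolding F_def x_def using prob_kakutani_max_le(1)[OF assms t, of n] that(1) iff[of n]
      by (simp add: t_def \<tau>_def)
    then have 1: "\<bar>F n s - Phi ((real n + 1 - 2 * x) / sqrt (v * x))\<bar> \<le> C0 / sqrt x"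
      using C0[OF \<open>x > 2\<close>, of n] by (simp add: v_def)
    have 2: "C0 / sqrt x \<le> C0 * 2 / sqrt (real n)"
    proof -
      have "sqrt (real n) \<le> sqrt (4 * x)" using x_ge n by simp
      then have "sqrt (real n) / 2 \<le> sqrt x" by (simp add: real_sqrt_mult)
      then have "C0 / sqrt x \<le> C0 / (sqrt (real n) / 2)"
        using \<open>C0 \<ge> 0\<close> n \<open>x > 2\<close> by (intro divide_left_mono) auto
      then show ?thesis by simp
    qed
    have vx: "sqrt (real n) / 3 \<le> sqrt (v * x)"
    proof -
      have "(1 / 3) * (real n / 3) \<le> v * x" using v x_ge n by (intro mult_mono) auto
      then have "sqrt (real n / 9) \<le> sqrt (v * x)" by simp
      then show ?thesis by (simp add: real_sqrt_divide)
    qed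
    have vx0: "sqrt (v * x) > 0" using vx n by (meson divide_pos_pos less_le_trans zero_less_numeral)
    \<comment> \<open>An exact identity: mean shift and standard deviation both depend on \<tau>,
      and together they leave just the factor 1 / sqrt (1 + \<tau>).\<close>
    have main: "(real n - 2 * x) / sqrt (v * x) = s / sqrt (1 + \<tau>)"
    proof -
      have t1: "1 + \<tau> > 0" using \<tau> by (simp add: abs_le_iff)
      have "real n - 2 * x = real n * \<tau> / (1 + \<tau>)"
        unfolding x_eq using t1 by (simp add: field_simps)
      also have "real n * \<tau> = s * (\<sigma> / 2 * sqrt (real n))"
      proof -
        define r where "r = sqrt (real n)"
        have r: "r > 0" "real n = r * r" using n by (auto simp: r_def)
        show ?thesis
          unfolding \<tau>_def r_def[symmetric] unfolding r(2) using r(1) by simp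
      qed
      finally have num: "real n - 2 * x = s * (\<sigma> / 2 * sqrt (real n)) / (1 + \<tau>)" .
      have "v * x = (\<sigma> / 2)\<^sup>2 * real n / (1 + \<tau>)"
        using t1 by (simp add: x_eq power_divide \<sigma>(2) field_simps)
      then have den: "sqrt (v * x) = \<sigma> / 2 * sqrt (real n) / sqrt (1 + \<tau>)"
        using \<sigma> by (simp add: real_sqrt_divide real_sqrt_mult)
      define w where "w = sqrt (1 + \<tau>)"
      have w: "w > 0" "1 + \<tau> = w * w" using t1 by (auto simp: w_def)
      show ?thesis
        unfolding num den w_def[symmetric] unfolding w(2) using w(1) n \<sigma> by (simp add: field_simps)
    qed
    \<comment> \<open>The 1 comes from n splits producing n + 1 pieces. It moves the argument by 1 /
      sqrt (v x), within the error allowed.\<close>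
    have 3: "\<bar>Phi ((real n + 1 - 2 * x) / sqrt (v * x)) - Phi (s / sqrt (1 + \<tau>))\<bar> \<le> 3 / sqrt (real n)"
    proof -
      have "\<bar>Phi ((real n + 1 - 2 * x) / sqrt (v * x)) - Phi (s / sqrt (1 + \<tau>))\<bar> \<le>
          \<bar>(real n + 1 - 2 * x) / sqrt (v * x) - (real n - 2 * x) / sqrt (v * x)\<bar>"
        unfolding main[symmetric] by (rule Phi_lipschitz)
      also have "(real n + 1 - 2 * x) / sqrt (v * x) - (real n - 2 * x) / sqrt (v * x) = 1 / sqrt (v * x)"
        by (simp add: diff_divide_distrib[symmetric])
      also have "\<bar>1 / sqrt (v * x)\<bar> = 1 / sqrt (v * x)"
        using vx0 by simp
      also have "\<dots> \<le> 1 / (sqrt (real n) / 3)"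
        using n vx0 by (intro divide_left_mono vx mult_pos_pos) auto
      finally show ?thesis by simp
    qed
    have 4: "\<bar>Phi (s / sqrt (1 + \<tau>)) - Phi s\<bar> \<le> 3 * \<sigma> / 2 / sqrt (real n)"
    proof (cases "s = 0")
      case False
      have "\<bar>Phi (s / sqrt (1 + \<tau>)) - Phi s\<bar> * \<bar>s\<bar> \<le> 3 * \<bar>\<tau>\<bar>" by (rule Phi_rescale[OF \<tau>])
      also have "\<bar>\<tau>\<bar> = \<bar>s\<bar> * \<sigma> / (2 * sqrt (real n))" using \<sigma> n by (simp add: \<tau>_def abs_mult)
      also have "3 * (\<bar>s\<bar> * \<sigma> / (2 * sqrt (real n))) = (3 * \<sigma> / 2 / sqrt (real n)) * \<bar>s\<bar>"
        by simp
      finally have *: "\<bar>Phi (s / sqrt (1 + \<tau>)) - Phi s\<bar> * \<bar>s\<bar> \<le> (3 * \<sigma> / 2 / sqrt (real n)) * \<bar>s\<bar>" .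
      show ?thesis by (rule mult_right_le_imp_le[OF *]) (use False in simp)
    qed (use \<sigma> in simp)
    have "\<bar>F n s - Phi s\<bar> \<le> C0 * 2 / sqrt (real n) + 3 / sqrt (real n) + 3 * \<sigma> / 2 / sqrt (real n)"
      using 1 2 3 4 by linarith
    also have "\<dots> = C1 / sqrt (real n)" by (simp add: C1_def add_divide_distrib)
    finally show ?thesis .
  qed
  have "\<bar>F n s - Phi s\<bar> \<le> C / sqrt (real n)" if "n \<ge> 1" for n s
  \<comment> \<open>For n \<le> 6 the claim is trivial: sqrt n \<le> 3 \<le> C, and two
    probabilities differ by at most 1.\<close>
  proof (cases "n \<ge> 7")
    case False
    then have "sqrt (real n) \<le> sqrt (3\<^sup>2)" by (intro real_sqrt_le_mono) auto
    then have "sqrt (real n) \<le> 3" by simp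
    moreover have "3 \<le> C" using C1 by (simp add: C_def)
    ultimately have "1 \<le> C / sqrt (real n)" using that by (simp add: le_divide_eq)
    then show ?thesis using F01[of n s] Phi_bounds[of s] by linarith
  next
    case True
    define s0 where "s0 = sqrt (real n) / \<sigma>"
    have n: "real n > 0" "sqrt (real n) > 0" using True by auto
    have s0: "s0 > 0" using n \<sigma> by (simp add: s0_def)
    have tail: "1 / s0\<^sup>2 \<le> \<sigma>\<^sup>2 / sqrt (real n)"
    proof -
      have "sqrt (real n) \<le> real n" using True by (intro real_le_lsqrt) (auto simp: power2_eq_square)
      then have le: "\<sigma>\<^sup>2 / real n \<le> \<sigma>\<^sup>2 / sqrt (real n)" using n by (intro divide_left_mono) auto
      have "1 / s0\<^sup>2 = \<sigma>\<^sup>2 / real n" using n by (simp add: s0_def power_divide)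
      also note le
      finally show ?thesis .
    qed
    have sum: "C1 / sqrt (real n) + \<sigma>\<^sup>2 / sqrt (real n) \<le> C / sqrt (real n)"
      using n by (simp add: C_def add_divide_distrib[symmetric] divide_right_mono)
    have s0_nonneg: "0 \<le> \<sigma>\<^sup>2 / sqrt (real n)" using n by simp
    \<comment> \<open>Outside the range of \<open>core\<close>, both functions are monotone and
      already within O(1 / sqrt n) of 0 or 1 at the end points \<plusminus>s0: \<Phi> by
      \<open>Phi_tail\<close>, and F by comparison with \<Phi> there.\<close>
    consider "\<bar>s\<bar> \<le> s0" | "s0 < s" | "s < - s0" by linarith
    then show ?thesis
    proof cases
      case 1
      then show ?thesis using core[OF True, of s] sum s0_nonneg unfolding s0_def by linarith
    next
      case 2
      then have "F n s0 \<le> F n s" "Phi s0 \<le> Phi s" using F_mono[of s0 s n] Phi_mono[of s0 s] that by auto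
      moreover have "\<bar>F n s0 - Phi s0\<bar> \<le> C1 / sqrt (real n)"
        using core[OF True, of s0] s0 unfolding s0_def by simp
      ultimately show ?thesis
        using F01[of n s] Phi_bounds[of s] Phi_tail(1)[OF s0] tail sum C1 n by linarith
    next
      case 3
      then have "F n s \<le> F n (- s0)" "Phi s \<le> Phi (- s0)" using F_mono[of s "- s0" n] Phi_mono[of s "- s0"] that by auto
      moreover have "\<bar>F n (- s0) - Phi (- s0)\<bar> \<le> C1 / sqrt (real n)"
        using core[OF True, of "- s0"] s0 unfolding s0_def by simp
      ultimately show ?thesis
        using F01[of n s] Phi_bounds[of s] Phi_tail(2)[OF s0] tail sum by linarith
    qed
  qed
  then have "(SUP s. \<bar>F n s - Phi s\<bar>) \<le> C / sqrt (real n)" if "n \<ge> 1" for n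
    using that by (intro cSUP_least) auto
  moreover have "C \<ge> 0" using C1 by (simp add: C_def)
  ultimately show ?thesis
    unfolding F_def by blast
qed

end
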